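(* Let $a\in(0,1)$, let $m$ be a positive integer and let $p$ be a real number, not an even integer, with $0<p<2m$. Let $P_m(z,p,a)$ be the polynomial of degree at most $2m$ of best uniform approximation to $|x|^p$ on $[-1,-a]\cup[a,1]$, and let $E=E_{2m}(p,a)$ be the approximation error. Then there is a curve $\gamma=\gamma_m(p,a)$ inside the half-strip $$\{w=u+iv:\ u\in(0,(m+1)\pi),\ v>0\}$$ such that the extremal polynomial possesses the representation $$P_m(z,p,a)=z^p+(-1)^{[p/2]}E\cos\phi_m(z,p,a),$$ where $\phi_m(z,p,a)$ is the conformal map of the first quadrant onto the region $\Omega_m(p,a)$ in this half-strip bounded on the left by $\gamma_m(p,a)$, normalized by $\phi_m(a,p,a)=0$, $\phi_m(1,p,a)=(m+1)\pi$ and $\phi_m(\infty,p,a)=\infty$. Moreover, the curve $\gamma$ is the image of the imaginary half-axis $\{iy: y>0\}$ under this conformal map, and it satisfies the functional equation $$\gamma_m(p,a)=\Bigl\{u+iv=\phi_m(iy,p,a):\ E\sin u(y)\,\sinh v(y)=\Bigl|\sin\frac{\pi p}{2}\Bigr|\,y^p,\ y>0\Bigr\},$$ that is, writing $\phi_m(iy,p,a)=u(y)+iv(y)$, one has $E\sin u(y)\sinh v(y)=\left|\sin\frac{\pi p}{2}\right|y^p$ for all $y>0$.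
   Context: The approximation error is $E_{2m}(p,a)=\min_{\deg P\le 2m}\ \max_{a\le|x|\le1}\bigl||x|^p-P(x)\bigr|$, and $P_m(\cdot,p,a)$ is the minimizing polynomial. $[\,\cdot\,]$ denotes the integer part, and $z^p$ is the branch in the first quadrant $\{\operatorname{Re}z>0,\operatorname{Im}z>0\}$ that is positive for $z>0$. The conformal map is understood to be extended to the boundary of the quadrant. *)

theory Defs
  imports "HOL-Complex_Analysis.Complex_Analysis" "HOL-Computational_Algebra.Polynomial"
begin

definition approx_set :: "real \<Rightarrow> real set" where
  "approx_set a = {x. a \<le> \<bar>x\<bar> \<and> \<bar>x\<bar> \<le> 1}"

(* The set is compact and the function continuous (for 0 < p), so for 0 < a < 1 the
   supremum is a maximum. *)
definition max_error :: "real \<Rightarrow> real \<Rightarrow> real poly \<Rightarrow> real" where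
  "max_error p a P = (SUP x\<in>approx_set a. \<bar>\<bar>x\<bar> powr p - poly P x\<bar>)"

definition approx_error :: "nat \<Rightarrow> real \<Rightarrow> real \<Rightarrow> real" where
  "approx_error n p a = (INF P\<in>{P. degree P \<le> n}. max_error p a P)"

definition best_approx :: "nat \<Rightarrow> real \<Rightarrow> real \<Rightarrow> real poly \<Rightarrow> bool" where
  "best_approx n p a P \<longleftrightarrow> degree P \<le> n \<and> max_error p a P = approx_error n p a"

definition first_quadrant :: "complex set" where
  "first_quadrant = {z. 0 < Re z \<and> 0 < Im z}"

definition half_strip :: "nat \<Rightarrow> complex set" where
  "half_strip m = {w. 0 < Re w \<and> Re w < real (m + 1) * pi \<and> 0 < Im w}"

(* Omega is the region in the half-strip bounded on the left by the curve gamma: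
   it is a component of the complement of gamma in the half-strip, gamma is the whole
   part of its boundary lying inside the half-strip, it reaches the right edge of the
   half-strip everywhere, and gamma cuts it off from the left edge except possibly
   for a bounded piece of that edge. *)
definition bounded_on_left_by :: "nat \<Rightarrow> complex set \<Rightarrow> complex set \<Rightarrow> bool" where
  "bounded_on_left_by m \<gamma> \<Omega> \<longleftrightarrow>
     \<Omega> \<in> components (half_strip m - \<gamma>) \<and>
     frontier \<Omega> \<inter> half_strip m = \<gamma> \<and>
     {w. Re w = real (m + 1) * pi \<and> 0 < Im w} \<subseteq> frontier \<Omega> \<and>
     bounded ({w. Re w = 0 \<and> 0 < Im w} \<inter> frontier \<Omega>)"

(* A conformal map of the first quadrant onto Omega, extended continuously to the
   closed quadrant; the values of \<phi> outside the closed quadrant are irrelevant. *)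
definition normalized_conformal_map ::
    "nat \<Rightarrow> real \<Rightarrow> complex set \<Rightarrow> (complex \<Rightarrow> complex) \<Rightarrow> bool" where
  "normalized_conformal_map m a \<Omega> \<phi> \<longleftrightarrow>
     \<phi> holomorphic_on first_quadrant \<and>
     bij_betw \<phi> first_quadrant \<Omega> \<and>
     continuous_on (closure first_quadrant) \<phi> \<and>
     \<phi> (of_real a) = 0 \<and>
     \<phi> 1 = of_real (real (m + 1) * pi) \<and>
     filterlim \<phi> at_infinity (inf at_infinity (principal (closure first_quadrant)))"

end

theory Submission
  imports Defs
begin

text \<open>Put \<open>w = z\<^sup>2\<close> and \<open>s = p / 2\<close>. The set and the function are symmetric, so \<open>P(z) = Q(z\<^sup>2)\<close>, where \<open>Q\<close>
  is a best approximation of degree at most \<open>m\<close> to \<open>t powr s\<close> on \<open>[a\<^sup>2, 1]\<close>. The first quadrant becomes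
  the upper half-plane, the imaginary half-axis becomes the negative real axis, and the claim is that
  the normalized error \<open>g(w) = (-1)\<^bsup>[s]\<^esup> (Q(w) - w\<^sup>s) / E\<close> equals \<open>cos \<phi>(w)\<close> for a conformal map \<open>\<phi>\<close> of
  the upper half-plane. Three facts make this work.

  First, the real error behaves like a cosine. Differentiating \<open>Q(t) - t powr s\<close> often enough kills the
  polynomial, so Rolle's theorem leaves at most \<open>m\<close> positive critical points. A polynomial of degree
  \<open>m\<close> can interpolate the error at \<open>m + 1\<close> points and hence reduce it if there are no more extremal
  points; so there are exactly \<open>m + 2\<close> of them, namely both endpoints and all the critical points, and
  between consecutive ones the error is strictly monotone, from one of the values \<open>\<plusminus>E\<close> to the other
  (\<open>extremal_points_exist\<close>, \<open>extremal_error_signs\<close>).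

  Second, \<open>g\<close> omits \<open>[-1, 1]\<close> in the upper half-plane and \<open>g'\<close> has no zero there. If a function
  \<open>R(w) + k w\<^sup>s\<close> with a real polynomial \<open>R\<close> of degree at most \<open>n > s\<close> has \<open>n\<close> positive zeros, divide it by
  the polynomial with these zeros. The quotient is real on the positive axis, its imaginary part has
  one sign on the negative axis and tends to \<open>0\<close> at infinity; by the maximum principle this imaginary
  part does not vanish in the upper half-plane (\<open>quasi_poly_complex_nonzero\<close>). The functions \<open>g - c\<close>
  with \<open>-1 < c < 1\<close> and \<open>w g'(w)\<close> have this form.

  Third, \<open>g\<close> therefore has a holomorphic inverse cosine \<open>\<phi>\<close> with positive imaginary part, and its
  boundary values can be followed along the real axis: \<open>(0, a\<^sup>2)\<close> goes to the left edge of the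
  half-strip, the \<open>m + 1\<close> intervals between extremal points go to the \<open>m + 1\<close> segments of length \<open>\<pi>\<close>
  of the base, \<open>(1, \<infinity>)\<close> goes to the right edge, and the negative axis, where \<open>Im g < 0\<close>, goes to a curve
  \<open>\<gamma>\<close> with \<open>0 < u < \<pi>\<close> that satisfies \<open>sin u sinh v = - Im g\<close>. Since \<open>\<phi>\<close> is proper, a connected set
  that misses the image of the real axis lies inside the image of the upper half-plane or outside it
  (\<open>connected_subset_image\<close>). This excludes the complement of the half-strip and the part to
  the left of \<open>\<gamma>\<close>, so the image is a region of the half-strip bounded by \<open>\<gamma>\<close>. The set of values that are
  taken twice is open and closed in the image and has no point near a point of the right edge, hence
  is empty (\<open>inj_phi\<close>).\<close>

section \<open>Positive zeros of a polynomial minus a real power\<close>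

lemma less_of_steps:
  fixes x :: "nat \<Rightarrow> real"
  assumes "\<And>j. j \<le> m \<Longrightarrow> x j < x (Suc j)" and "i < j" "j \<le> Suc m"
  shows "x i < x j"
  using assms(2,3)
proof (induction j)
  case (Suc j)
  then show ?case using assms(1)[of j] by (cases "i = j") auto
qed simp

lemma inj_on_of_steps:
  fixes x :: "nat \<Rightarrow> real"
  assumes "\<And>j. j \<le> m \<Longrightarrow> x j < x (Suc j)"
  shows "inj_on x {..Suc m}"
proof (intro inj_onI)
  fix i j assume ij: "i \<in> {..Suc m}" "j \<in> {..Suc m}" "x i = x j"
  show "i = j"
    using less_of_steps[where x = x and m = m and i = i and j = j]
      less_of_steps[where x = x and m = m and i = j and j = i] assms ij
    by (cases i j rule: linorder_cases) auto
qed

lemma no_point_inside_step: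
  fixes x :: "nat \<Rightarrow> real"
  assumes steps: "\<And>j. j \<le> m \<Longrightarrow> x j < x (Suc j)" and "i \<le> Suc m" "j \<le> m"
  shows "x i \<le> x j \<or> x (Suc j) \<le> x i"
proof (cases "i \<le> j")
  case True
  then show ?thesis using less_of_steps[where x = x and m = m and i = i and j = j] assms by (cases "i = j") auto
next
  case False
  then show ?thesis using less_of_steps[where x = x and m = m and i = "Suc j" and j = i] assms
    by (cases "i = Suc j") auto
qed

text \<open>Iterated Rolle, with the zeros of the derivative located to the right of the first zero of the
  function: this is what makes the sign count in \<open>sign_before_zeros\<close> possible.\<close>

lemma zeros_of_derivative:
  fixes f f' :: "real \<Rightarrow> real"
  assumes der: "\<And>t. 0 < t \<Longrightarrow> (f has_real_derivative f' t) (at t)"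
  shows "finite Z \<Longrightarrow> card Z = Suc N \<Longrightarrow> Z \<subseteq> {0<..} \<Longrightarrow> (\<And>z. z \<in> Z \<Longrightarrow> f z = 0) \<Longrightarrow>
    \<exists>Z'. finite Z' \<and> card Z' = N \<and> (\<forall>z\<in>Z'. f' z = 0 \<and> Min Z < z)"
proof (induction N arbitrary: Z)
  case 0
  then show ?case by (intro exI[of _ "{}"]) auto
next
  case (Suc N)
  define a where "a = Min Z"
  define Y where "Y = Z - {a}"
  define b where "b = Min Y"
  have aZ: "a \<in> Z" using Suc.prems unfolding a_def by (intro Min_in) auto
  have cY: "card Y = Suc N" and fY: "finite Y" using Suc.prems aZ by (auto simp: Y_def)
  have bY: "b \<in> Y" using cY fY unfolding b_def by (intro Min_in) auto
  have "a \<le> b" using bY Suc.prems(1) unfolding a_def Y_def by auto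
  then have ab: "a < b" using bY Y_def by auto
  have a0: "0 < a" using aZ Suc.prems(3) by auto
  obtain Y' where Y': "finite Y'" "card Y' = N" "\<And>z. z \<in> Y' \<Longrightarrow> f' z = 0 \<and> b < z"
    using Suc.IH[OF fY cY] Suc.prems unfolding Y_def b_def by auto
  obtain c where c: "a < c" "c < b" "f b - f a = (b - a) * f' c"
    using MVT2[OF ab, of f f'] der a0 by auto
  have "f a = 0" "f b = 0" using aZ bY Suc.prems(4) Y_def by auto
  then have "f' c = 0" using c(3) ab by auto
  moreover have "c \<notin> Y'" using Y'(3) c(2) by force
  ultimately show ?case using Y' c ab unfolding a_def[symmetric]
    by (intro exI[of _ "insert c Y'"]) force
qed

text \<open>Counting zeros and determining signs at once. If \<open>D N\<close> has the sign of \<open>c\<close> everywhere and \<open>D 0\<close> has \<open>N\<close>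
  zeros beyond \<open>x\<close>, then by Rolle \<open>D 1\<close> has \<open>N - 1\<close> zeros beyond the first of them, so by induction
  \<open>D 1\<close> has a fixed sign up to that zero, and integrating back from the zero flips the sign once.
  With \<open>x\<close> itself a zero this is contradictory, which gives the bound in \<open>card_zeros_le\<close>.\<close>

lemma sign_before_zeros:
  fixes D :: "nat \<Rightarrow> real \<Rightarrow> real"
  assumes "\<And>k t. 0 < t \<Longrightarrow> (D k has_real_derivative D (Suc k) t) (at t)"
    and "\<And>t. 0 < t \<Longrightarrow> 0 < c * D N t"
    and "finite Z" "card Z = N" "\<And>z. z \<in> Z \<Longrightarrow> x < z \<and> D 0 z = 0" "0 < x"
  shows "0 < c * (- 1) ^ N * D 0 x"
  using assms
proof (induction N arbitrary: D Z x)
  case 0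
  then show ?case by auto
next
  case (Suc N)
  define b where "b = Min Z"
  have "Z \<noteq> {}" using Suc.prems(4) by auto
  then have bZ: "b \<in> Z" using Suc.prems(3) unfolding b_def by auto
  have xb: "x < b" "D 0 b = 0" using Suc.prems(5) bZ by auto
  have "Z \<subseteq> {0<..}" using Suc.prems(5,6) by force
  then obtain Y where Y: "finite Y" "card Y = N" "\<And>z. z \<in> Y \<Longrightarrow> D (Suc 0) z = 0 \<and> b < z"
    using zeros_of_derivative[of "D 0" "D (Suc 0)" Z N] Suc.prems unfolding b_def by blast
  obtain y where y: "x < y" "y < b" "D 0 b - D 0 x = (b - x) * D (Suc 0) y"
    using MVT2[OF xb(1), of "D 0" "D (Suc 0)"] Suc.prems(1,6) by auto
  have "0 < c * (- 1) ^ N * D (Suc 0) y"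
    using Suc.IH[of "\<lambda>k. D (Suc k)" Y y] Suc.prems(1,2,6) Y y(1,2) by force
  then have "0 < (b - x) * (c * (- 1) ^ N * D (Suc 0) y)" using xb by simp
  moreover have "D 0 x = - ((b - x) * D (Suc 0) y)" using y(3) xb by simp
  then have "c * (- 1) ^ Suc N * D 0 x = (b - x) * (c * (- 1) ^ N * D (Suc 0) y)" by simp
  ultimately show ?case by simp
qed

lemma card_zeros_le:
  fixes D :: "nat \<Rightarrow> real \<Rightarrow> real"
  assumes der: "\<And>k t. 0 < t \<Longrightarrow> (D k has_real_derivative D (Suc k) t) (at t)"
    and pos: "\<And>t. 0 < t \<Longrightarrow> 0 < c * D N t"
  shows "finite {t. 0 < t \<and> D 0 t = 0}" "card {t. 0 < t \<and> D 0 t = 0} \<le> N"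
proof -
  have "card Z \<le> N" if Z: "Z \<subseteq> {t. 0 < t \<and> D 0 t = 0}" "finite Z" for Z
  proof (rule ccontr)
    assume "\<not> card Z \<le> N"
    then obtain Y where Y: "Y \<subseteq> Z" "card Y = Suc N"
      by (metis not_less_eq_eq obtain_subset_with_card_n)
    then have fY: "finite Y" "Y \<noteq> {}" using Z finite_subset by auto
    define x where "x = Min Y"
    have xY: "x \<in> Y" "\<And>y. y \<in> Y \<Longrightarrow> x \<le> y" unfolding x_def using fY by auto
    have "0 < c * (- 1) ^ N * D 0 x"
    proof (rule sign_before_zeros[OF der pos])
      show "finite (Y - {x})" "card (Y - {x}) = N" using fY xY Y by auto
      show "\<And>z. z \<in> Y - {x} \<Longrightarrow> x < z \<and> D 0 z = 0" using xY Y(1) Z(1) by force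
      show "0 < x" using xY Y(1) Z(1) by auto
    qed auto
    then show False using xY Y(1) Z(1) by auto
  qed
  then show "finite {t. 0 < t \<and> D 0 t = 0}" "card {t. 0 < t \<and> D 0 t = 0} \<le> N"
    using finite_if_finite_subsets_card_bdd[of "{t. 0 < t \<and> D 0 t = 0}" N] by auto
qed

text \<open>The \<open>k\<close>-th derivative of \<open>Q(t) - t powr s\<close> on the positive axis, in closed form. All derivatives are
  kept in one family so that \<open>sign_before_zeros\<close> applies to any tail of it.\<close>

definition quasi_poly :: "real poly \<Rightarrow> real \<Rightarrow> nat \<Rightarrow> real \<Rightarrow> real" where
  "quasi_poly Q s k t = poly ((pderiv ^^ k) Q) t - (\<Prod>i<k. s - real i) * t powr (s - real k)"

lemma quasi_poly_0: "quasi_poly Q s 0 t = poly Q t - t powr s"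
  by (simp add: quasi_poly_def)

lemma quasi_poly_has_derivative:
  assumes "0 < t"
  shows "(quasi_poly Q s k has_real_derivative quasi_poly Q s (Suc k) t) (at t)"
  unfolding quasi_poly_def using assms
  by (auto intro!: derivative_eq_intros simp: algebra_simps)

lemma quasi_poly_top:
  assumes "degree Q < N"
  shows "quasi_poly Q s N t = - (\<Prod>i<N. s - real i) * t powr (s - real N)"
proof -
  have "degree ((pderiv ^^ k) Q) \<le> degree Q - k" for k
    by (induction k) (auto simp: degree_pderiv)
  moreover obtain M where N: "N = Suc M" using assms by (cases N) auto
  ultimately have "degree ((pderiv ^^ M) Q) = 0" using assms by (metis diff_is_0_eq le_zero_eq less_Suc_eq_le)
  then have "(pderiv ^^ N) Q = 0" by (simp add: N pderiv_eq_0_iff)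
  then show ?thesis by (simp add: quasi_poly_def)
qed

lemma card_zeros_quasi_poly:
  assumes "degree Q < N" and s: "\<And>i. i < N \<Longrightarrow> s \<noteq> real i"  and "k \<le> N"
  shows "finite {t. 0 < t \<and> quasi_poly Q s k t = 0}"
    and "card {t. 0 < t \<and> quasi_poly Q s k t = 0} \<le> N - k"
proof -
  have pos: "0 < - (\<Prod>i<N. s - real i) * quasi_poly Q s (k + (N - k)) t" if "0 < t" for t
  proof -
    have "(\<Prod>i<N. s - real i) \<noteq> 0" using s by auto
    then have "0 < (\<Prod>i<N. s - real i) * (\<Prod>i<N. s - real i) * t powr (s - real N)" 
      using that by (metis mult_pos_pos not_real_square_gt_zero powr_gt_zero less_numeral_extra(3))
    then show ?thesis using assms quasi_poly_top[OF assms(1), of s t] by (simp add: mult.assoc)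
  qed
  show "finite {t. 0 < t \<and> quasi_poly Q s k t = 0}" "card {t. 0 < t \<and> quasi_poly Q s k t = 0} \<le> N - k"
    using card_zeros_le[of "\<lambda>j. quasi_poly Q s (k + j)", OF _ pos] quasi_poly_has_derivative by auto
qed

text \<open>The factors \<open>s - i\<close> are positive up to \<open>i = [s]\<close> and negative from then on. This is where the sign
  \<open>(-1)\<^bsup>[p/2]\<^esup>\<close> of the representation comes from.\<close>

lemma sign_falling_product:
  assumes "0 < s" and "\<And>i::nat. s \<noteq> real i" and "s < real m"
  shows "0 < (- 1) ^ (m - nat \<lfloor>s\<rfloor>) * (\<Prod>i<Suc m. s - real i)"
proof -
  define n where "n = nat \<lfloor>s\<rfloor>"
  have "real n \<le> s" "s < real n + 1" using assms(1) by (auto simp: n_def)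
  then have n: "real n < s" "s < real n + 1" using assms(2)[of n] by auto
  then have "n < m" using assms(3) by linarith
  have "0 < (- 1) ^ j * (\<Prod>i<Suc (n + j). s - real i)" for j
  proof (induction j)
    case 0
    show ?case using n by (auto intro!: prod_pos simp del: prod.lessThan_Suc)
  next
    case (Suc j)
    have "s - real (n + Suc j) < 0" using n by simp
    then have "0 < - (s - real (n + Suc j)) * ((- 1) ^ j * (\<Prod>i<Suc (n + j). s - real i))"
      using Suc by (metis mult_pos_pos neg_0_less_iff_less)
    also have "\<dots> = (- 1) ^ Suc j * (\<Prod>i<Suc (n + Suc j). s - real i)"
      by (simp add: algebra_simps)
    finally show ?case .
  qed
  from this[of "m - n"] show ?thesis using \<open>n < m\<close> by (simp add: n_def)
qed

section \<open>Extremal points of the error\<close>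

lemma interpolating_poly_exists:
  fixes f :: "real \<Rightarrow> real"
  assumes "finite X"
  shows "\<exists>R. degree R \<le> card X - 1 \<and> (\<forall>x\<in>X. poly R x = f x)"
  using assms
proof induction
  case empty
  show ?case by (intro exI[of _ 0]) auto
next
  case (insert x X)
  then obtain R where R: "degree R \<le> card X - 1" "\<forall>x\<in>X. poly R x = f x" by auto
  define V where "V = (\<Prod>y\<in>X. [:- y, 1:])"
  have dV: "degree V \<le> card X"
    using degree_prod_sum_le[OF insert(1), of "\<lambda>y. [:- y, 1:]"] by (simp add: V_def)
  have Vx: "poly V x \<noteq> 0" using insert by (auto simp: V_def poly_prod)
  have VX: "poly V y = 0" if "y \<in> X" for y
    using insert that by (auto simp: V_def poly_prod)
  show ?case
  proof (intro exI conjI ballI)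
    let ?S = "R + smult ((f x - poly R x) / poly V x) V"
    show "degree ?S \<le> card (insert x X) - 1"
      using R(1) dV insert by (intro degree_add_le) auto
    show "poly ?S y = f y" if "y \<in> insert x X" for y
      using that R(2) Vx VX by auto
  qed
qed

text \<open>Kolmogorov's criterion: a correction \<open>R\<close> with the sign of the error at all extremal points improves the
  approximation. By compactness the points of \<open>K\<close> split into those where \<open>e R\<close> is bounded away from \<open>0\<close>,
  where a small multiple of \<open>R\<close> helps, and those where \<open>\<bar>e\<bar>\<close> is bounded away from \<open>E\<close>, where it does no harm.\<close>

lemma error_can_be_reduced:
  fixes e R :: "real \<Rightarrow> real"
  assumes "compact K" "continuous_on K e" "continuous_on K R" "0 < E"
    and le: "\<And>t. t \<in> K \<Longrightarrow> \<bar>e t\<bar> \<le> E"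
    and same: "\<And>t. t \<in> K \<Longrightarrow> \<bar>e t\<bar> = E \<Longrightarrow> 0 < e t * R t"
  shows "\<exists>\<epsilon>. \<forall>t\<in>K. \<bar>e t - \<epsilon> * R t\<bar> < E"
proof (cases "K = {}")
  case False
  \<comment> \<open>Positive everywhere, so its minimum \<open>d\<close> is the common margin of the two cases.\<close>
  define h where "h t = max (E - \<bar>e t\<bar>) (e t * R t)" for t
  have "continuous_on K h" unfolding h_def by (intro continuous_intros assms)
  then obtain t0 where t0: "t0 \<in> K" "\<And>t. t \<in> K \<Longrightarrow> h t0 \<le> h t"
    using continuous_attains_inf[OF assms(1) False] by blast
  define d where "d = h t0"
  have d: "0 < d" using le[OF t0(1)] same[OF t0(1)] by (cases "\<bar>e t0\<bar> = E") (auto simp: d_def h_def)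
  have "bounded (R ` K)" using assms(1,3) compact_continuous_image compact_imp_bounded by blast
  then obtain B where B: "\<And>t. t \<in> K \<Longrightarrow> \<bar>R t\<bar> \<le> B" by (auto simp: bounded_iff)
  define M where "M = max B 1"
  have M: "1 \<le> M" "\<And>t. t \<in> K \<Longrightarrow> \<bar>R t\<bar> \<le> M" using B unfolding M_def by (force simp: le_max_iff_disj)+
  define \<epsilon> where "\<epsilon> = d / (2 * M\<^sup>2)"
  have eps: "0 < \<epsilon>" "\<epsilon> * M\<^sup>2 = d / 2" using d M by (auto simp: \<epsilon>_def)
  have "\<bar>e t - \<epsilon> * R t\<bar> < E" if t: "t \<in> K" for t
  proof (cases "d \<le> E - \<bar>e t\<bar>")
    case True
    have "\<epsilon> * \<bar>R t\<bar> \<le> \<epsilon> * M" using eps M(2)[OF t] by simp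
    also have "\<dots> \<le> \<epsilon> * M\<^sup>2" using eps(1) M(1) by (simp add: power2_eq_square)
    finally have "\<bar>\<epsilon> * R t\<bar> < d" using eps d by (simp add: abs_mult)
    then show ?thesis using True by linarith
  next
    case False
    then have *: "d \<le> e t * R t" using t0(2)[OF t] by (auto simp: d_def h_def)
    have "(R t)\<^sup>2 \<le> M\<^sup>2" using M(2)[OF t] M(1) by (simp add: abs_le_square_iff[symmetric])
    then have "\<epsilon> * (\<epsilon> * (R t)\<^sup>2) \<le> \<epsilon> * (\<epsilon> * M\<^sup>2)" using eps(1) by simp
    moreover have "\<epsilon> * d \<le> \<epsilon> * (e t * R t)" using * eps(1) by simp
    moreover have "0 < \<epsilon> * d" using eps(1) d by simp
    moreover have "(e t)\<^sup>2 \<le> E\<^sup>2" using le[OF t] assms(4) by (simp add: abs_le_square_iff[symmetric])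
    moreover have "(e t - \<epsilon> * R t)\<^sup>2 = (e t)\<^sup>2 - 2 * (\<epsilon> * (e t * R t)) + \<epsilon> * (\<epsilon> * (R t)\<^sup>2)"
      by (simp add: power2_eq_square algebra_simps)
    ultimately have "(e t - \<epsilon> * R t)\<^sup>2 < E\<^sup>2" using eps(2) by simp
    then show ?thesis using assms(4) by (metis abs_of_pos power2_abs power2_less_imp_less less_imp_le)
  qed
  then show ?thesis by blast
qed auto

lemma same_sign_on_connected:
  fixes f :: "real \<Rightarrow> real"
  assumes "connected I" "continuous_on I f" "\<And>t. t \<in> I \<Longrightarrow> f t \<noteq> 0" "c \<in> I" "0 < f c" "t \<in> I"
  shows "0 < f t"
proof (rule ccontr)
  assume "\<not> 0 < f t"
  moreover have "connected (f ` I)" using assms connected_continuous_image by blast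
  ultimately have "0 \<in> f ` I"
    using assms by (meson connectedD_interval imageI less_imp_le not_le)
  then show False using assms(3) by auto
qed

text \<open>The extremal points of a best approximation lie among the two endpoints and the at most \<open>m\<close> critical
  points. Were there at most \<open>m + 1\<close> of them, the polynomial interpolating the error there would reduce it.
  So all the bounds are equalities: every endpoint and every positive critical point is extremal.\<close>

lemma extremal_points_exist:
  fixes Q :: "real poly" and b s E :: real
  defines "e \<equiv> quasi_poly Q s 0" and "e' \<equiv> quasi_poly Q s 1"
  assumes b: "0 < b" "b < 1" and deg: "degree Q \<le> m" and s: "\<And>i::nat. s \<noteq> real i"
    and le: "\<And>t. b \<le> t \<Longrightarrow> t \<le> 1 \<Longrightarrow> \<bar>e t\<bar> \<le> E"
    and best: "\<And>R. degree R \<le> m \<Longrightarrow> \<exists>t\<in>{b..1}. E \<le> \<bar>poly R t - t powr s\<bar>"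
  obtains x :: "nat \<Rightarrow> real" where "0 < E" "x 0 = b" "x (Suc m) = 1"
    "\<And>j. j \<le> m \<Longrightarrow> x j < x (Suc j)"
    "{t. 0 < t \<and> e' t = 0} = x ` {1..m}"
    "{t. b \<le> t \<and> t \<le> 1 \<and> \<bar>e t\<bar> = E} = x ` {..Suc m}"
proof -
  have der: "(e has_real_derivative e' t) (at t)" if "0 < t" for t
    using quasi_poly_has_derivative[OF that, of Q s 0] by (simp add: e_def e'_def)
  have cont: "continuous_on {b..1} e"
    using b by (intro continuous_at_imp_continuous_on ballI DERIV_isCont[OF der]) auto
  define C where "C = {t. 0 < t \<and> e' t = 0}"
  define X where "X = {t. b \<le> t \<and> t \<le> 1 \<and> \<bar>e t\<bar> = E}"
  have C: "finite C" "card C \<le> m"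
    using card_zeros_quasi_poly[of Q "Suc m" s 1] deg s by (auto simp: C_def e'_def)
  have XC: "X \<subseteq> {b, 1} \<union> (C \<inter> {b<..<1})"
  proof
    fix t assume t: "t \<in> X"
    show "t \<in> {b, 1} \<union> (C \<inter> {b<..<1})"
    proof (cases "t = b \<or> t = 1")
      case False
      then have tb: "b < t" "t < 1" using t by (auto simp: X_def)
      define d where "d = min (t - b) (1 - t)"
      have d: "0 < d" "\<And>y. \<bar>t - y\<bar> < d \<Longrightarrow> \<bar>e y\<bar> \<le> E" using tb le by (auto simp: d_def)
      have dt: "DERIV e t :> e' t" using der tb b by auto
      have "e' t = 0"
      proof (cases "0 \<le> e t")
        case True
        then have "e t = E" using t by (auto simp: X_def)
        then show ?thesis using d by (intro DERIV_local_max[OF dt d(1)]) force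
      next
        case False
        then have "e t = - E" using t by (auto simp: X_def)
        then show ?thesis using d by (intro DERIV_local_min[OF dt d(1)]) force
      qed
      then show ?thesis using tb b by (auto simp: C_def)
    qed auto
  qed
  then have finX: "finite X" using C(1) finite_subset by blast
  have "0 \<le> E" using le[of b] b by force
  moreover have "E \<noteq> 0"
  proof
    assume "E = 0"
    then have "{b..1} \<subseteq> X" using le by (force simp: X_def)
    then show False using finX b infinite_Icc finite_subset by blast
  qed
  ultimately have E: "0 < E" by simp
  have cardX: "m + 2 \<le> card X"
  proof (rule ccontr)
    assume "\<not> m + 2 \<le> card X"
    then have "card X - 1 \<le> m" by simp
    then obtain R where R: "degree R \<le> m" "\<forall>x\<in>X. poly R x = e x"
      using interpolating_poly_exists[OF finX, of e] order_trans by blast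
    have "\<exists>\<epsilon>. \<forall>t\<in>{b..1}. \<bar>e t - \<epsilon> * poly R t\<bar> < E"
    proof (rule error_can_be_reduced[OF _ cont _ E])
      show "\<And>t. t \<in> {b..1} \<Longrightarrow> \<bar>e t\<bar> = E \<Longrightarrow> 0 < e t * poly R t"
        using R(2) E by (auto simp: X_def) (metis abs_0 less_irrefl not_real_square_gt_zero)
    qed (auto intro!: continuous_intros le)
    then obtain \<epsilon> where \<epsilon>: "\<forall>t\<in>{b..1}. \<bar>e t - \<epsilon> * poly R t\<bar> < E" by blast
    have "degree (Q - smult \<epsilon> R) \<le> m"
      using deg R(1) by (intro degree_diff_le) (auto intro: order_trans[OF degree_smult_le])
    from best[OF this] \<epsilon> show False by (force simp: e_def quasi_poly_0 algebra_simps)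
  qed
  have cb: "card ({b, 1} \<union> (C \<inter> {b<..<1})) = 2 + card (C \<inter> {b<..<1})"
    using b C(1) by (subst card_Un_disjoint) auto
  have "card X \<le> card ({b, 1} \<union> (C \<inter> {b<..<1}))"
    using XC C(1) by (intro card_mono) auto
  \<comment> \<open>Both cardinalities are squeezed to \<open>m\<close>, so no critical point lies outside \<open>(b, 1)\<close>.\<close>
  then have "m \<le> card (C \<inter> {b<..<1})" using cardX cb by simp
  then have CC: "C \<inter> {b<..<1} = C" "card C = m"
    using C card_seteq[of C "C \<inter> {b<..<1}"] by (auto simp: card_mono)
  have X: "X = {b, 1} \<union> C"
    using card_seteq[OF _ XC] cardX cb CC C by auto
  have cX: "card X = m + 2" using cb CC X by simp
  define x where "x j = sorted_list_of_set X ! j" for j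
  have len: "length (sorted_list_of_set X) = m + 2" using cX finX by simp
  have inc: "x i < x j" if "i < j" "j \<le> Suc m" for i j
    unfolding x_def using that len
    by (intro sorted_wrt_nth_less[OF strict_sorted_list_of_set]) auto
  have "x ` {..<length (sorted_list_of_set X)} = set (sorted_list_of_set X)"
    unfolding set_conv_nth x_def by auto
  then have xX: "x ` {..Suc m} = X"
    unfolding len set_sorted_list_of_set[OF finX] by (simp only: add_2_eq_Suc' lessThan_Suc_atMost)
  have Xb: "\<And>t. t \<in> X \<Longrightarrow> b \<le> t \<and> t \<le> 1" by (simp add: X_def)
  have "b \<in> X" "1 \<in> X" unfolding X by auto
  then obtain i j where ij: "i \<le> Suc m" "x i = b" "j \<le> Suc m" "x j = 1" using xX by (metis atMost_iff imageE)
  have "x 0 \<in> X" "x (Suc m) \<in> X" using xX by auto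
  then have "b \<le> x 0" "x (Suc m) \<le> 1" using Xb by auto
  then have x0: "x 0 = b" and x1: "x (Suc m) = 1"
    using ij inc[of 0 i] inc[of j "Suc m"] by (cases "i = 0"; cases "j = Suc m"; simp)+
  have K: "k \<in> {1..m} \<longleftrightarrow> x k \<noteq> b \<and> x k \<noteq> 1" if "k \<le> Suc m" for k
  proof (cases "k = 0 \<or> k = Suc m")
    case True
    then show ?thesis using x0 x1 by auto
  next
    case False
    then show ?thesis using inc[of 0 k] inc[of k "Suc m"] x0 x1 that by simp
  qed
  have "x ` {1..m} = x ` {..Suc m} - {b, 1}"
  proof (intro equalityI subsetI)
    fix t assume "t \<in> x ` {1..m}"
    then obtain k where "t = x k" "k \<in> {1..m}" "k \<le> Suc m" by force
    then have "x k \<notin> {b, 1}" using K[of k] by simp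
    moreover have "x k \<in> x ` {..Suc m}" using \<open>k \<le> Suc m\<close> by (intro imageI) simp
    ultimately show "t \<in> x ` {..Suc m} - {b, 1}" unfolding \<open>t = x k\<close> by (intro DiffI)
  next
    fix t assume "t \<in> x ` {..Suc m} - {b, 1}"
    then obtain k where "t = x k" "k \<le> Suc m" "x k \<noteq> b" "x k \<noteq> 1" by (auto simp del: atMost_Suc)
    then show "t \<in> x ` {1..m}" using K[of k] by blast
  qed
  then have "x ` {1..m} = X - {b, 1}" using xX by argo
  moreover have "C \<subseteq> {b<..<1}" using CC(1) by blast
  then have "X - {b, 1} = C" unfolding X by force
  ultimately have xC: "C = x ` {1..m}" by argo
  show ?thesis
  proof (rule that[of x, OF E x0 x1])
    show "x j < x (Suc j)" if "j \<le> m" for j using inc[of j "Suc j"] that by simp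
    show "{t. 0 < t \<and> e' t = 0} = x ` {1..m}" using xC unfolding C_def .
    show "{t. b \<le> t \<and> t \<le> 1 \<and> \<bar>e t\<bar> = E} = x ` {..Suc m}" using xX unfolding X_def by simp
  qed
qed

text \<open>There are no critical points between consecutive extremal points, so the error is strictly monotone
  there and must pass from one of the values \<open>\<plusminus>E\<close> to the other. That fixes all signs up to one, and
  \<open>sign_before_zeros\<close>, applied to the derivative with its \<open>m\<close> zeros, provides that one.\<close>

lemma extremal_error_signs:
  fixes Q :: "real poly" and s E :: real and x :: "nat \<Rightarrow> real"
  assumes m: "0 < m" and s: "0 < s" "s < real m" "\<And>i::nat. s \<noteq> real i" 
    and deg: "degree Q \<le> m" and E: "0 < E"
    and x0: "0 < x 0" and inc: "\<And>j. j \<le> m \<Longrightarrow> x j < x (Suc j)"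
    and crit: "{t. 0 < t \<and> quasi_poly Q s 1 t = 0} = x ` {1..m}"
    and ext: "\<And>j. j \<le> Suc m \<Longrightarrow> \<bar>quasi_poly Q s 0 (x j)\<bar> = E"
  defines "\<sigma> \<equiv> (- 1) ^ nat \<lfloor>s\<rfloor> :: real"
  shows "degree Q = m"
    and "\<And>j. j \<le> Suc m \<Longrightarrow> \<sigma> * quasi_poly Q s 0 (x j) = (- 1) ^ j * E"
    and "\<And>t. 0 < t \<Longrightarrow> t < x 1 \<Longrightarrow> \<sigma> * quasi_poly Q s 1 t < 0"
    and "\<And>j t. j \<le> m \<Longrightarrow> x j < t \<Longrightarrow> t < x (Suc j) \<Longrightarrow> (- 1) ^ j * \<sigma> * quasi_poly Q s 1 t < 0"
    and "\<And>t. x m < t \<Longrightarrow> (- 1) ^ m * \<sigma> * quasi_poly Q s 1 t < 0"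
proof -
  define e where "e = quasi_poly Q s 0"
  define e' where "e' = quasi_poly Q s 1"
  have der: "(e has_real_derivative e' t) (at t)" if "0 < t" for t
    using quasi_poly_has_derivative[OF that, of Q s 0] by (simp add: e_def e'_def)
  have cont': "continuous_on {0<..} e'"
    unfolding e'_def
    by (intro continuous_at_imp_continuous_on ballI DERIV_isCont[OF quasi_poly_has_derivative]) auto
  have mono: "x i < x j" if "i < j" "j \<le> Suc m" for i j
    by (rule less_of_steps[where m = m]) (use inc that in auto)
  have xpos: "0 < x j" if "j \<le> Suc m" for j
    using that mono[of 0 j] x0 by (cases j) auto
  have "inj_on x {..Suc m}" by (rule inj_on_of_steps) (rule inc)
  then have inj: "inj_on x {1..m}" by (rule inj_on_subset) auto
  then have cardC: "card {t. 0 < t \<and> e' t = 0} = m"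
    using crit by (simp add: e'_def card_image)
  show deg': "degree Q = m"
  proof (rule ccontr)
    assume "degree Q \<noteq> m"
    then have "card {t. 0 < t \<and> e' t = 0} \<le> m - 1"
      using card_zeros_quasi_poly[of Q m s 1] deg s m unfolding e'_def by auto
    then show False using cardC m by simp
  qed
  have nz: "e' t \<noteq> 0" if "0 < t" "\<And>j. 1 \<le> j \<Longrightarrow> j \<le> m \<Longrightarrow> t \<noteq> x j" for t
  proof
    assume "e' t = 0"
    then have "t \<in> x ` {1..m}" using that(1) crit by (auto simp: e'_def set_eq_iff)
    then obtain j where "1 \<le> j" "j \<le> m" "t = x j" by auto
    then show False using that(2) by blast
  qed
  have sgn: "\<sigma> * \<sigma> = 1" "\<bar>\<sigma>\<bar> = 1" by (auto simp: \<sigma>_def power_mult_distrib[symmetric])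
  have first: "\<sigma> * e' t < 0" if t: "0 < t" "t < x 1" for t
  proof -
    define \<kappa> where "\<kappa> = (\<Prod>i<Suc m. s - real i)"
    have Pi: "0 < (- 1) ^ (m - nat \<lfloor>s\<rfloor>) * \<kappa>"
      using sign_falling_product[OF s(1,3,2)] by (simp add: \<kappa>_def)
    have "nat \<lfloor>s\<rfloor> \<le> m" using s(2) by linarith
    then have "(- 1) ^ (m - nat \<lfloor>s\<rfloor>) * \<sigma> = ((- 1) ^ m :: real)"
      by (simp add: \<sigma>_def power_add[symmetric])
    then have "0 < (- 1) ^ m * \<sigma> * \<kappa>"
      using Pi sgn by (metis (no_types, lifting) mult.assoc mult.right_neutral)
    have top: "quasi_poly Q s (Suc m) t = - \<kappa> * t powr (s - real (Suc m))" for t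
      using quasi_poly_top[of Q "Suc m" s t] deg by (simp add: \<kappa>_def)
    have "0 < (- ((- 1) ^ m * \<sigma>)) * (- 1) ^ m * quasi_poly Q s (Suc 0) t"
    proof (rule sign_before_zeros[where D = "\<lambda>k. quasi_poly Q s (Suc k)" and Z = "x ` {1..m}"])
      show "0 < - ((- 1) ^ m * \<sigma>) * quasi_poly Q s (Suc m) t" if "0 < t" for t
        using \<open>0 < (- 1) ^ m * \<sigma> * \<kappa>\<close> that unfolding top by (simp add: mult.assoc[symmetric])
      show "card (x ` {1..m}) = m" using inj by (simp add: card_image)
      show "t < z \<and> quasi_poly Q s (Suc 0) z = 0" if "z \<in> x ` {1..m}" for z
      proof
        obtain j where j: "z = x j" "1 \<le> j" "j \<le> m" using \<open>z \<in> x ` {1..m}\<close> by auto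
        then have "x 1 \<le> x j" using mono[of 1 j] by (cases "j = 1") auto
        then show "t < z" using t j by simp
        show "quasi_poly Q s (Suc 0) z = 0" using that crit by (auto simp: set_eq_iff)
      qed
    qed (use t quasi_poly_has_derivative in auto)
    also have "(- ((- 1) ^ m * \<sigma>)) * (- 1) ^ m * quasi_poly Q s (Suc 0) t = - (\<sigma> * e' t)"
    proof -
      have "(- 1) ^ m * (- 1) ^ m = (1 :: real)" by (simp add: power_mult_distrib[symmetric])
      moreover have "- (u * \<sigma>) * u * y = - ((u * u) * (\<sigma> * y))" for u y :: real
        by (simp add: mult_ac)
      ultimately show ?thesis by (simp add: e'_def del: power_mult_distrib)
    qed
    finally show ?thesis by simp
  qed
  then show "\<And>t. 0 < t \<Longrightarrow> t < x 1 \<Longrightarrow> \<sigma> * quasi_poly Q s 1 t < 0" by (simp add: e'_def)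
  have step: "\<exists>c. x j < c \<and> c < x (Suc j) \<and> e (x (Suc j)) - e (x j) = (x (Suc j) - x j) * e' c"
    if "j \<le> m" for j
    using MVT2[OF inc[OF that], of e e'] der xpos[of j] that by force
  have between: "e' t \<noteq> 0" if "j \<le> m" "x j < t" "t < x (Suc j)" for j t
  proof (rule nz)
    show "0 < t" using xpos[of j] that by simp
    fix i assume "1 \<le> i" "i \<le> m"
    have "x i \<le> x j \<or> x (Suc j) \<le> x i"
      by (rule no_point_inside_step[where m = m]) (use inc \<open>i \<le> m\<close> that(1) in auto)
    then show "t \<noteq> x i" using that by auto
  qed
  have flip: "e (x (Suc j)) = - e (x j)" if j: "j \<le> m" for j
  proof -
    obtain c where c: "x j < c" "c < x (Suc j)" "e (x (Suc j)) - e (x j) = (x (Suc j) - x j) * e' c"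
      using step[OF j] by auto
    then have "e (x (Suc j)) \<noteq> e (x j)" using between[OF j c(1,2)] inc[OF j] by auto
    moreover have "\<bar>e (x j)\<bar> = E" "\<bar>e (x (Suc j))\<bar> = E" using ext j by (auto simp: e_def)
    ultimately show ?thesis by (auto simp: abs_if split: if_splits)
  qed
  have e0: "\<sigma> * e (x 0) = E"
  proof -
    obtain c where c: "x 0 < c" "c < x (Suc 0)" "e (x (Suc 0)) - e (x 0) = (x (Suc 0) - x 0) * e' c"
      using step[of 0] by auto
    then have "\<sigma> * e' c < 0" using first[of c] x0 by simp
    then have "(x (Suc 0) - x 0) * (\<sigma> * e' c) < 0" using c by (simp add: mult_pos_neg)
    also have "(x (Suc 0) - x 0) * (\<sigma> * e' c) = \<sigma> * (e (x (Suc 0)) - e (x 0))" using c(3) by simp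
    finally have "0 < \<sigma> * e (x 0)" using flip[of 0] by simp
    moreover have "\<bar>\<sigma> * e (x 0)\<bar> = E" using sgn ext[of 0] by (simp add: abs_mult e_def)
    ultimately show ?thesis by simp
  qed
  have alt: "\<sigma> * e (x j) = (- 1) ^ j * E" if "j \<le> Suc m" for j
    using that by (induction j) (auto simp: e0 flip)
  then show "\<And>j. j \<le> Suc m \<Longrightarrow> \<sigma> * quasi_poly Q s 0 (x j) = (- 1) ^ j * E" by (simp add: e_def)
  have sign: "(- 1) ^ j * \<sigma> * e' t < 0"
    if j: "j \<le> m" and I: "connected I" "I \<subseteq> {0<..}" "{x j<..<x (Suc j)} \<subseteq> I" "t \<in> I"
      and nzI: "\<And>t. t \<in> I \<Longrightarrow> e' t \<noteq> 0" for j t and I :: "real set"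
  proof -
    obtain c where c: "x j < c" "c < x (Suc j)" "e (x (Suc j)) - e (x j) = (x (Suc j) - x j) * e' c"
      using step[OF j] by auto
    have "(x (Suc j) - x j) * ((- 1) ^ j * \<sigma> * e' c)
        = (- 1) ^ j * \<sigma> * (e (x (Suc j)) - e (x j))"
      unfolding c(3) by (simp add: mult_ac)
    also have "\<dots> = (- 1) ^ j * (\<sigma> * e (x (Suc j))) - (- 1) ^ j * (\<sigma> * e (x j))"
      by (simp add: algebra_simps)
    also have "\<dots> = - 2 * E" using alt[of j] alt[of "Suc j"] j
      by (simp add: mult.assoc[symmetric] power_mult_distrib[symmetric])
    also have "\<dots> < 0" using E by simp
    finally have neg: "(- 1) ^ j * \<sigma> * e' c < 0" using inc[OF j] by (simp add: mult_less_0_iff)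
    have "0 < - ((- 1) ^ j * \<sigma> * e' t)"
    proof (rule same_sign_on_connected[OF I(1), where c = c and f = "\<lambda>t. - ((- 1) ^ j * \<sigma> * e' t)" and t = t])
      show "continuous_on I (\<lambda>t. - ((- 1) ^ j * \<sigma> * e' t))"
        by (intro continuous_intros continuous_on_subset[OF cont' I(2)])
      show "- ((- 1) ^ j * \<sigma> * e' t) \<noteq> 0" if "t \<in> I" for t
        using nzI[OF that] by (simp add: \<sigma>_def)
    qed (use neg c I in auto)
    then show ?thesis by simp
  qed
  show "(- 1) ^ j * \<sigma> * quasi_poly Q s 1 t < 0" if "j \<le> m" "x j < t" "t < x (Suc j)" for j t
    using sign[OF that(1), of "{x j<..<x (Suc j)}" t] between[OF that(1)] that xpos[of j]
    by (force simp: e'_def)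
  show "(- 1) ^ m * \<sigma> * quasi_poly Q s 1 t < 0" if "x m < t" for t
  proof -
    have "e' t \<noteq> 0" if "t \<in> {x m<..}" for t
    proof (rule nz)
      show "0 < t" using xpos[of m] that by simp
      show "t \<noteq> x j" if "1 \<le> j" "j \<le> m" for j
        using mono[of j m] \<open>t \<in> {x m<..}\<close> that by (cases "j = m") force+
    qed
    then show ?thesis using sign[of m "{x m<..}" t] that xpos[of m] by (force simp: e'_def)
  qed
qed

section \<open>Zeros in the upper half-plane\<close>

lemma Im_nonpos_upper_half_plane:
  fixes F :: "complex \<Rightarrow> complex"
  assumes cont: "continuous_on {w. 0 \<le> Im w} F" and hol: "F holomorphic_on {w. 0 < Im w}"
    and inf: "\<And>\<epsilon>. 0 < \<epsilon> \<Longrightarrow> \<exists>r. \<forall>w. 0 \<le> Im w \<and> r \<le> cmod w \<longrightarrow> Im (F w) \<le> \<epsilon>"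
    and bd: "\<And>t. Im (F (of_real t)) \<le> 0" and w: "0 < Im w"
  shows "Im (F w) \<le> 0"
proof (rule field_le_epsilon)
  fix \<epsilon> :: real assume "0 < \<epsilon>"
  then obtain r where r: "\<And>w. 0 \<le> Im w \<Longrightarrow> r \<le> cmod w \<Longrightarrow> Im (F w) \<le> \<epsilon>" using inf by blast
  define R where "R = max r (cmod w)"
  define S where "S = {w. 0 \<le> Im w} \<inter> cball 0 R"
  have S: "closed S" "bounded S"
    unfolding S_def by (auto intro!: closed_Int closed_halfspace_Im_ge bounded_Int)
  have op: "open ({w. 0 < Im w} \<inter> ball 0 R)" by (intro open_Int open_halfspace_Im_gt open_ball)
  have int: "interior S \<subseteq> {w. 0 < Im w}"
    using interior_halfspace_ge[of \<i> 0] by (auto simp: S_def inner_complex_def)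
  have "Re (- \<i> * F w) \<le> \<epsilon>"
  proof (rule maximum_real_frontier[OF _ _ S(2), where f = "\<lambda>w. - \<i> * F w"])
    show "(\<lambda>w. - \<i> * F w) holomorphic_on interior S"
      using holomorphic_on_subset[OF hol int] by (intro holomorphic_intros)
    show "continuous_on (closure S) (\<lambda>w. - \<i> * F w)"
      using S(1) by (auto intro!: continuous_intros continuous_on_subset[OF cont] simp: S_def)
    show "w \<in> S" using w by (auto simp: S_def R_def)
    fix z assume z: "z \<in> frontier S"
    then have zS: "z \<in> S" using S(1) by (simp add: frontier_def)
    have "z \<notin> {w. 0 < Im w} \<inter> ball 0 R"
    proof
      assume "z \<in> {w. 0 < Im w} \<inter> ball 0 R"
      moreover have "{w. 0 < Im w} \<inter> ball 0 R \<subseteq> S" by (auto simp: S_def)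
      ultimately have "z \<in> interior S" using op interior_maximal by blast
      then show False using z by (simp add: frontier_def)
    qed
    then consider "Im z = 0" | "R \<le> cmod z" "0 \<le> Im z" using zS by (force simp: S_def)
    then show "Re (- \<i> * F z) \<le> \<epsilon>"
    proof cases
      case 1
      then have "z = of_real (Re z)" by (simp add: complex_eq_iff)
      then show ?thesis using bd[of "Re z"] \<open>0 < \<epsilon>\<close> by simp
    next
      case 2
      then show ?thesis using r[of z] by (simp add: R_def)
    qed
  qed
  then show "Im (F w) \<le> 0 + \<epsilon>" by simp
qed

text \<open>The strict form follows from the open mapping theorem: the image of a nonconstant \<open>F\<close> is open, so it
  cannot touch the real axis from below, and a constant \<open>F\<close> is excluded by the boundary value at \<open>t\<close>.\<close>

lemma Im_neg_upper_half_plane: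
  fixes F :: "complex \<Rightarrow> complex"
  assumes cont: "continuous_on {w. 0 \<le> Im w} F" and hol: "F holomorphic_on {w. 0 < Im w}"
    and inf: "\<And>\<epsilon>. 0 < \<epsilon> \<Longrightarrow> \<exists>r. \<forall>w. 0 \<le> Im w \<and> r \<le> cmod w \<longrightarrow> Im (F w) \<le> \<epsilon>"
    and bd: "\<And>t. Im (F (of_real t)) \<le> 0" and neg: "Im (F (of_real t)) < 0" and w: "0 < Im w"
  shows "Im (F w) < 0"
proof (rule ccontr)
  let ?H = "{w. 0 < Im w}"
  assume "\<not> Im (F w) < 0"
  then have w0: "Im (F w) = 0" using Im_nonpos_upper_half_plane[OF cont hol inf bd w] by simp
  have clH: "closure ?H = {w. 0 \<le> Im w}" using closure_halfspace_gt[of \<i> 0] by (simp add: inner_complex_def)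
  show False
  proof (cases "F constant_on ?H")
    case True
    then obtain c where c: "\<And>z. z \<in> ?H \<Longrightarrow> F z = c" by (auto simp: constant_on_def)
    then have "F (of_real t) = c"
      using continuous_constant_on_closure[of ?H F c "of_real t"] cont clH by simp
    then show False using c[of w] w w0 neg by simp
  next
    case False
    have "open (F ` ?H)"
      using open_mapping_thm[OF hol _ _ _ _ False] open_halfspace_Im_gt
        convex_connected[OF convex_halfspace_Im_gt] by simp
    then obtain d where d: "0 < d" "cball (F w) d \<subseteq> F ` ?H"
      using w open_contains_cball by (metis imageI mem_Collect_eq)
    have "F w + \<i> * of_real d \<in> cball (F w) d" using d(1) by (simp add: dist_norm norm_mult)
    then obtain z where "0 < Im z" "F z = F w + \<i> * of_real d" using d(2) by auto
    then show False using Im_nonpos_upper_half_plane[OF cont hol inf bd, of z] w0 d(1) by simp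
  qed
qed

lemma factor_out_zeros:
  fixes f :: "complex \<Rightarrow> complex"
  assumes "f holomorphic_on D" "open D" "finite Z" "Z \<subseteq> D" "\<And>z. z \<in> Z \<Longrightarrow> f z = 0"
  shows "\<exists>q. q holomorphic_on D \<and> (\<forall>w\<in>D. f w = (\<Prod>z\<in>Z. w - z) * q w)"
  using assms(3,1,4,5)
proof (induction Z arbitrary: f)
  case empty
  then show ?case by auto
next
  case (insert a Z)
  define f1 where "f1 w = (if w = a then deriv f a else (f w - f a) / (w - a))" for w
  have f1: "f1 holomorphic_on D"
    unfolding f1_def using insert assms(2) by (intro pole_lemma) (auto simp: interior_open)
  have eq: "f w = (w - a) * f1 w" for w
    using insert by (auto simp: f1_def)
  have "f1 z = 0" if "z \<in> Z" for z
    using insert.prems(3)[of z] insert.hyps(2) that by (auto simp: f1_def insert.prems)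
  then obtain q where q: "q holomorphic_on D" "\<forall>w\<in>D. f1 w = (\<Prod>z\<in>Z. w - z) * q w"
    using insert.IH[OF f1] insert.prems by auto
  then show ?case using eq insert.hyps by (intro exI[of _ q]) simp
qed

text \<open>On the closed upper half-plane without \<open>0\<close> the principal logarithm is continuous from above even along its cut.
  The rotation by a quarter turn exhibits this: it moves this set into the domain where the
  logarithm is holomorphic.\<close>

lemma powr_eq_rotated:
  assumes "0 \<le> Im w" "w \<noteq> 0"
  shows "w powr of_real s = exp (of_real s * (Ln (- \<i> * w) + \<i> * of_real pi / 2))"
proof -
  have "Ln w = Ln (\<i> * (- \<i> * w))" by simp
  also have "\<dots> = Ln (- \<i> * w) + \<i> * of_real pi / 2"
    using assms by (subst Ln_times_ii) auto
  finally show ?thesis using assms by (simp add: powr_def)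
qed

lemma continuous_on_powr_upper:
  assumes "0 < s"
  shows "continuous_on {w. 0 \<le> Im w} (\<lambda>w. w powr of_real s :: complex)"
proof -
  let ?H = "{w::complex. 0 \<le> Im w}"
  have "((\<lambda>w. w powr of_real s :: complex) \<longlongrightarrow> w powr of_real s) (at w within ?H)" if w: "w \<in> ?H" for w
  proof (cases "w = 0")
    case True
    have "((\<lambda>w::complex. norm w powr s) \<longlongrightarrow> norm (0::complex) powr s) (at 0 within ?H)"
      using assms by (intro tendsto_powr2 tendsto_intros) auto
    then have "((\<lambda>w::complex. norm (w powr of_real s)) \<longlongrightarrow> 0) (at 0 within ?H)"
      by (simp add: norm_powr_real_powr')
    then show ?thesis using True tendsto_norm_zero_iff by (simp add: tendsto_norm_zero_iff)
  next
    case False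
    have "- \<i> * w \<notin> \<real>\<^sub>\<le>\<^sub>0" using w False by (auto simp: complex_nonpos_Reals_iff complex_eq_iff)
    then have "((\<lambda>w. exp (of_real s * (Ln (- \<i> * w) + \<i> * of_real pi / 2)))
        \<longlongrightarrow> exp (of_real s * (Ln (- \<i> * w) + \<i> * of_real pi / 2))) (at w within ?H)"
      by (intro tendsto_intros)
    moreover have "eventually (\<lambda>v. exp (of_real s * (Ln (- \<i> * v) + \<i> * of_real pi / 2)) = v powr of_real s) (at w within ?H)"
      unfolding eventually_at
    proof (intro exI[of _ "norm w"] conjI ballI impI)
      fix v assume v: "v \<in> ?H" "v \<noteq> w \<and> dist v w < norm w"
      then have "v \<noteq> 0" by auto
      then show "exp (of_real s * (Ln (- \<i> * v) + \<i> * of_real pi / 2)) = v powr of_real s"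
        using powr_eq_rotated[of v s] v by simp
    qed (use False in auto)
    ultimately show ?thesis using powr_eq_rotated[of w s] w False
      by (auto intro: Lim_transform_eventually)
  qed
  then show ?thesis by (simp add: continuous_on_def)
qed

lemma powr_minus_real:
  assumes "0 < r"
  shows "(- of_real r :: complex) powr of_real s = of_real (r powr s) * cis (pi * s)"
proof -
  have "Ln (- of_real r :: complex) = Ln (of_real r) + \<i> * of_real pi"
    using assms by (subst Ln_minus) (auto simp: Ln_of_real)
  then show ?thesis using assms
    by (simp add: powr_def Ln_of_real exp_add ring_distribs cis_conv_exp exp_of_real[symmetric] mult_ac)
qed

lemma powr_of_nonneg_real:
  assumes "0 \<le> r"
  shows "(of_real r :: complex) powr of_real s = of_real (r powr s)"
  using assms by (simp add: powr_of_real)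

lemma poly_over_power_at_infinity:
  fixes p :: "complex poly"
  assumes "degree p \<le> n"
  shows "((\<lambda>w. poly p w / w ^ n) \<longlongrightarrow> coeff p n) at_infinity"
proof -
  have eq: "poly p w / w ^ n = (\<Sum>i\<le>n. coeff p i * inverse w ^ (n - i))" if "w \<noteq> 0" for w
  proof -
    have "poly p w = (\<Sum>i\<le>n. coeff p i * w ^ i)"
      unfolding poly_altdef using assms by (intro sum.mono_neutral_left) (auto simp: coeff_eq_0)
    moreover have "w ^ i / w ^ n = inverse w ^ (n - i)" if "i \<le> n" for i
      using that \<open>w \<noteq> 0\<close> by (simp add: power_diff field_simps)
    ultimately show ?thesis by (simp add: sum_divide_distrib flip: times_divide_eq_right)
  qed
  have "((\<lambda>w. \<Sum>i\<le>n. coeff p i * inverse w ^ (n - i)) \<longlongrightarrow> (\<Sum>i\<le>n. coeff p i * 0 ^ (n - i))) at_infinity"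
    by (intro tendsto_intros tendsto_inverse_0)
  also have "(\<Sum>i\<le>n. coeff p i * 0 ^ (n - i)) = coeff p n"
    by (subst sum.remove[of _ n]) (auto intro!: sum.neutral)
  finally show ?thesis
    by (rule Lim_transform_eventually)
       (auto simp: eventually_at_infinity intro!: exI[of _ 1] eq[symmetric])
qed

lemma powr_over_power_at_infinity:
  assumes "s < real n"
  shows "((\<lambda>w::complex. w powr of_real s / w ^ n) \<longlongrightarrow> 0) at_infinity"
proof -
  have "((\<lambda>x::real. x powr (s - n)) \<longlongrightarrow> 0) at_top" using assms by (intro tendsto_neg_powr filterlim_ident) simp
  then have "((\<lambda>w::complex. norm w powr (s - n)) \<longlongrightarrow> 0) at_infinity"
    using filterlim_compose filterlim_norm_at_top by blast
  moreover have "eventually (\<lambda>w::complex. norm w powr (s - n) = norm (w powr of_real s / w ^ n)) at_infinity"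
    unfolding eventually_at_infinity
  proof (intro exI[of _ 1] allI impI)
    fix w :: complex assume "1 \<le> norm w"
    then have "norm w powr real n = norm w ^ n" by (intro powr_realpow) auto
    then show "norm w powr (s - n) = norm (w powr of_real s / w ^ n)"
      by (simp add: norm_divide norm_power norm_powr_real_powr' powr_diff)
  qed
  ultimately have "((\<lambda>w::complex. norm (w powr of_real s / w ^ n)) \<longlongrightarrow> 0) at_infinity"
    by (rule Lim_transform_eventually)
  then show ?thesis by (rule tendsto_norm_zero_cancel)
qed

definition quasi_poly_complex :: "real poly \<Rightarrow> real \<Rightarrow> real \<Rightarrow> complex \<Rightarrow> complex" where
  "quasi_poly_complex R k s w = poly (map_poly of_real R) w + of_real k * w powr of_real s"

lemma poly_map_poly_of_real [simp]:
  "poly (map_poly of_real R) (of_real t :: complex) = of_real (poly R t)"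
  by (induction R) (auto simp: map_poly_pCons)

lemma quasi_poly_complex_of_real:
  "0 \<le> t \<Longrightarrow> quasi_poly_complex R k s (of_real t) = of_real (poly R t + k * t powr s)"
  by (simp add: quasi_poly_complex_def powr_of_nonneg_real)

lemma quasi_poly_complex_holomorphic:
  "quasi_poly_complex R k s holomorphic_on - \<real>\<^sub>\<le>\<^sub>0"
  unfolding quasi_poly_complex_def by (intro holomorphic_intros) auto

lemma quasi_poly_complex_continuous:
  "0 < s \<Longrightarrow> continuous_on {w. 0 \<le> Im w} (quasi_poly_complex R k s)"
  unfolding quasi_poly_complex_def by (intro continuous_intros continuous_on_powr_upper)

lemma Im_quasi_poly_complex_minus:
  assumes "0 < r"
  shows "Im (quasi_poly_complex R k s (- of_real r)) = k * r powr s * sin (pi * s)"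
  using poly_map_poly_of_real[of R "- r"] assms
  by (simp add: quasi_poly_complex_def powr_minus_real)

lemma quasi_poly_complex_over_power:
  assumes "degree R \<le> n" "s < real n"
  shows "((\<lambda>w. quasi_poly_complex R k s w / w ^ n) \<longlongrightarrow> of_real (coeff R n)) at_infinity"
proof -
  have "degree (map_poly of_real R :: complex poly) \<le> n" using assms(1) by (simp add: degree_map_poly)
  then have "((\<lambda>w. poly (map_poly of_real R) w / w ^ n + of_real k * (w powr of_real s / w ^ n))
      \<longlongrightarrow> coeff (map_poly of_real R :: complex poly) n + of_real k * 0) at_infinity"
    using assms by (intro tendsto_intros poly_over_power_at_infinity powr_over_power_at_infinity)
  then show ?thesis by (simp add: quasi_poly_complex_def add_divide_distrib coeff_map_poly)
qed

lemma prod_over_power_at_infinity: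
  fixes Z :: "complex set"
  assumes "finite Z"
  shows "((\<lambda>w. (\<Prod>z\<in>Z. w - z) / w ^ card Z) \<longlongrightarrow> 1) at_infinity"
proof -
  have lim: "((\<lambda>w. (\<Prod>z\<in>Z. 1 - z * inverse w)) \<longlongrightarrow> (\<Prod>z\<in>Z. 1 - z * 0)) at_infinity"
    by (intro tendsto_intros tendsto_inverse_0)
  have eq: "(\<Prod>z\<in>Z. 1 - z * inverse w) = (\<Prod>z\<in>Z. w - z) / w ^ card Z" if "w \<noteq> 0" for w
  proof -
    have "(\<Prod>z\<in>Z. w - z) / w ^ card Z = (\<Prod>z\<in>Z. (w - z) / w)"
      by (simp add: prod_dividef)
    also have "\<dots> = (\<Prod>z\<in>Z. 1 - z * inverse w)" using that by (simp add: field_simps)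
    finally show ?thesis by simp
  qed
  have "((\<lambda>w. (\<Prod>z\<in>Z. w - z) / w ^ card Z) \<longlongrightarrow> (\<Prod>z\<in>Z. 1 - z * 0)) at_infinity"
    by (rule Lim_transform_eventually[OF lim])
       (auto simp: eventually_at_infinity intro!: exI[of _ 1] eq)
  then show ?thesis by simp
qed

lemma sin_pi_noninteger:
  assumes "0 < s" "\<And>i::nat. s \<noteq> real i"
  shows "sin (pi * s) \<noteq> 0"
proof
  assume "sin (pi * s) = 0"
  then obtain i :: int where "pi * s = of_int i * pi" by (auto simp: sin_zero_iff_int2)
  then have "s = of_int i" by simp
  then have "s = real (nat i)" using assms(1) by simp
  then show False using assms(2) by blast
qed

text \<open>Dividing by the monic polynomial with the \<open>n\<close> given zeros gives a function that is real on the positive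
  axis. On the negative axis the divisor is real with sign \<open>(-1)\<^sup>n\<close>, and the imaginary part of the dividend
  is \<open>k r\<^sup>s sin(\<pi> s)\<close>, so the quotient has an imaginary part of constant sign. At infinity it tends to
  the coefficient of \<open>w\<^sup>n\<close> in \<open>R\<close>, which is real. The maximum principle finishes the argument.\<close>

lemma quasi_poly_complex_nonzero:
  assumes s: "0 < s" "s < real n" "\<And>i::nat. s \<noteq> real i" and k: "k \<noteq> 0"
    and deg: "degree R \<le> n"
    and Z: "finite Z" "card Z = n" "\<And>z. z \<in> Z \<Longrightarrow> 0 < z \<and> poly R z + k * z powr s = 0"
    and w: "0 < Im w"
  shows "quasi_poly_complex R k s w \<noteq> 0"
proof
  assume zero: "quasi_poly_complex R k s w = 0"
  let ?D = "- \<real>\<^sub>\<le>\<^sub>0 :: complex set" and ?C = "{w. 0 \<le> Im w}"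
  define h where "h = quasi_poly_complex R k s"
  define Y where "Y = complex_of_real ` Z"
  have Y: "finite Y" "card Y = n" "Y \<subseteq> ?D"
    using Z by (auto simp: Y_def card_image inj_on_def complex_nonpos_Reals_iff) force
  have hY: "h z = 0" if z: "z \<in> Y" for z
  proof -
    obtain t where t: "z = of_real t" "t \<in> Z" using z by (auto simp: Y_def)
    then show ?thesis using Z(3)[of t] by (simp add: h_def quasi_poly_complex_of_real)
  qed
  have openD: "open ?D" by (simp add: closed_nonpos_Reals_complex open_Compl)
  obtain q where q: "q holomorphic_on ?D" "\<And>w. w \<in> ?D \<Longrightarrow> h w = (\<Prod>z\<in>Y. w - z) * q w"
    using factor_out_zeros[OF quasi_poly_complex_holomorphic openD Y(1,3), of R k s] hY
    unfolding h_def by blast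
  define \<rho> where "\<rho> w = (\<Prod>z\<in>Y. w - z)" for w :: complex
  have rho0: "\<rho> w = 0 \<longleftrightarrow> w \<in> Y" for w using Y(1) by (auto simp: \<rho>_def)
  \<comment> \<open>\<open>q\<close> removes the singularities of \<open>h / \<rho>\<close>, but is unspecified on the cut \<open>(-\<infinity>, 0]\<close>.\<close>
  define F where "F w = (if w \<in> ?D then q w else h w / \<rho> w)" for w
  have F: "F w = h w / \<rho> w" if "w \<notin> Y" for w
    using that q(2)[of w] rho0[of w] by (auto simp: F_def \<rho>_def)
  have contF: "continuous_on ?C F"
  proof -
    have "continuous_on (?C \<inter> ?D \<union> (?C - Y)) F"
      unfolding F_def
    proof (rule continuous_on_cases_local_open)
      have *: "?C \<inter> ?D \<union> (?C - Y) = ?C" using Y(3) by auto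
      show "openin (top_of_set (?C \<inter> ?D \<union> (?C - Y))) (?C \<inter> ?D)"
        unfolding * using openD by (simp add: openin_open_Int)
      have "?C - Y = ?C \<inter> - Y" by auto
      moreover have "open (- Y)" using Y(1) by (simp add: finite_imp_closed open_Compl)
      ultimately show "openin (top_of_set (?C \<inter> ?D \<union> (?C - Y))) (?C - Y)"
        unfolding * by (simp add: openin_open_Int)
      show "continuous_on (?C \<inter> ?D) q"
        using holomorphic_on_imp_continuous_on[OF q(1)] by (rule continuous_on_subset) auto
      show "continuous_on (?C - Y) (\<lambda>w. h w / \<rho> w)"
        unfolding h_def \<rho>_def using Y(1)
        by (intro continuous_intros continuous_on_subset[OF quasi_poly_complex_continuous[OF s(1)]]) auto
      show "q w = h w / \<rho> w" if "w \<in> ?C \<inter> ?D \<and> w \<notin> ?D \<or> w \<in> ?C - Y \<and> w \<in> ?D" for w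
        using that q(2)[of w] rho0[of w] by (auto simp: \<rho>_def)
    qed
    moreover have "?C \<inter> ?D \<union> (?C - Y) = ?C" using Y(3) by auto
    ultimately show ?thesis by simp
  qed
  have holF: "F holomorphic_on {w. 0 < Im w}"
  proof (rule holomorphic_transform)
    show "q holomorphic_on {w. 0 < Im w}"
      by (rule holomorphic_on_subset[OF q(1)]) (auto simp: complex_nonpos_Reals_iff)
  qed (auto simp: F_def complex_nonpos_Reals_iff)
  have limF: "(F \<longlongrightarrow> of_real (coeff R n)) at_infinity"
  proof -
    have "((\<lambda>w. (h w / w ^ n) / (\<rho> w / w ^ n)) \<longlongrightarrow> of_real (coeff R n) / 1) at_infinity"
      unfolding h_def \<rho>_def using quasi_poly_complex_over_power[OF deg s(2)]
        prod_over_power_at_infinity[OF Y(1)] Y(2) by (intro tendsto_divide) auto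
    moreover obtain B where B: "\<And>z. z \<in> Y \<Longrightarrow> norm z \<le> B"
      using finite_imp_bounded[OF Y(1)] by (auto simp: bounded_iff)
    have "eventually (\<lambda>w. (h w / w ^ n) / (\<rho> w / w ^ n) = F w) at_infinity"
      unfolding eventually_at_infinity
    proof (intro exI[of _ "max B 0 + 1"] allI impI)
      fix w :: complex assume "max B 0 + 1 \<le> norm w"
      then have "w \<notin> Y" "w \<noteq> 0" using B[of w] by auto
      then show "(h w / w ^ n) / (\<rho> w / w ^ n) = F w" using F by simp
    qed
    ultimately show ?thesis by (auto intro: Lim_transform_eventually)
  qed
  have Fpos: "Im (F (of_real t)) = 0" if t: "0 \<le> t" for t
  proof -
    have real: "Im (F (of_real u)) = 0" if "0 \<le> u" "u \<notin> Z" for u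
    proof -
      have "of_real u \<notin> Y" using that by (auto simp: Y_def)
      moreover have "\<rho> (of_real u) = of_real (\<Prod>z\<in>Z. u - z)"
        unfolding \<rho>_def Y_def by (subst prod.reindex) (auto simp: inj_on_def)
      ultimately show ?thesis using that
        by (simp add: F h_def quasi_poly_complex_of_real flip: of_real_divide of_real_prod of_real_diff)
    qed
    have "((\<lambda>u. Im (F (of_real u))) \<longlongrightarrow> Im (F (of_real t))) (at t within {0..})"
    proof -
      have "continuous_on {0..} (\<lambda>u. Im (F (of_real u)))"
        by (intro continuous_intros continuous_on_compose2[OF contF]) auto
      then show ?thesis using t by (simp add: continuous_on_def)
    qed
    moreover have "((\<lambda>u. Im (F (of_real u))) \<longlongrightarrow> 0) (at t within {0..})"
    proof (rule Lim_transform_eventually[OF tendsto_const])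
      have "eventually (\<lambda>u. u \<in> - (Z - {t})) (at t)"
        using finite_imp_closed[of "Z - {t}"] Z(1) by (intro eventually_at_in_open' open_Compl) auto
      then have "eventually (\<lambda>u. u \<in> - (Z - {t})) (at t within {0..})"
        unfolding eventually_at by blast
      then show "eventually (\<lambda>u. 0 = Im (F (of_real u))) (at t within {0..})"
        using real by (auto simp: eventually_at elim!: eventually_mono)
    qed
    moreover have "at t within {0..} \<noteq> bot"
    proof
      assume "at t within {0..} = bot"
      moreover have "at_right t \<le> at t within {0..}" using t by (intro at_le) auto
      ultimately show False using trivial_limit_at_right_real[of t] by (simp add: bot_unique)
    qed
    ultimately show ?thesis using tendsto_unique by blast
  qed
  \<comment> \<open>This number has the sign of the imaginary part of \<open>F\<close> on the negative axis.\<close>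
  define A where "A = k * sin (pi * s) * (- 1) ^ n"
  have A: "A \<noteq> 0" using k sin_pi_noninteger[OF s(1,3)] by (simp add: A_def)
  have Fneg: "Im (F (- of_real r)) * A > 0" if r: "0 < r" for r
  proof -
    define V where "V = (\<Prod>z\<in>Z. r + z)"
    have V: "0 < V" using Z(3) r unfolding V_def by (intro prod_pos) (force intro: add_pos_pos)
    have "\<rho> (- of_real r) = (\<Prod>z\<in>Z. - of_real (r + z))"
      unfolding \<rho>_def Y_def by (subst prod.reindex) (auto simp: inj_on_def intro!: prod.cong)
    also have "\<dots> = (\<Prod>z\<in>Z. of_real ((- 1) * (r + z)))" by simp
    also have "\<dots> = of_real (\<Prod>z\<in>Z. (- 1) * (r + z))" by (rule of_real_prod[symmetric])
    also have "(\<Prod>z\<in>Z. (- 1) * (r + z)) = (- 1) ^ n * V"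
      unfolding prod.distrib V_def Z(2)[symmetric] by (simp only: prod_constant)
    finally have rho: "\<rho> (- of_real r) = of_real ((- 1) ^ n * V)" .
    have "- of_real r \<notin> Y" using Z(3) r by (force simp: Y_def simp flip: of_real_minus)
    then have "F (- of_real r) = h (- of_real r) / of_real ((- 1) ^ n * V)" using F rho by simp
    then have "Im (F (- of_real r)) = k * r powr s * sin (pi * s) / ((- 1) ^ n * V)"
      using Im_quasi_poly_complex_minus[OF r, of R k s] by (simp only: Im_divide_of_real h_def)
    then have "Im (F (- of_real r)) = A * (r powr s / V)"
      by (cases "even n") (auto simp: A_def)
    then have "Im (F (- of_real r)) * A = A * A * (r powr s / V)" by simp
    then show ?thesis using A V r by (metis mult_pos_pos not_real_square_gt_zero divide_pos_pos powr_gt_zero less_irrefl)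
  qed
  have "Im (of_real (- A) * F w) < 0"
  proof (rule Im_neg_upper_half_plane[where t = "- 1" and F = "\<lambda>w. of_real (- A) * F w"])
    show "continuous_on ?C (\<lambda>w. of_real (- A) * F w)" by (intro continuous_intros contF)
    show "(\<lambda>w. of_real (- A) * F w) holomorphic_on {w. 0 < Im w}" by (intro holomorphic_intros holF)
    show "\<exists>r. \<forall>w. 0 \<le> Im w \<and> r \<le> cmod w \<longrightarrow> Im (of_real (- A) * F w) \<le> \<epsilon>" if "0 < \<epsilon>" for \<epsilon>
    proof -
      have "((\<lambda>w. Im (of_real (- A) * F w)) \<longlongrightarrow> Im (of_real (- A) * of_real (coeff R n))) at_infinity"
        by (intro tendsto_intros limF)
      then have "eventually (\<lambda>w. Im (of_real (- A) * F w) < \<epsilon>) at_infinity"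
        using that by (intro order_tendstoD(2)) auto
      then show ?thesis unfolding eventually_at_infinity by (meson less_imp_le)
    qed
    show "Im (of_real (- A) * F (of_real t)) \<le> 0" for t
      using Fpos[of t] Fneg[of "- t"] by (cases "0 \<le> t") (auto simp: mult.commute)
    show "Im (of_real (- A) * F (of_real (- 1))) < 0" using Fneg[of 1] by (simp add: mult.commute)
  qed (use w in auto)
  moreover have "w \<notin> Y" using w by (auto simp: Y_def)
  then have "F w = 0" using F zero by (simp add: h_def)
  ultimately show False by simp
qed

section \<open>Branches of the inverse cosine\<close>

lemma Re_cos_cosh: "Re (cos z) = cos (Re z) * cosh (Im z)"
  by (simp add: Re_cos cosh_def)

lemma Im_cos_sinh: "Im (cos z) = - (sin (Re z) * sinh (Im z))"
  by (simp add: Im_cos sinh_def algebra_simps diff_divide_distrib)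

lemma abs_Im_le_norm_cos: "\<bar>Im z\<bar> \<le> cmod (cos z)"
proof -
  have "\<bar>Im z\<bar> \<le> \<bar>sinh (Im z)\<bar>"
    using real_le_abs_sinh[of "Im z"] by (simp add: sinh_def exp_minus scaleR_conv_of_real)
  then have "(Im z)\<^sup>2 \<le> (sinh (Im z))\<^sup>2" by (simp add: abs_le_square_iff)
  also have "\<dots> \<le> (cos (Re z))\<^sup>2 + (sinh (Im z))\<^sup>2" by simp
  also have "\<dots> = (cmod (cos z))\<^sup>2"
    by (simp add: norm_cos_squared sinh_def exp_minus power_divide)
  finally show ?thesis by (metis abs_le_square_iff abs_norm_cancel)
qed

text \<open>A point with almost the right cosine is close to a point with exactly the right one, uniformly. By
  periodicity and \<open>abs_Im_le_norm_cos\<close> only a compact rectangle has to be considered.\<close>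

lemma cos_near_fibre:
  fixes c :: complex
  assumes "0 < \<epsilon>"
  shows "\<exists>\<delta>>0. \<forall>\<zeta>. dist (cos \<zeta>) c < \<delta> \<longrightarrow> (\<exists>\<xi>. cos \<xi> = c \<and> dist \<zeta> \<xi> < \<epsilon>)"
proof -
  define B where "B = cmod c + 1"
  define U where "U = (\<Union>\<xi>\<in>{\<xi>. cos \<xi> = c}. ball \<xi> \<epsilon>)"
  define K where "K = cbox (Complex (- pi) (- B)) (Complex pi B) - U"
  have "open U" by (auto simp: U_def)
  then have K: "compact K" unfolding K_def by (intro compact_diff compact_cbox)
  have "\<exists>d>0. \<forall>\<zeta>\<in>K. d \<le> dist (cos \<zeta>) c"
  proof (cases "K = {}")
    case False
    have "continuous_on K (\<lambda>\<zeta>. dist (cos \<zeta>) c)" by (intro continuous_intros)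
    then obtain z where z: "z \<in> K" "\<forall>\<zeta>\<in>K. dist (cos z) c \<le> dist (cos \<zeta>) c"
      using continuous_attains_inf[OF K False] by blast
    have "cos z \<noteq> c" using z(1) assms by (auto simp: K_def U_def)
    then show ?thesis using z(2) by (intro exI[of _ "dist (cos z) c"]) auto
  qed (auto intro: exI[of _ 1])
  then obtain d where d: "0 < d" "\<And>\<zeta>. \<zeta> \<in> K \<Longrightarrow> d \<le> dist (cos \<zeta>) c" by blast
  show ?thesis
  proof (intro exI[of _ "min d 1"] conjI allI impI)
    fix \<zeta> assume close: "dist (cos \<zeta>) c < min d 1"
    define n where "n = round (Re \<zeta> / (2 * pi))"
    define \<zeta>' where "\<zeta>' = \<zeta> - of_real (2 * pi * of_int n)"
    have shift: "cos (w + of_real (2 * pi * of_int k)) = cos w" for w :: complex and k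
      unfolding complex_cos_eq by (intro bexI[of _ "of_int k"] disjI1) (auto simp: mult_ac)
    have cos': "cos (w - of_real (2 * pi * of_int n)) = cos w" "cos (w + of_real (2 * pi * of_int n)) = cos w"
      for w :: complex
      using shift[of w n] shift[of w "- n"] by simp_all
    have "\<bar>Re \<zeta> / (2 * pi) - of_int n\<bar> \<le> 1 / 2"
      unfolding n_def using of_int_round_abs_le[of "Re \<zeta> / (2 * pi)"] by linarith
    then have "\<bar>Re \<zeta> / (2 * pi) - of_int n\<bar> * (2 * pi) \<le> 1 / 2 * (2 * pi)"
      by (intro mult_right_mono) auto
    also have "\<bar>Re \<zeta> / (2 * pi) - of_int n\<bar> * (2 * pi) = \<bar>(Re \<zeta> / (2 * pi) - of_int n) * (2 * pi)\<bar>"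
      by (simp add: abs_mult)
    also have "(Re \<zeta> / (2 * pi) - of_int n) * (2 * pi) = Re \<zeta>'"
      by (simp add: \<zeta>'_def left_diff_distrib)
    finally have "\<bar>Re \<zeta>'\<bar> \<le> pi" by simp
    moreover have "norm (cos \<zeta>') \<le> B"
    proof -
      have "norm (cos \<zeta>') \<le> norm c + dist (cos \<zeta>) c"
        unfolding \<zeta>'_def cos' by (metis dist_norm norm_triangle_sub)
      then show ?thesis using close by (simp add: B_def)
    qed
    then have "\<bar>Im \<zeta>'\<bar> \<le> B" using abs_Im_le_norm_cos[of \<zeta>'] by simp
    ultimately have "\<zeta>' \<in> cbox (Complex (- pi) (- B)) (Complex pi B)"
      by (auto simp: in_cbox_complex_iff abs_le_iff)
    moreover have "\<zeta>' \<notin> K" using d(2)[of \<zeta>'] close unfolding \<zeta>'_def cos' by auto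
    ultimately obtain \<xi> where xi: "cos \<xi> = c" "dist \<xi> \<zeta>' < \<epsilon>" by (auto simp: K_def U_def)
    show "\<exists>\<xi>. cos \<xi> = c \<and> dist \<zeta> \<xi> < \<epsilon>"
    proof (intro exI conjI)
      show "cos (\<xi> + of_real (2 * pi * of_int n)) = c" using xi cos' by simp
      show "dist \<zeta> (\<xi> + of_real (2 * pi * of_int n)) < \<epsilon>"
        using xi(2) unfolding \<zeta>'_def dist_norm by (metis diff_diff_eq diff_add_eq_diff_diff_swap norm_minus_commute)
    qed
  qed (use d in auto)
qed

text \<open>Two points with cosine \<open>c\<close> differ either by a multiple of \<open>2 \<pi>\<close> or by some \<open>\<eta>\<close> with \<open>cos \<eta> = 2 c\<^sup>2 - 1\<close>. In
  the second case a small \<open>\<eta>\<close> forces \<open>2 c\<^sup>2 - 1 = 1\<close>, and then \<open>\<eta> = 0\<close>.\<close>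

lemma cos_fibre_separated:
  fixes c :: complex
  shows "\<exists>\<epsilon>>0. \<forall>\<xi> \<xi>'. cos \<xi> = c \<and> cos \<xi>' = c \<and> dist \<xi> \<xi>' < \<epsilon> \<longrightarrow> \<xi> = \<xi>'"
proof -
  have small: "\<eta> = 0" if eta: "cos \<eta> = 1" "norm \<eta> < 1" for \<eta> :: complex
  proof -
    obtain n :: int where n: "\<eta> = of_real (2 * real_of_int n * pi)"
      using eta(1) by (auto simp: cos_eq_1)
    have "n = 0"
    proof (rule ccontr)
      assume "n \<noteq> 0"
      then have "1 \<le> \<bar>real_of_int n\<bar>" by linarith
      then have "1 * pi \<le> \<bar>real_of_int n\<bar> * pi" by (intro mult_right_mono) auto
      moreover have "norm \<eta> = 2 * (\<bar>real_of_int n\<bar> * pi)" using n by (simp add: norm_mult)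
      ultimately show False using eta(2) pi_gt3 by linarith
    qed
    then show ?thesis using n by simp
  qed
  obtain e where e: "0 < e" "\<And>\<eta>::complex. norm \<eta> < e \<Longrightarrow> 2 * c\<^sup>2 - 1 \<noteq> 1 \<Longrightarrow> cos \<eta> \<noteq> 2 * c\<^sup>2 - 1"
  proof (cases "2 * c\<^sup>2 - 1 = 1")
    case False
    have "isCont cos (0::complex)" by (intro continuous_intros)
    then have "eventually (\<lambda>\<eta>::complex. cos \<eta> \<noteq> 2 * c\<^sup>2 - 1) (nhds 0)"
      unfolding isCont_def using False
      by (metis cos_zero isContD tendsto_at_iff_tendsto_nhds tendsto_imp_eventually_ne)
    then show ?thesis using that unfolding eventually_nhds_metric dist_norm by auto
  qed (use that[of 1] in auto)
  show ?thesis
  proof (intro exI[of _ "min e 1"] conjI allI impI)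
    fix \<xi> \<xi>' :: complex assume *: "cos \<xi> = c \<and> cos \<xi>' = c \<and> dist \<xi> \<xi>' < min e 1"
    then have "cos \<xi> = cos \<xi>'" by simp
    then obtain n where n: "n \<in> \<int>" "\<xi> = \<xi>' + of_real (2 * n * pi) \<or> \<xi> = - \<xi>' + of_real (2 * n * pi)"
      using complex_cos_eq by blast
    then obtain j :: int where j: "n = of_int j" by (auto elim: Ints_cases)
    have "cos (\<xi> - \<xi>') = 1"
    proof (cases "\<xi> = \<xi>' + of_real (2 * n * pi)")
      case True
      then have "\<xi> - \<xi>' = of_real (2 * real_of_int j * pi)" using j by simp
      then show ?thesis by (auto simp: cos_eq_1)
    next
      case False
      then have "\<xi> - \<xi>' = 2 * \<xi> + of_real (2 * of_int (- j) * pi)"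
        using n(2) j by (simp add: algebra_simps)
      then have "cos (\<xi> - \<xi>') = cos (2 * \<xi>)" unfolding complex_cos_eq by (intro bexI[of _ "of_int (- j)"]) auto
      then have "cos (\<xi> - \<xi>') = 2 * c\<^sup>2 - 1" using * by (simp add: cos_double_cos)
      then show ?thesis using e(2)[of "\<xi> - \<xi>'"] * by (auto simp: dist_norm)
    qed
    then show "\<xi> = \<xi>'" using small[of "\<xi> - \<xi>'"] * by (simp add: dist_norm)
  qed (use e in auto)
qed

text \<open>A continuous branch of the inverse cosine of \<open>g\<close> maps a small connected neighbourhood of \<open>x\<close> in \<open>S\<close> into
  the union of small disjoint balls about the points of the fibre over \<open>c\<close>, hence into a single one of
  them. The argument is the same at the branch points \<open>c = \<plusminus>1\<close>.\<close>

lemma arccos_branch_has_limit: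
  fixes \<phi> g :: "complex \<Rightarrow> complex"
  assumes S: "convex S" "x \<in> closure S" and cont: "continuous_on S \<phi>"
    and lim: "(g \<longlongrightarrow> c) (at x within S)" and cos: "\<And>w. w \<in> S \<Longrightarrow> cos (\<phi> w) = g w" and x: "x \<notin> S"
  shows "\<exists>l. (\<phi> \<longlongrightarrow> l) (at x within S)"
proof -
  obtain \<epsilon> where \<epsilon>: "0 < \<epsilon>" "\<And>\<xi> \<xi>'. cos \<xi> = c \<Longrightarrow> cos \<xi>' = c \<Longrightarrow> dist \<xi> \<xi>' < \<epsilon> \<Longrightarrow> \<xi> = \<xi>'"
    using cos_fibre_separated[of c] by auto
  have near: "\<exists>r>0. \<forall>w\<in>S \<inter> ball x r. \<exists>\<xi>. cos \<xi> = c \<and> dist (\<phi> w) \<xi> < e" if e: "0 < e" for e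
  proof -
    obtain d where d: "0 < d" "\<And>\<zeta>. dist (cos \<zeta>) c < d \<Longrightarrow> \<exists>\<xi>. cos \<xi> = c \<and> dist \<zeta> \<xi> < e"
      using cos_near_fibre[OF e] by blast
    have "eventually (\<lambda>w. dist (g w) c < d) (at x within S)" using lim d(1) tendstoD by blast
    then obtain r where r: "0 < r" "\<And>w. w \<in> S \<Longrightarrow> w \<noteq> x \<Longrightarrow> dist w x < r \<Longrightarrow> dist (g w) c < d"
      unfolding eventually_at by blast
    have "\<exists>\<xi>. cos \<xi> = c \<and> dist (\<phi> w) \<xi> < e" if w: "w \<in> S \<inter> ball x r" for w
    proof -
      have "dist (g w) c < d" using w x by (intro r(2)) (auto simp: dist_commute)
      then show ?thesis using d(2)[of "\<phi> w"] cos w by auto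
    qed
    then show ?thesis using r(1) by blast
  qed
  obtain r where r: "0 < r" "\<And>w. w \<in> S \<inter> ball x r \<Longrightarrow> \<exists>\<xi>. cos \<xi> = c \<and> dist (\<phi> w) \<xi> < \<epsilon> / 2"
    using near[of "\<epsilon> / 2"] \<epsilon>(1) by auto
  define B where "B = S \<inter> ball x r"
  obtain b where "b \<in> S" "dist b x < r" using S(2) r(1) unfolding closure_approachable by blast
  then have b: "b \<in> B" by (simp add: B_def dist_commute)
  obtain l where l: "cos l = c" "dist (\<phi> b) l < \<epsilon> / 2" using r(2) b B_def by blast
  have conn: "connected (\<phi> ` B)"
    unfolding B_def by (intro connected_continuous_image continuous_on_subset[OF cont] convex_connected
        convex_Int S convex_ball) auto
  define V where "V = (\<Union>\<xi>\<in>{\<xi>. cos \<xi> = c \<and> \<xi> \<noteq> l}. ball \<xi> (\<epsilon> / 2))"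
  have "open V" by (auto simp: V_def)
  have cover: "\<phi> ` B \<subseteq> ball l (\<epsilon> / 2) \<union> V"
  proof
    fix \<zeta> assume "\<zeta> \<in> \<phi> ` B"
    then obtain \<xi> where "cos \<xi> = c" "dist \<zeta> \<xi> < \<epsilon> / 2" using r(2) B_def by blast
    then show "\<zeta> \<in> ball l (\<epsilon> / 2) \<union> V" by (cases "\<xi> = l") (auto simp: V_def dist_commute)
  qed
  have disj: "ball l (\<epsilon> / 2) \<inter> V = {}"
  proof -
    have "dist l \<xi> < \<epsilon>" if "dist l \<zeta> < \<epsilon> / 2" "dist \<xi> \<zeta> < \<epsilon> / 2" for \<xi> \<zeta>
      using dist_triangle_half_r that by (metis dist_commute dist_triangle_half_l)
    then show ?thesis using \<epsilon>(2)[OF l(1)] by (force simp: V_def)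
  qed
  have in_ball: "\<phi> ` B \<subseteq> ball l (\<epsilon> / 2)"
  proof -
    have "ball l (\<epsilon> / 2) \<inter> \<phi> ` B = {} \<or> V \<inter> \<phi> ` B = {}"
      using connectedD[OF conn open_ball \<open>open V\<close>] disj cover by blast
    moreover have "\<phi> b \<in> ball l (\<epsilon> / 2) \<inter> \<phi> ` B" using b l by (auto simp: dist_commute)
    ultimately show ?thesis using cover by blast
  qed
  have "(\<phi> \<longlongrightarrow> l) (at x within S)"
  proof (rule tendstoI)
    fix e :: real assume "0 < e"
    then obtain r' where r': "0 < r'"
      "\<And>w. w \<in> S \<inter> ball x r' \<Longrightarrow> \<exists>\<xi>. cos \<xi> = c \<and> dist (\<phi> w) \<xi> < min e (\<epsilon> / 2)"
      using near[of "min e (\<epsilon> / 2)"] \<epsilon>(1) by auto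
    have "dist (\<phi> w) l < e" if w: "w \<in> S" "dist w x < min r r'" for w
    proof -
      obtain \<xi> where xi: "cos \<xi> = c" "dist (\<phi> w) \<xi> < min e (\<epsilon> / 2)"
        using r'(2)[of w] w by (auto simp: dist_commute)
      have "w \<in> B" using w by (simp add: B_def dist_commute)
      then have "\<phi> w \<in> ball l (\<epsilon> / 2)" using in_ball by blast
      then have "dist \<xi> l < \<epsilon>" using xi(2) by (auto intro: dist_triangle_half_r simp: dist_commute)
      then have "\<xi> = l" using \<epsilon>(2) xi(1) l(1) by blast
      then show ?thesis using xi(2) by simp
    qed
    then show "eventually (\<lambda>w. dist (\<phi> w) l < e) (at x within S)"
      unfolding eventually_at using r(1) r'(1) by (intro exI[of _ "min r r'"]) auto
  qed
  then show ?thesis by blast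
qed

lemma continuous_extension_to_closure:
  fixes f :: "complex \<Rightarrow> complex"
  assumes "continuous_on S f" and lim: "\<And>x. x \<in> closure S - S \<Longrightarrow> \<exists>l. (f \<longlongrightarrow> l) (at x within S)"
  obtains h where "continuous_on (closure S) h" "\<And>x. x \<in> S \<Longrightarrow> h x = f x"
proof -
  obtain h where "continuous_map (top_of_set (closure S)) euclidean h" "\<And>x. x \<in> S \<Longrightarrow> h x = f x"
  proof (rule continuous_map_extension_pointwise_alt[where X = euclidean and S = S and T = "closure S"
        and Y = "euclidean :: complex topology" and f = f])
    show "regular_space (euclidean :: complex topology)" by (rule regular_space_euclidean)
    show "S \<subseteq> closure S" by (rule closure_subset)
    show "closure S \<subseteq> euclidean closure_of S" by simp
    show "continuous_map (top_of_set S) euclidean f" using assms(1) by simp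
    show "\<exists>l. limitin euclidean f l (atin_within euclidean t S)" if t: "t \<in> closure S - S" for t
    proof -
      obtain l where "(f \<longlongrightarrow> l) (at t within S)" using lim[OF t] by blast
      then have "limitin euclidean f l (atin_within euclidean t S)"
        by (simp add: limitin_def tendsto_def eventually_atin_within eventually_at_topological)
           (metis)
      then show ?thesis by blast
    qed
  qed blast
  then show ?thesis using that by simp
qed

text \<open>The real part of the inverse cosine cannot cross a multiple of \<open>\<pi>\<close> over the lower half-plane, because
  \<open>Im (cos z) = - sin (Re z) sinh (Im z)\<close>; so its range is decided by the value at \<open>- \<i>\<close>.\<close>

lemma Arccos_lower_half_plane:
  assumes "Im c < 0"
  shows "0 < Re (Arccos c)" "Re (Arccos c) < pi" "0 < Im (Arccos c)"
proof -
  let ?L = "{c. Im c < 0}"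
  have nz: "sin (Re (Arccos c)) \<noteq> 0" if "c \<in> ?L" for c
    using that Im_cos_sinh[of "Arccos c"] by auto
  have "connected ((\<lambda>c. Re (Arccos c)) ` ?L)"
    by (intro connected_continuous_image convex_connected convex_halfspace_Im_lt
        continuous_at_imp_continuous_on ballI continuous_intros isCont_Arccos) auto
  moreover have "0 < Re (Arccos (- \<i>))" using Arccos_bounds[of "- \<i>"] by simp
  ultimately have "0 < Re (Arccos c)"
    using assms nz connectedD_interval[of "(\<lambda>c. Re (Arccos c)) ` ?L" "Re (Arccos c)" "Re (Arccos (- \<i>))" 0]
    by (force simp: not_less)
  moreover have "Re (Arccos c) \<noteq> pi" using nz[of c] assms by auto
  ultimately show *: "0 < Re (Arccos c)" "Re (Arccos c) < pi"
    using Re_Arccos_bounds[of c] by auto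
  then have "0 < sin (Re (Arccos c))" by (simp add: sin_gt_zero)
  moreover have "0 < sin (Re (Arccos c)) * sinh (Im (Arccos c))"
    using Im_cos_sinh[of "Arccos c"] assms by simp
  ultimately show "0 < Im (Arccos c)" by (simp add: zero_less_mult_iff)
qed

text \<open>An angle that starts at \<open>0\<close> and keeps a positive sine cannot leave \<open>(0, \<pi>)\<close>. This lemma and the next
  two convert sign information about \<open>sin\<close> into exact boundary values of the lifted map.\<close>

lemma stays_in_sine_arch:
  fixes V :: "real \<Rightarrow> real"
  assumes "continuous_on {a..b} V" "V a = 0" "a < b" and pos: "\<And>t. a < t \<Longrightarrow> t \<le> b \<Longrightarrow> 0 < sin (V t)"
  shows "0 < V b" "V b < pi"
proof -
  have ivt: "\<exists>t. a < t \<and> t \<le> b \<and> V t = y" if y: "y \<noteq> 0" "min 0 (V b) \<le> y" "y \<le> max 0 (V b)" for y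
  proof -
    have "connected (V ` {a..b})" using assms(1) by (intro connected_continuous_image) auto
    moreover have "V b \<in> V ` {a..b}" "0 \<in> V ` {a..b}" using assms(2,3) by force+
    ultimately have "y \<in> V ` {a..b}"
      using y(2,3) connectedD_interval by (metis max_def min_def)
    then obtain t where "a \<le> t" "t \<le> b" "V t = y" by auto
    then show ?thesis using assms(2) y(1) by (metis order_le_less)
  qed
  show "V b < pi"
  proof (rule ccontr)
    assume "\<not> V b < pi"
    then have "min 0 (V b) \<le> pi" "pi \<le> max 0 (V b)" using pi_ge_zero by linarith+
    then obtain t where "a < t" "t \<le> b" "V t = pi" using ivt[of pi] by auto
    then show False using pos by force
  qed
  show "0 < V b"
  proof (rule ccontr)
    assume *: "\<not> 0 < V b"
    have "V b \<noteq> 0" using pos[of b] assms(3) by auto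
    then have "V b < 0" using * by simp
    define y where "y = max (V b) (- pi / 2)"
    have y: "y < 0" "V b \<le> y" "- pi < y" using \<open>V b < 0\<close> pi_gt_zero by (auto simp: y_def max_def)
    then have "y \<noteq> 0" "min 0 (V b) \<le> y" "y \<le> max 0 (V b)" by auto
    then obtain t where t: "a < t" "t \<le> b" "V t = y" using ivt by blast
    have "0 < sin (- y)" using y by (intro sin_gt_zero) auto
    then show False using pos[of t] t by simp
  qed
qed

lemma crosses_sine_arch:
  fixes V :: "real \<Rightarrow> real"
  assumes cont: "continuous_on {a..b} V" and "V a = 0" and ab: "a < b"
    and pos: "\<And>t. a < t \<Longrightarrow> t < b \<Longrightarrow> 0 < sin (V t)" and "cos (V b) = - 1"
  shows "V b = pi"
proof -
  have "V ` {a<..<b} \<subseteq> {0..pi}"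
  proof
    fix y assume "y \<in> V ` {a<..<b}"
    then obtain t where t: "a < t" "t < b" "y = V t" by auto
    have "continuous_on {a..t} V" using cont t by (auto intro: continuous_on_subset)
    then show "y \<in> {0..pi}" using stays_in_sine_arch[of a t V] assms(2) pos t by fastforce
  qed
  then have "V ` closure {a<..<b} \<subseteq> {0..pi}"
    using cont ab by (intro image_closure_subset) auto
  moreover have "V b \<in> V ` closure {a<..<b}" using ab by (intro imageI) simp
  ultimately have "V b \<in> {0..pi}" by blast
  then show ?thesis using assms(5) cos_inj_pi[of "V b" pi] by simp
qed

lemma zero_of_sine_zero:
  fixes V :: "real \<Rightarrow> real"
  assumes I: "connected I" "continuous_on I V" "c \<in> I" "V c = 0" "t \<in> I"
    and zero: "\<And>t. t \<in> I \<Longrightarrow> sin (V t) = 0"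
  shows "V t = 0"
proof (rule ccontr)
  assume nz: "V t \<noteq> 0"
  have conn: "connected (V ` I)" using I by (intro connected_continuous_image) auto
  have mem: "V t \<in> V ` I" "0 \<in> V ` I" using imageI[OF I(3), of V] imageI[OF I(5), of V] I(4) by auto
  consider "0 < V t" | "V t < 0" using nz by linarith
  then show False
  proof cases
    case 1
    then have "min (V t) (pi / 2) \<in> V ` I"
      using connectedD_interval[OF conn mem(2,1), of "min (V t) (pi / 2)"] by auto
    then have "sin (min (V t) (pi / 2)) = 0" using zero by force
    moreover have "0 < sin (min (V t) (pi / 2))" using 1 pi_gt_zero by (intro sin_gt_zero) (auto simp: min_def)
    ultimately show False by simp
  next
    case 2
    define y where "y = max (V t) (- pi / 2)"
    have y: "y < 0" "V t \<le> y" "- pi < y" using 2 pi_gt_zero by (auto simp: y_def max_def)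
    then have "y \<in> V ` I" using connectedD_interval[OF conn mem(1,2), of y] by auto
    then have "sin y = 0" using zero by force
    moreover have "0 < sin (- y)" using y by (intro sin_gt_zero) auto
    ultimately show False by simp
  qed
qed

section \<open>Lifting an alternating function through the cosine\<close>

text \<open>The features of the normalized error that the construction of the conformal map uses. Here \<open>k\<close> is the
  restriction of \<open>g\<close> to the positive axis and \<open>k'\<close> its derivative; \<open>x 0, \<dots>, x (m + 1)\<close> are the points where
  \<open>k\<close> takes the values \<open>1, -1, 1, \<dots>\<close> in turn. The behaviour on the negative axis is given by the
  imaginary part alone, which determines the curve \<open>\<gamma>\<close> through its functional equation.\<close>

locale alternating_map =
  fixes g :: "complex \<Rightarrow> complex" and k k' :: "real \<Rightarrow> real" and x :: "nat \<Rightarrow> real" and m :: nat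
    and \<kappa> s :: real
  assumes cont_g: "continuous_on {w. 0 \<le> Im w} g"
    and hol_g: "g holomorphic_on - \<real>\<^sub>\<le>\<^sub>0"
    and g_infinity: "filterlim g at_infinity at_infinity"
    and deriv_g: "\<And>w. 0 < Im w \<Longrightarrow> deriv g w \<noteq> 0"
    and omits: "\<And>w c. 0 < Im w \<Longrightarrow> \<bar>c\<bar> \<le> 1 \<Longrightarrow> g w \<noteq> of_real c"
    and g_real: "\<And>t. 0 \<le> t \<Longrightarrow> g (of_real t) = of_real (k t)"
    and deriv_real: "\<And>t. 0 < t \<Longrightarrow> deriv g (of_real t) = of_real (k' t)"
    and m_pos: "0 < m" and x_pos: "0 < x 0" and x_inc: "\<And>j. j \<le> m \<Longrightarrow> x j < x (Suc j)"
    and k_x: "\<And>j. j \<le> Suc m \<Longrightarrow> k (x j) = (- 1) ^ j"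
    and k_between: "\<And>j t. j \<le> m \<Longrightarrow> x j < t \<Longrightarrow> t < x (Suc j) \<Longrightarrow> \<bar>k t\<bar> < 1 \<and> (- 1) ^ j * k' t < 0"
    and k_left: "\<And>t. 0 \<le> t \<Longrightarrow> t < x 0 \<Longrightarrow> 1 < k t \<and> k t \<le> k 0"
    and k_right: "\<And>t. x (Suc m) < t \<Longrightarrow> 1 < \<bar>k t\<bar> \<and> k' t \<noteq> 0"
    and k_right_inj: "inj_on k {x (Suc m)<..}"
    and \<kappa>_pos: "0 < \<kappa>" and s_pos: "0 < s"
    and Im_g_minus: "\<And>r. 0 < r \<Longrightarrow> Im (g (- of_real r)) = - \<kappa> * r powr s"
begin

abbreviation "H \<equiv> {w::complex. 0 < Im w}"
abbreviation "C \<equiv> {w::complex. 0 \<le> Im w}"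

lemma closure_H: "closure H = C"
  using closure_halfspace_gt[of \<i> 0] by (simp add: inner_complex_def)

lemma H_slit: "H \<subseteq> - \<real>\<^sub>\<le>\<^sub>0"
  by (auto simp: complex_nonpos_Reals_iff)

lemma open_H: "open H" by (simp add: open_halfspace_Im_gt)

lemma connected_H: "connected H" by (simp add: convex_connected convex_halfspace_Im_gt)

text \<open>Since \<open>g\<close> omits \<open>[-1, 1]\<close> on the upper half-plane, a holomorphic inverse cosine of \<open>g\<close> exists there and
  its imaginary part has no zero; a change of sign makes that part positive. The limits at the boundary
  exist by \<open>arccos_branch_has_limit\<close>, and a shift by a multiple of \<open>2 \<pi>\<close> normalizes the value at \<open>x 0\<close>.\<close>

lemma arccos_branch_exists:
  "\<exists>\<phi>. continuous_on C \<phi> \<and> \<phi> holomorphic_on H \<and> (\<forall>w\<in>C. cos (\<phi> w) = g w) \<and>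
     (\<forall>w\<in>H. 0 < Im (\<phi> w)) \<and> \<phi> (of_real (x 0)) = 0"
proof -
  have holH: "g holomorphic_on H" using hol_g H_slit holomorphic_on_subset by blast
  have "g w \<noteq> 1 \<and> g w \<noteq> - 1" if "w \<in> H" for w
    using omits[of w 1] omits[of w "- 1"] that by auto
  then obtain \<phi>\<^sub>0 where phi0: "\<phi>\<^sub>0 holomorphic_on H" "\<And>w. w \<in> H \<Longrightarrow> g w = cos (\<phi>\<^sub>0 w)"
    using contractible_imp_holomorphic_arccos[OF holH convex_imp_contractible[OF convex_halfspace_Im_gt]] by blast
  have nz: "Im (\<phi>\<^sub>0 w) \<noteq> 0" if "w \<in> H" for w
  proof
    assume "Im (\<phi>\<^sub>0 w) = 0"
    then have "\<phi>\<^sub>0 w = of_real (Re (\<phi>\<^sub>0 w))" by (simp add: complex_eq_iff)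
    then have "g w = of_real (cos (Re (\<phi>\<^sub>0 w)))" using phi0(2)[OF that] by (metis cos_of_real)
    then show False using omits[of w "cos (Re (\<phi>\<^sub>0 w))"] that by simp
  qed
  have conn: "connected ((\<lambda>w. Im (\<phi>\<^sub>0 w)) ` H)"
    by (intro connected_continuous_image continuous_intros holomorphic_on_imp_continuous_on phi0 connected_H)
  define \<epsilon> where "\<epsilon> = sgn (Im (\<phi>\<^sub>0 \<i>))"
  have eps: "\<epsilon> = 1 \<or> \<epsilon> = - 1" using nz[of \<i>] by (auto simp: \<epsilon>_def sgn_if)
  \<comment> \<open>Both signs give an inverse cosine; this one has positive imaginary part.\<close>
  define \<phi>\<^sub>1 where "\<phi>\<^sub>1 w = of_real \<epsilon> * \<phi>\<^sub>0 w" for w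
  have pos: "0 < Im (\<phi>\<^sub>1 w)" if "w \<in> H" for w
  proof (rule ccontr)
    assume "\<not> 0 < Im (\<phi>\<^sub>1 w)"
    then have "\<epsilon> * Im (\<phi>\<^sub>0 w) \<le> 0" by (simp add: \<phi>\<^sub>1_def)
    moreover have "\<epsilon> * Im (\<phi>\<^sub>0 \<i>) > 0" using nz[of \<i>] by (auto simp: \<epsilon>_def sgn_if)
    ultimately have "min (Im (\<phi>\<^sub>0 w)) (Im (\<phi>\<^sub>0 \<i>)) \<le> 0" "0 \<le> max (Im (\<phi>\<^sub>0 w)) (Im (\<phi>\<^sub>0 \<i>))"
      using eps by (auto simp: min_def max_def)
    then have "0 \<in> (\<lambda>w. Im (\<phi>\<^sub>0 w)) ` H"
      using connectedD_interval[OF conn, of "min (Im (\<phi>\<^sub>0 w)) (Im (\<phi>\<^sub>0 \<i>))" "max (Im (\<phi>\<^sub>0 w)) (Im (\<phi>\<^sub>0 \<i>))" 0] that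
      by (auto simp: min_def max_def split: if_splits)
    then show False using nz by auto
  qed
  have cos1: "cos (\<phi>\<^sub>1 w) = g w" if "w \<in> H" for w
    using eps phi0(2)[OF that] by (auto simp: \<phi>\<^sub>1_def)
  have hol1: "\<phi>\<^sub>1 holomorphic_on H" unfolding \<phi>\<^sub>1_def by (intro holomorphic_intros phi0)
  then have cont1: "continuous_on H \<phi>\<^sub>1" by (rule holomorphic_on_imp_continuous_on)
  obtain \<psi> where psi: "continuous_on (closure H) \<psi>" "\<And>w. w \<in> H \<Longrightarrow> \<psi> w = \<phi>\<^sub>1 w"
  proof (rule continuous_extension_to_closure[OF cont1])
    fix w assume w: "w \<in> closure H - H"
    have "(g \<longlongrightarrow> g w) (at w within C)" using cont_g w closure_H by (auto simp: continuous_on_def)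
    then have "(g \<longlongrightarrow> g w) (at w within H)" by (rule tendsto_within_subset) auto
    then show "\<exists>l. (\<phi>\<^sub>1 \<longlongrightarrow> l) (at w within H)"
      using w by (intro arccos_branch_has_limit[OF _ _ cont1 _ cos1]) (auto intro: convex_halfspace_Im_gt)
  qed blast
  have cospsi: "cos (\<psi> w) = g w" if "w \<in> C" for w
  proof -
    have "cos (\<psi> w) - g w = 0"
    proof (rule continuous_constant_on_closure[where S = H and f = "\<lambda>w. cos (\<psi> w) - g w" and a = 0 and x = w])
      show "continuous_on (closure H) (\<lambda>w. cos (\<psi> w) - g w)"
        using psi(1) cont_g unfolding closure_H by (intro continuous_intros)
      show "cos (\<psi> v) - g v = 0" if "v \<in> H" for v using psi(2)[OF that] cos1[OF that] by simp
      show "w \<in> closure H" using that closure_H by simp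
    qed
    then show ?thesis by simp
  qed
  have "cos (\<psi> (of_real (x 0))) = 1" using cospsi[of "of_real (x 0)"] g_real[of "x 0"] k_x[of 0] x_pos by simp
  then obtain n :: int where n: "\<psi> (of_real (x 0)) = of_real (2 * real_of_int n * pi)"
    by (auto simp: cos_eq_1)
  show ?thesis
  proof (intro exI conjI ballI)
    let ?\<phi> = "\<lambda>w. \<psi> w - of_real (2 * real_of_int n * pi)"
    show "continuous_on C ?\<phi>" using psi(1) unfolding closure_H by (intro continuous_intros)
    have "\<psi> holomorphic_on H" using hol1 psi(2) holomorphic_transform by metis
    then show "?\<phi> holomorphic_on H" by (intro holomorphic_intros)
    show "cos (?\<phi> w) = g w" if "w \<in> C" for w
    proof -
      have "cos (?\<phi> w) = cos (\<psi> w)"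
        unfolding complex_cos_eq by (intro bexI[of _ "of_int (- n)"] disjI1) auto
      then show ?thesis using cospsi[OF that] by simp
    qed
    show "0 < Im (?\<phi> w)" if "w \<in> H" for w using pos[OF that] psi(2)[OF that] by simp
    show "?\<phi> (of_real (x 0)) = 0" using n by simp
  qed
qed

end

locale alternating_map_branch = alternating_map +
  fixes \<phi> :: "complex \<Rightarrow> complex"
  assumes cont: "continuous_on {w. 0 \<le> Im w} \<phi>" and hol: "\<phi> holomorphic_on {w. 0 < Im w}"
    and cos_phi: "\<And>w. 0 \<le> Im w \<Longrightarrow> cos (\<phi> w) = g w"
    and Im_pos: "\<And>w. 0 < Im w \<Longrightarrow> 0 < Im (\<phi> w)"
    and phi_x0: "\<phi> (of_real (x 0)) = 0"
begin

lemma Im_nonneg: "0 \<le> Im w \<Longrightarrow> 0 \<le> Im (\<phi> w)"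
  using continuous_ge_on_closure[of H "\<lambda>w. Im (\<phi> w)" w 0] cont closure_H Im_pos
  by (auto intro!: continuous_intros simp: less_imp_le)

lemma Im_phi_zero:
  assumes "0 \<le> t" "\<bar>k t\<bar> \<le> 1"
  shows "Im (\<phi> (of_real t)) = 0"
proof (rule ccontr)
  let ?z = "\<phi> (of_real t)"
  assume nz: "Im ?z \<noteq> 0"
  have c: "cos ?z = of_real (k t)" using cos_phi[of "of_real t"] g_real assms by simp
  have "sin (Re ?z) * sinh (Im ?z) = 0" using Im_cos_sinh[of ?z] c by simp
  then have "sin (Re ?z) = 0" using nz by simp
  then have "\<bar>cos (Re ?z)\<bar> = 1" using sin_zero_abs_cos_one by blast
  then have "\<bar>Re (cos ?z)\<bar> = cosh (Im ?z)" by (simp add: Re_cos_cosh abs_mult)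
  moreover have "cosh (Im ?z) > 1"
  proof -
    have "cosh (Im ?z) \<noteq> 1" using nz by simp
    then show ?thesis using cosh_real_ge_1[of "Im ?z"] by linarith
  qed
  ultimately show False using c assms(2) by simp
qed

lemma sin_zero_Im_pos:
  assumes "0 \<le> t" "1 < \<bar>k t\<bar>"
  shows "sin (Re (\<phi> (of_real t))) = 0" "0 < Im (\<phi> (of_real t))"
proof -
  let ?z = "\<phi> (of_real t)"
  have c: "cos ?z = of_real (k t)" using cos_phi[of "of_real t"] g_real assms by simp
  have "Im ?z \<noteq> 0"
  proof
    assume "Im ?z = 0"
    then have "k t = cos (Re ?z)" using c Re_cos_cosh[of ?z] by simp
    then show False using assms(2) abs_cos_le_one[of "Re ?z"] by linarith
  qed
  then show "0 < Im ?z" using Im_nonneg[of "of_real t"] by simp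
  have "sin (Re ?z) * sinh (Im ?z) = 0" using Im_cos_sinh[of ?z] c by simp
  then show "sin (Re ?z) = 0" using \<open>Im ?z \<noteq> 0\<close> by simp
qed

lemma cos_Re_phi:
  assumes "0 \<le> t" "\<bar>k t\<bar> \<le> 1"
  shows "cos (Re (\<phi> (of_real t))) = k t"
  using Im_phi_zero[OF assms] Re_cos_cosh[of "\<phi> (of_real t)"] cos_phi[of "of_real t"] g_real[OF assms(1)] by simp

lemma continuous_on_Re_phi: "continuous_on A (\<lambda>t. Re (\<phi> (of_real t)))"
  by (intro continuous_intros continuous_on_compose2[OF cont]) auto

text \<open>The orientation of the boundary map. Just above a real point, \<open>Im g\<close> is \<open>k'(t)\<close> times the height to first
  order, and it is also \<open>- sin u sinh v\<close> with \<open>v > 0\<close>. So \<open>\<phi>\<close> moves to the right along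
  the base of the half-strip as \<open>t\<close> increases.\<close>

lemma sine_opposes_derivative:
  assumes t: "0 < t"
  shows "k' t * sin (Re (\<phi> (of_real t))) \<le> 0"
proof -
  let ?p = "\<lambda>\<epsilon>. of_real t + \<i> * of_real \<epsilon> :: complex"
  have mem: "of_real t \<in> - (\<real>\<^sub>\<le>\<^sub>0 :: complex set)" using t by simp
  have "open (- (\<real>\<^sub>\<le>\<^sub>0 :: complex set))" by (simp add: closed_nonpos_Reals_complex open_Compl)
  then have "(g has_field_derivative of_real (k' t)) (at (of_real t))"
    using holomorphic_derivI[OF hol_g _ mem] deriv_real[OF t] by simp
  then have quot: "((\<lambda>h. (g (of_real t + h) - g (of_real t)) / h) \<longlongrightarrow> of_real (k' t)) (at 0)"
    by (rule DERIV_D)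
  have "filterlim (\<lambda>\<epsilon>. \<i> * of_real \<epsilon> :: complex) (at 0) (at_right 0)"
  proof (rule filterlim_atI)
    show "((\<lambda>\<epsilon>. \<i> * of_real \<epsilon> :: complex) \<longlongrightarrow> 0) (at_right 0)"
      by (rule tendsto_eq_intros refl tendsto_within_subset[OF tendsto_ident_at] | simp)+
    show "eventually (\<lambda>\<epsilon>. \<i> * of_real \<epsilon> \<noteq> (0 :: complex)) (at_right 0)"
      by (auto simp: eventually_at_filter)
  qed
  from filterlim_compose[OF quot this]
  have "((\<lambda>\<epsilon>. Re ((g (?p \<epsilon>) - g (of_real t)) / (\<i> * of_real \<epsilon>))) \<longlongrightarrow> k' t) (at_right 0)"
    using tendsto_Re by fastforce
  moreover have "((\<lambda>\<epsilon>. sin (Re (\<phi> (?p \<epsilon>)))) \<longlongrightarrow> sin (Re (\<phi> (?p 0)))) (at_right 0)"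
  proof -
    have "continuous_on {0..} (\<lambda>\<epsilon>. sin (Re (\<phi> (?p \<epsilon>))))"
      by (intro continuous_intros continuous_on_compose2[OF cont]) auto
    then have "((\<lambda>\<epsilon>. sin (Re (\<phi> (?p \<epsilon>)))) \<longlongrightarrow> sin (Re (\<phi> (?p 0)))) (at 0 within {0..})"
      unfolding continuous_on_def by (rule bspec) simp
    then show ?thesis by (rule tendsto_within_subset) auto
  qed
  ultimately have lim: "((\<lambda>\<epsilon>. Re ((g (?p \<epsilon>) - g (of_real t)) / (\<i> * of_real \<epsilon>)) * sin (Re (\<phi> (?p \<epsilon>))))
      \<longlongrightarrow> k' t * sin (Re (\<phi> (?p 0)))) (at_right 0)"
    by (intro tendsto_mult)
  have nonpos: "Re ((g (?p \<epsilon>) - g (of_real t)) / (\<i> * of_real \<epsilon>)) * sin (Re (\<phi> (?p \<epsilon>))) \<le> 0" if "0 < \<epsilon>" for \<epsilon>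
  proof -
    have "Re ((g (?p \<epsilon>) - g (of_real t)) / (\<i> * of_real \<epsilon>)) = Im (g (?p \<epsilon>)) / \<epsilon>"
      using that g_real[of t] t by (simp add: Re_divide power2_eq_square)
    also have "Im (g (?p \<epsilon>)) = - (sin (Re (\<phi> (?p \<epsilon>))) * sinh (Im (\<phi> (?p \<epsilon>))))"
      using cos_phi[of "?p \<epsilon>"] that Im_cos_sinh[of "\<phi> (?p \<epsilon>)"] by simp
    finally have "Re ((g (?p \<epsilon>) - g (of_real t)) / (\<i> * of_real \<epsilon>)) * sin (Re (\<phi> (?p \<epsilon>)))
      = - ((sin (Re (\<phi> (?p \<epsilon>))))\<^sup>2 * sinh (Im (\<phi> (?p \<epsilon>))) / \<epsilon>)"
      by (simp add: power2_eq_square)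
    moreover have "0 < Im (\<phi> (?p \<epsilon>))" using Im_pos[of "?p \<epsilon>"] that by simp
    ultimately show ?thesis using that by simp
  qed
  have "k' t * sin (Re (\<phi> (?p 0))) \<le> 0"
    by (rule tendsto_upperbound[OF lim]) (auto simp: eventually_at_filter nonpos)
  then show ?thesis by simp
qed

lemma x_mono: "i < j \<Longrightarrow> j \<le> Suc m \<Longrightarrow> x i < x j"
  by (rule less_of_steps[where m = m]) (use x_inc in auto)

lemma x_gt_0: "j \<le> Suc m \<Longrightarrow> 0 < x j"
  using x_mono[of 0 j] x_pos by (cases j) auto

lemma sin_minus_multiple_pi: "sin (u - real j * pi) = (- 1) ^ j * sin u"
  by (simp add: sin_diff cos_npi)

lemma cos_minus_multiple_pi: "cos (u - real j * pi) = (- 1) ^ j * cos u"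
  by (simp add: cos_diff cos_npi)

lemma sine_sign:
  assumes "j \<le> m" "x j < t" "t < x (Suc j)"
  shows "0 < sin (Re (\<phi> (of_real t)) - real j * pi)"
proof -
  have t0: "0 < t" using x_gt_0[of j] assms by simp
  have b: "\<bar>k t\<bar> < 1" "(- 1) ^ j * k' t < 0" using k_between[OF assms] by auto
  define S where "S = (- 1) ^ j * sin (Re (\<phi> (of_real t)))"
  have "cos (Re (\<phi> (of_real t))) = k t" using cos_Re_phi[of t] b t0 by simp
  then have "sin (Re (\<phi> (of_real t))) \<noteq> 0" using b(1) sin_zero_abs_cos_one[of "Re (\<phi> (of_real t))"] by auto
  then have "S \<noteq> 0" by (simp add: S_def)
  moreover have "(- 1) ^ j * k' t * S \<le> 0"
    using sine_opposes_derivative[OF t0] by (cases "even j") (auto simp: S_def)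
  then have "0 \<le> S" using b(2) by (simp add: mult_le_0_iff)
  ultimately have "0 < S" by simp
  then show ?thesis by (simp add: sin_minus_multiple_pi S_def)
qed

text \<open>On each interval between consecutive points \<open>\<phi>\<close> is real, and \<open>sine_sign\<close> confines it to one arch of the
  sine, at whose far end the cosine has reached the next value \<open>\<plusminus>1\<close>: the image advances by exactly \<open>\<pi>\<close>.\<close>

lemma phi_x: "j \<le> Suc m \<Longrightarrow> \<phi> (of_real (x j)) = of_real (real j * pi)"
proof (induction j)
  case 0
  then show ?case by (simp add: phi_x0)
next
  case (Suc j)
  let ?V = "\<lambda>t. Re (\<phi> (of_real t)) - real j * pi"
  have "?V (x (Suc j)) = pi"
  proof (rule crosses_sine_arch[of "x j" "x (Suc j)" ?V])
    show "continuous_on {x j..x (Suc j)} ?V" by (intro continuous_intros continuous_on_Re_phi)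
    show "?V (x j) = 0" using Suc by simp
    show "x j < x (Suc j)" using Suc.prems x_inc by simp
    show "cos (?V (x (Suc j))) = - 1"
      using cos_Re_phi[of "x (Suc j)"] k_x[of "Suc j"] x_gt_0[of "Suc j"] Suc.prems
      by (simp add: cos_minus_multiple_pi power_mult_distrib[symmetric])
    show "0 < sin (?V t)" if "x j < t" "t < x (Suc j)" for t using sine_sign[of j t] that Suc.prems by simp
  qed
  moreover have "Im (\<phi> (of_real (x (Suc j)))) = 0"
    using Im_phi_zero[of "x (Suc j)"] k_x[of "Suc j"] x_gt_0[of "Suc j"] Suc.prems by simp
  ultimately show ?case by (simp add: complex_eq_iff algebra_simps)
qed

lemma Re_phi_left:
  assumes "0 \<le> t" "t \<le> x 0"
  shows "Re (\<phi> (of_real t)) = 0"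
proof (rule zero_of_sine_zero[of "{0..x 0}" "\<lambda>t. Re (\<phi> (of_real t))" "x 0" t])
  show "sin (Re (\<phi> (of_real u))) = 0" if "u \<in> {0..x 0}" for u
    using that sin_zero_Im_pos[of u] k_left[of u] phi_x0 by (cases "u = x 0") auto
qed (use assms x_pos phi_x0 continuous_on_Re_phi in auto)

lemma Re_phi_right:
  assumes "x (Suc m) \<le> t"
  shows "Re (\<phi> (of_real t)) = real (Suc m) * pi"
proof -
  have "Re (\<phi> (of_real t)) - real (Suc m) * pi = 0"
  proof (rule zero_of_sine_zero[of "{x (Suc m)..}" "\<lambda>t. Re (\<phi> (of_real t)) - real (Suc m) * pi" "x (Suc m)" t])
    show "sin (Re (\<phi> (of_real u)) - real (Suc m) * pi) = 0" if "u \<in> {x (Suc m)..}" for u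
      unfolding sin_minus_multiple_pi
      using that sin_zero_Im_pos[of u] k_right[of u] phi_x[of "Suc m"] x_gt_0[of "Suc m"]
      by (cases "u = x (Suc m)") (auto simp del: of_nat_Suc)
  qed (use assms phi_x[of "Suc m"] in \<open>auto intro!: continuous_intros continuous_on_Re_phi simp del: of_nat_Suc\<close>)
  then show ?thesis by simp
qed

lemma between_points:
  "x 0 \<le> t \<Longrightarrow> t \<le> x n \<Longrightarrow> n \<le> Suc m \<Longrightarrow>
    (\<exists>j\<le>n. t = x j) \<or> (\<exists>j<n. x j < t \<and> t < x (Suc j))"
proof (induction n)
  case 0
  then show ?case by auto
next
  case (Suc n)
  consider "t \<le> x n" | "t = x (Suc n)" | "x n < t" "t < x (Suc n)" using Suc.prems by linarith
  then show ?case
  proof cases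
    case 1
    then have "(\<exists>j\<le>n. t = x j) \<or> (\<exists>j<n. x j < t \<and> t < x (Suc j))" using Suc by simp
    then show ?thesis using le_SucI less_SucI by blast
  next
    case 2
    then show ?thesis by (intro disjI1 exI[of _ "Suc n"]) simp
  next
    case 3
    then show ?thesis by (intro disjI2 exI[of _ n]) simp
  qed
qed

lemma phi_middle:
  assumes "x 0 \<le> t" "t \<le> x (Suc m)"
  shows "Im (\<phi> (of_real t)) = 0"
    and "0 \<le> Re (\<phi> (of_real t))" "Re (\<phi> (of_real t)) \<le> real (Suc m) * pi"
proof -
  have t: "0 \<le> t" using assms x_pos by simp
  have "Im (\<phi> (of_real t)) = 0 \<and> 0 \<le> Re (\<phi> (of_real t)) \<and> Re (\<phi> (of_real t)) \<le> real (Suc m) * pi"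
    using between_points[OF assms order_refl]
  proof (elim disjE exE conjE)
    fix j assume j: "j \<le> Suc m" "t = x j"
    have "real j * pi \<le> real (Suc m) * pi" using j(1) by (intro mult_right_mono) auto
    then show ?thesis using phi_x[OF j(1)] j(2) by simp
  next
    fix j assume j: "j < Suc m" "x j < t" "t < x (Suc j)"
    let ?V = "\<lambda>t. Re (\<phi> (of_real t)) - real j * pi"
    have "continuous_on {x j..t} ?V" by (intro continuous_intros continuous_on_Re_phi)
    moreover have "?V (x j) = 0" using phi_x[of j] j by simp
    moreover have "0 < sin (?V u)" if "x j < u" "u \<le> t" for u using sine_sign[of j u] j that by simp
    ultimately have V: "0 < Re (\<phi> (of_real t)) - real j * pi" "Re (\<phi> (of_real t)) - real j * pi < pi"
      using stays_in_sine_arch[of "x j" t ?V] j(2) by blast+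
    have "(real j + 1) * pi \<le> real (Suc m) * pi" using j(1) by (intro mult_right_mono) auto
    then have "real j * pi + pi \<le> real (Suc m) * pi" by (simp only: distrib_right mult_1)
    moreover have "0 \<le> real j * pi" by simp
    ultimately have "0 \<le> Re (\<phi> (of_real t)) \<and> Re (\<phi> (of_real t)) \<le> real (Suc m) * pi"
      using V by (intro conjI; linarith)
    moreover have "\<bar>k t\<bar> \<le> 1" using k_between[of j t] j by simp
    ultimately show ?thesis using Im_phi_zero[OF t] by simp
  qed
  then show "Im (\<phi> (of_real t)) = 0" "0 \<le> Re (\<phi> (of_real t))" "Re (\<phi> (of_real t)) \<le> real (Suc m) * pi"
    by auto
qed

text \<open>The functional equation of the curve is the identity \<open>Im (cos \<zeta>) = - sin u sinh v\<close>. As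
  \<open>Im g\<close> is negative on the negative axis, \<open>sin u\<close> is positive, so \<open>u\<close>, which starts at \<open>0\<close>, stays below \<open>\<pi>\<close>.\<close>

lemma phi_minus:
  assumes "0 < r"
  shows "sin (Re (\<phi> (- of_real r))) * sinh (Im (\<phi> (- of_real r))) = \<kappa> * r powr s"
    and "0 < Im (\<phi> (- of_real r))"
    and "0 < Re (\<phi> (- of_real r))" "Re (\<phi> (- of_real r)) < pi"
proof -
  have eq: "sin (Re (\<phi> (- of_real r))) * sinh (Im (\<phi> (- of_real r))) = \<kappa> * r powr s" if "0 < r" for r
    using Im_cos_sinh[of "\<phi> (- of_real r)"] cos_phi[of "- of_real r"] Im_g_minus[OF that] by simp
  show "sin (Re (\<phi> (- of_real r))) * sinh (Im (\<phi> (- of_real r))) = \<kappa> * r powr s" using eq assms .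
  have pos: "0 < Im (\<phi> (- of_real r)) \<and> 0 < sin (Re (\<phi> (- of_real r)))" if "0 < r" for r
  proof -
    have *: "0 < sin (Re (\<phi> (- of_real r))) * sinh (Im (\<phi> (- of_real r)))"
      using eq[OF that] \<kappa>_pos that by simp
    moreover have "0 \<le> sinh (Im (\<phi> (- of_real r)))" using Im_nonneg[of "- of_real r"] by simp
    ultimately show ?thesis by (auto simp: zero_less_mult_iff)
  qed
  show "0 < Im (\<phi> (- of_real r))" using pos assms by blast
  let ?V = "\<lambda>t. Re (\<phi> (of_real (- t)))"
  have "continuous_on {0..r} ?V" by (intro continuous_intros continuous_on_compose2[OF cont]) auto
  moreover have "?V 0 = 0" using Re_phi_left[of 0] x_pos by simp
  ultimately show "0 < Re (\<phi> (- of_real r))" "Re (\<phi> (- of_real r)) < pi"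
    using stays_in_sine_arch[of 0 r ?V] pos assms by auto
qed

end

section \<open>The image of the upper half-plane\<close>

context alternating_map_branch
begin

abbreviation "\<Omega> \<equiv> \<phi> ` H"
abbreviation "\<gamma> \<equiv> (\<lambda>r. \<phi> (- of_real r)) ` {0<..}"
abbreviation "strip \<equiv> {w. 0 < Re w \<and> Re w < real (m + 1) * pi \<and> 0 < Im w}"

lemma boundary_cases:
  assumes "Im w = 0"
  obtains (minus) r where "0 < r" "w = - of_real r"
    | (left) t where "0 \<le> t" "t \<le> x 0" "w = of_real t"
    | (middle) t where "x 0 < t" "t \<le> x (Suc m)" "w = of_real t"
    | (right) t where "x (Suc m) < t" "w = of_real t"
proof -
  have "w = of_real (Re w)" using assms by (simp add: complex_eq_iff)
  then show ?thesis
    using minus[of "- Re w"] left[of "Re w"] middle[of "Re w"] right[of "Re w"] by fastforce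
qed

lemma Re_phi_boundary:
  assumes "Im w = 0"
  shows "0 \<le> Re (\<phi> w)" "Re (\<phi> w) \<le> real (m + 1) * pi"
proof -
  have "0 < real (m + 1) * pi" by simp
  moreover have "pi \<le> real (m + 1) * pi" by simp
  ultimately have "0 \<le> Re (\<phi> w) \<and> Re (\<phi> w) \<le> real (m + 1) * pi"
    using boundary_cases[OF assms] phi_minus(3,4) Re_phi_left Re_phi_right phi_middle(2,3)
    by (smt (verit) Suc_eq_plus1)
  then show "0 \<le> Re (\<phi> w)" "Re (\<phi> w) \<le> real (m + 1) * pi" by auto
qed

lemma g_infinity_bound:
  obtains R where "0 < R" "\<And>w. R \<le> cmod w \<Longrightarrow> B < cmod (g w)"
proof -
  have "eventually (\<lambda>w. B + 1 \<le> cmod (g w)) at_infinity"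
    using filterlim_at_infinity_imp_norm_at_top[OF g_infinity] by (simp add: filterlim_at_top)
  then obtain R where R: "\<And>w. R \<le> cmod w \<Longrightarrow> B + 1 \<le> cmod (g w)" unfolding eventually_at_infinity by blast
  show ?thesis
  proof (rule that[of "max R 1"])
    show "B < cmod (g w)" if "max R 1 \<le> cmod w" for w using R[of w] that by simp
  qed simp
qed

text \<open>Properness: as \<open>g\<close> tends to infinity at infinity, bounded values of \<open>g\<close> come from bounded points.\<close>

lemma convergent_subsequence:
  assumes "\<And>n. w n \<in> C" "bounded (range (\<lambda>n::nat. g (w n)))"
  obtains l r where "l \<in> C" "strict_mono (r::nat\<Rightarrow>nat)" "(\<lambda>n. w (r n)) \<longlonglongrightarrow> l"
proof -
  obtain B where B: "\<And>n. cmod (g (w n)) \<le> B" using assms(2) by (auto simp: bounded_iff)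
  obtain R where R: "\<And>w. R \<le> cmod w \<Longrightarrow> B < cmod (g w)" using g_infinity_bound[of B] by blast
  have "w n \<in> C \<inter> cball 0 R" for n using R[of "w n"] B[of n] assms(1)[of n] by force
  moreover have "compact (C \<inter> cball 0 R)"
    by (intro closed_Int_compact closed_halfspace_Im_ge compact_cball)
  ultimately show ?thesis using that unfolding compact_def comp_def by blast
qed

lemma phi_tendsto:
  assumes "l \<in> C" "\<And>n. w n \<in> C" "w \<longlonglongrightarrow> l"
  shows "(\<lambda>n. \<phi> (w n)) \<longlonglongrightarrow> \<phi> l"
  using continuous_on_tendsto_compose[OF cont assms(3)] assms(1,2) by auto

lemma closed_image: "closed (\<phi> ` C)"
proof (unfold closed_sequential_limits, intro allI impI, elim conjE)
  fix z l assume "\<forall>n. z n \<in> \<phi> ` C" and z: "z \<longlonglongrightarrow> l"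
  then have "\<exists>v. v \<in> C \<and> z n = \<phi> v" for n by blast
  then obtain w where w: "\<And>n. w n \<in> C" "\<And>n. z n = \<phi> (w n)" by metis
  have "(\<lambda>n. g (w n)) = (\<lambda>n. cos (z n))" using w cos_phi by auto
  then have "(\<lambda>n. g (w n)) \<longlonglongrightarrow> cos l" using z by (auto intro: tendsto_intros)
  then have "bounded (range (\<lambda>n. g (w n)))" by (rule convergent_imp_bounded)
  then obtain v r where v: "v \<in> C" "strict_mono r" "(\<lambda>n. w (r n)) \<longlonglongrightarrow> v"
    using convergent_subsequence[of w] w(1) by blast
  have "(\<lambda>n. \<phi> (w (r n))) \<longlonglongrightarrow> \<phi> v" using phi_tendsto[OF v(1) _ v(3)] w(1) by blast
  moreover have "(\<lambda>n. \<phi> (w (r n))) \<longlonglongrightarrow> l"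
    using LIMSEQ_subseq_LIMSEQ[OF z v(2)] w(2) by (simp add: comp_def)
  ultimately show "l \<in> \<phi> ` C" using v(1) LIMSEQ_unique by blast
qed

lemma deriv_phi:
  assumes "0 < Im w"
  shows "deriv \<phi> w \<noteq> 0"
proof
  assume zero: "deriv \<phi> w = 0"
  have "(\<phi> has_field_derivative 0) (at w)"
    using holomorphic_derivI[OF hol open_H, of w] assms zero by simp
  then have "((\<lambda>w. cos (\<phi> w)) has_field_derivative 0) (at w)"
    by (auto intro!: derivative_eq_intros)
  then have "(g has_field_derivative 0) (at w)"
    by (rule has_field_derivative_transform_within_open[OF _ open_H]) (use assms cos_phi in auto)
  then show False using deriv_g[OF assms] DERIV_imp_deriv by blast
qed

lemma not_constant: "\<not> \<phi> constant_on H"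
proof
  assume "\<phi> constant_on H"
  then obtain c where c: "\<And>w. w \<in> H \<Longrightarrow> \<phi> w = c" by (auto simp: constant_on_def)
  have "(\<phi> has_field_derivative 0) (at \<i>)"
    by (rule has_field_derivative_transform_within_open[OF DERIV_const open_H]) (use c in auto)
  then show False using deriv_phi[of \<i>] DERIV_imp_deriv by force
qed

lemma open_image: "open U \<Longrightarrow> U \<subseteq> H \<Longrightarrow> open (\<phi> ` U)"
  by (rule open_mapping_thm[OF hol open_H connected_H _ _ not_constant])

lemma open_Omega: "open \<Omega>"
  using open_image[OF open_H] by blast

text \<open>The image \<open>\<Omega>\<close> is open, and by properness the image of the closed half-plane is closed. A set \<open>T\<close> that
  misses the boundary values meets both in the same set, which is therefore open and closed in \<open>T\<close>.\<close>

lemma connected_subset_image: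
  assumes T: "connected T" and bd: "\<And>w. Im w = 0 \<Longrightarrow> \<phi> w \<notin> T" and ne: "T \<inter> \<Omega> \<noteq> {}"
  shows "T \<subseteq> \<Omega>"
proof -
  have eq: "T \<inter> \<Omega> = T \<inter> \<phi> ` C" using bd by (force simp: order_le_less)
  have "openin (top_of_set T) (T \<inter> \<Omega>)" using open_Omega by (simp add: openin_open_Int)
  moreover have "closedin (top_of_set T) (T \<inter> \<Omega>)"
    unfolding eq using closed_image by (simp add: closedin_closed_Int)
  ultimately have "T \<inter> \<Omega> = T" using T ne unfolding connected_clopen by blast
  then show ?thesis by blast
qed

text \<open>The complement of the closed half-strip is connected, misses the boundary values, and is not contained
  in \<open>\<Omega>\<close>, where imaginary parts are positive; so it is disjoint from \<open>\<Omega>\<close>. Openness of \<open>\<Omega>\<close> then removes the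
  edges as well.\<close>

lemma Omega_strip: "\<Omega> \<subseteq> strip"
proof -
  let ?b = "real (m + 1) * pi"
  define A1 where "A1 = {w. Re w < 0}"
  define A2 where "A2 = {w. Im w < 0}"
  define A3 where "A3 = {w. ?b < Re w}"
  have conn: "connected A1" "connected A2" "connected A3"
    unfolding A1_def A2_def A3_def
    by (rule convex_connected, rule convex_halfspace_Re_lt convex_halfspace_Im_lt convex_halfspace_Re_gt)+
  have "Complex (- 1) (- 1) \<in> A1 \<inter> A2" "Complex (?b + 1) (- 1) \<in> A2 \<inter> A3"
    unfolding A1_def A2_def A3_def by simp_all
  then have "A1 \<inter> A2 \<noteq> {}" "(A1 \<union> A2) \<inter> A3 \<noteq> {}" by blast+
  then have conn3: "connected (A1 \<union> A2 \<union> A3)" by (intro connected_Un conn)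
  have bd: "\<phi> w \<notin> A1 \<union> A2 \<union> A3" if "Im w = 0" for w
    using Re_phi_boundary[OF that] Im_nonneg[of w] that by (auto simp: A1_def A2_def A3_def)
  have disj: "(A1 \<union> A2 \<union> A3) \<inter> \<Omega> = {}"
  proof (rule ccontr)
    assume "(A1 \<union> A2 \<union> A3) \<inter> \<Omega> \<noteq> {}"
    then have "A1 \<union> A2 \<union> A3 \<subseteq> \<Omega>" using connected_subset_image[OF conn3] bd by presburger
    then have "- \<i> \<in> \<Omega>" by (auto simp: A2_def)
    then obtain w where "0 < Im w" "\<phi> w = - \<i>" by force
    then show False using Im_pos[of w] by simp
  qed
  show ?thesis
  proof
    fix \<zeta> assume z: "\<zeta> \<in> \<Omega>"
    obtain e where e: "0 < e" "cball \<zeta> e \<subseteq> \<Omega>" using open_Omega z open_contains_cball by blast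
    have "\<zeta> - of_real e \<in> \<Omega>" "\<zeta> + of_real e \<in> \<Omega>" using e by (auto simp: dist_norm intro!: subsetD[OF e(2)])
    then have "\<zeta> - of_real e \<notin> A1" "\<zeta> + of_real e \<notin> A3" using disj by blast+
    moreover have "0 < Im \<zeta>" using z Im_pos by auto
    ultimately show "\<zeta> \<in> strip" using e(1) by (auto simp: A1_def A3_def)
  qed
qed

text \<open>The part of the half-strip to the left of \<open>\<gamma>\<close>, described in the plane of the cosine. There \<open>\<gamma>\<close> becomes the
  curve \<open>g(-r)\<close>, \<open>r > 0\<close>, in the lower half-plane, which meets every horizontal line at most once because its
  imaginary part \<open>- \<kappa> r\<^sup>s\<close> is strictly decreasing. The points to the right of this graph correspond to the
  points to the left of \<open>\<gamma>\<close>, since high up along the left edge of the half-strip the cosine is large and positive.\<close>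

definition Left :: "complex set" where
  "Left = (\<lambda>(r, t). Arccos (g (- of_real r) + of_real t)) ` ({0<..} \<times> {0<..})"

lemma Im_shifted: "0 < r \<Longrightarrow> Im (g (- of_real r) + of_real t) < 0"
  using Im_g_minus[of r] \<kappa>_pos by simp

lemma connected_Left: "connected Left"
  unfolding Left_def case_prod_beta
proof (intro connected_continuous_image)
  show "connected ({0::real<..} \<times> {0::real<..})" by (intro connected_Times) auto
  have "continuous_on ({0<..} \<times> {0<..}) (\<lambda>p::real\<times>real. g (- of_real (fst p)) + of_real (snd p))"
    by (intro continuous_intros continuous_on_compose2[OF cont_g]) auto
  then show "continuous_on ({0<..} \<times> {0<..}) (\<lambda>p. Arccos (g (- of_real (fst p)) + of_real (snd p)))"
    using Im_shifted
    by (intro continuous_on_compose2[OF continuous_at_imp_continuous_on[of "{c. Im c < 0}" Arccos]]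
        ballI isCont_Arccos) auto
qed

lemma g_minus_inj:
  assumes "0 < r" "0 < r'" "Im (g (- of_real r)) = Im (g (- of_real r'))"
  shows "r = r'"
proof -
  have "r powr s = r' powr s" using assms Im_g_minus \<kappa>_pos by simp
  then show ?thesis
    using powr_less_mono2[OF s_pos, of r r'] powr_less_mono2[OF s_pos, of r' r] assms(1,2)
    by (cases r r' rule: linorder_cases) auto
qed

lemma boundary_not_Left:
  assumes "Im w = 0"
  shows "\<phi> w \<notin> Left"
proof
  assume "\<phi> w \<in> Left"
  then obtain r t where rt: "0 < r" "0 < t" "\<phi> w = Arccos (g (- of_real r) + of_real t)"
    by (auto simp: Left_def)
  then have eq: "g w = g (- of_real r) + of_real t" using cos_phi[of w] assms by simp
  show False
  proof (cases "0 \<le> Re w")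
    case True
    have "w = of_real (Re w)" using assms by (simp add: complex_eq_iff)
    then have "g w = of_real (k (Re w))" using g_real[OF True] by metis
    then have "Im (g w) = 0" by simp
    then show False using eq Im_shifted[OF rt(1), of t] by simp
  next
    case False
    define r' where "r' = - Re w"
    have w: "w = - of_real r'" "0 < r'" using False assms by (auto simp: r'_def complex_eq_iff)
    then have "r' = r" using g_minus_inj[of r' r] rt(1) eq by simp
    then show False using eq w rt(2) by simp
  qed
qed

text \<open>Otherwise \<open>\<Omega>\<close> would contain all of \<open>Left\<close>, which accumulates at the points of the left edge above
  \<open>\<phi>(0)\<close>. By properness such a point would be a value of \<open>\<phi>\<close> on the closed half-plane, which it is
  not: \<open>\<phi>\<close> maps only \<open>[0, x 0]\<close> to the left edge, and \<open>k \<le> k 0\<close> there.\<close>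

lemma Omega_Left: "\<Omega> \<inter> Left = {}"
proof (rule ccontr)
  assume "\<Omega> \<inter> Left \<noteq> {}"
  then have sub: "Left \<subseteq> \<Omega>"
    using connected_subset_image[OF connected_Left boundary_not_Left] by blast
  \<comment> \<open>These cosines of points of \<open>Left\<close> tend to \<open>k 0 + 1\<close>, the cosine of a point of the left edge above \<open>\<phi>(0)\<close>.\<close>
  define c where "c n = g (- of_real (inverse (Suc n))) + 1" for n :: nat
  have "\<exists>w. w \<in> H \<and> g w = c n \<and> 0 < Re (\<phi> w) \<and> Re (\<phi> w) < pi" for n
  proof -
    have "Arccos (c n) \<in> Left"
      unfolding Left_def c_def by (intro image_eqI[of _ _ "(inverse (Suc n), 1)"]) auto
    then obtain w where w: "w \<in> H" "\<phi> w = Arccos (c n)" using sub by (metis imageE subsetD)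
    then have "g w = c n" using cos_phi[of w] by simp
    moreover have "Im (c n) < 0" using Im_shifted[of "inverse (Suc n)" 1] by (simp add: c_def)
    ultimately show ?thesis using w Arccos_lower_half_plane[of "c n"] by auto
  qed
  then obtain w where w: "\<And>n. w n \<in> H" "\<And>n. g (w n) = c n"
    "\<And>n. 0 < Re (\<phi> (w n)) \<and> Re (\<phi> (w n)) < pi" by metis
  have "c \<longlonglongrightarrow> g (- of_real 0) + 1"
  proof -
    have "continuous_on UNIV (\<lambda>r. g (- of_real r))"
      by (intro continuous_intros continuous_on_compose2[OF cont_g]) auto
    then have "isCont (\<lambda>r. g (- of_real r)) 0" by (simp add: continuous_on_eq_continuous_at)
    then show ?thesis unfolding c_def
      by (intro tendsto_add tendsto_const isCont_tendsto_compose[where g = "\<lambda>r. g (- of_real r)"]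
          LIMSEQ_inverse_real_of_nat)
  qed
  then have c: "c \<longlonglongrightarrow> of_real (k 0 + 1)" using g_real[of 0] by simp
  then have "bounded (range (\<lambda>n. g (w n)))" using w(2) convergent_imp_bounded by auto
  moreover have "w n \<in> C" for n using w(1)[of n] by simp
  ultimately obtain l r where l: "l \<in> C" "strict_mono r" "(\<lambda>n. w (r n)) \<longlonglongrightarrow> l"
    using convergent_subsequence[of w] by blast
  have lim: "(\<lambda>n. \<phi> (w (r n))) \<longlonglongrightarrow> \<phi> l" using phi_tendsto[OF l(1) _ l(3)] w(1) by (simp add: less_imp_le)
  have "(\<lambda>n. cos (\<phi> (w (r n)))) \<longlonglongrightarrow> cos (\<phi> l)" using lim by (intro tendsto_intros)
  moreover have "(\<lambda>n. cos (\<phi> (w (r n)))) = (\<lambda>n. c (r n))" using w cos_phi by (auto simp: less_imp_le)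
  moreover have "(\<lambda>n. c (r n)) \<longlonglongrightarrow> of_real (k 0 + 1)"
    using LIMSEQ_subseq_LIMSEQ[OF c l(2)] by (simp add: comp_def)
  ultimately have gl: "g l = of_real (k 0 + 1)" using cos_phi[of l] l(1) LIMSEQ_unique by auto
  have Re: "0 \<le> Re (\<phi> l)" "Re (\<phi> l) \<le> pi"
    using LIMSEQ_le_const[OF tendsto_Re[OF lim], of 0] LIMSEQ_le_const2[OF tendsto_Re[OF lim], of pi] w(3)
    by (meson less_imp_le)+
  have k0: "1 < k 0" using k_left[of 0] x_pos by simp
  have pim: "pi < real (m + 1) * pi" using m_pos by simp
  consider "0 < Im l" | "Im l = 0" using l(1) by force
  then show False
  proof cases
    case 1
    then have "\<phi> l \<in> strip" using Omega_strip by blast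
    then have u: "0 < Re (\<phi> l)" "0 < Im (\<phi> l)" by auto
    have "sin (Re (\<phi> l)) * sinh (Im (\<phi> l)) = 0"
      using Im_cos_sinh[of "\<phi> l"] cos_phi[of l] l(1) gl by simp
    then have "sin (Re (\<phi> l)) = 0" using u by simp
    then have "Re (\<phi> l) = pi" using u(1) Re(2) sin_gt_zero[of "Re (\<phi> l)"] by force
    then have "Re (g l) = - cosh (Im (\<phi> l))"
      using Re_cos_cosh[of "\<phi> l"] cos_phi[of l] l(1) by simp
    then show False using gl k0 cosh_real_ge_1[of "Im (\<phi> l)"] by simp
  next
    case 2
    then show False
    proof (cases rule: boundary_cases)
      case (minus r)
      then show False using Im_shifted[of r 0] gl by simp
    next
      case (left t)
      then have "of_real (k t) = (of_real (k 0 + 1) :: complex)" using g_real[of t] gl by simp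
      then have "k t = k 0 + 1" by (rule of_real_eq_iff[THEN iffD1])
      then show False using left k_left[of t] k_x[of 0] k0 by (cases "t = x 0") auto
    next
      case (middle t)
      then have "of_real (k t) = (of_real (k 0 + 1) :: complex)" using g_real[of t] gl x_pos by simp
      then have "k t = k 0 + 1" by (rule of_real_eq_iff[THEN iffD1])
      moreover have "Im (\<phi> l) = 0"
        using phi_middle(1)[OF less_imp_le[OF middle(1)] middle(2)] unfolding middle(3) .
      then have "\<phi> l = of_real (Re (\<phi> l))" by (rule complex_is_Real_iff[THEN iffD2, THEN of_real_Re, symmetric])
      then have "cos (\<phi> l) = of_real (cos (Re (\<phi> l)))" by (metis cos_of_real)
      then have "of_real (k 0 + 1) = (of_real (cos (Re (\<phi> l))) :: complex)"
        using cos_phi[of l] l(1) gl by simp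
      then have "k 0 + 1 = cos (Re (\<phi> l))" by (rule of_real_eq_iff[THEN iffD1])
      ultimately show False using k0 cos_le_one[of "Re (\<phi> l)"] by linarith
    next
      case (right t)
      then show False using Re_phi_right[of t] Re(2) pim by simp
    qed
  qed
qed

text \<open>The boundary values lie on the edges of the half-strip or on \<open>\<gamma>\<close>. A point of \<open>\<gamma>\<close> is a limit of points of
  \<open>Left\<close>, and the open set \<open>\<Omega>\<close>, being disjoint from \<open>Left\<close>, is disjoint from its closure too.\<close>

lemma Omega_boundary:
  assumes "Im w = 0"
  shows "\<phi> w \<notin> \<Omega>"
proof
  assume *: "\<phi> w \<in> \<Omega>"
  then have strip: "\<phi> w \<in> strip" using Omega_strip by blast
  show False
    using assms
  proof (cases rule: boundary_cases)
    case (minus r)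
    have c: "Im (g w) < 0" using Im_shifted[of r 0] minus by simp
    have "\<phi> w = Arccos (g w)"
      using cos_phi[of w] assms phi_minus[OF minus(1)] minus(2) Arccos_cos[of "\<phi> w"] by simp
    have "(\<lambda>n. Arccos (g w + of_real (inverse (Suc n)))) \<longlonglongrightarrow> Arccos (g w + of_real 0)"
      using c by (intro isCont_tendsto_compose[OF isCont_Arccos] tendsto_intros LIMSEQ_inverse_real_of_nat) auto
    moreover have "Arccos (g w + of_real (inverse (Suc n))) \<in> Left" for n
      unfolding Left_def minus(2) using minus(1)
      by (intro image_eqI[of _ _ "(r, inverse (Suc n))"]) auto
    ultimately have "Arccos (g w + of_real 0) \<in> closure Left"
      unfolding closure_sequential
      by (intro exI[of _ "\<lambda>n. Arccos (g w + of_real (inverse (Suc n)))"]) auto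
    then have "\<phi> w \<in> closure Left" using \<open>\<phi> w = Arccos (g w)\<close> by simp
    then show False using open_Int_closure_eq_empty[OF open_Omega, of Left] Omega_Left * by blast
  next
    case (left t)
    then show False using Re_phi_left strip by auto
  next
    case (middle t)
    then show False using phi_middle[of t] strip by auto
  next
    case (right t)
    then show False using Re_phi_right[of t] strip by auto
  qed
qed

lemma frontier_Omega: "frontier \<Omega> = \<phi> ` {w. Im w = 0}"
proof -
  have "closure \<Omega> \<subseteq> \<phi> ` C" using closed_image by (intro closure_minimal) auto
  moreover have "\<phi> ` closure H \<subseteq> closure \<Omega>"
    using cont closure_H by (intro image_closure_subset) (auto simp: closure_subset)
  ultimately have cl: "closure \<Omega> = \<phi> ` C" using closure_H by auto
  have "frontier \<Omega> = \<phi> ` C - \<Omega>" using cl open_Omega by (simp add: frontier_def interior_open)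
  also have "\<dots> = \<phi> ` {w. Im w = 0}"
    using Omega_boundary by (force simp: order_le_less)
  finally show ?thesis .
qed

end

lemma locally_injective_sequences:
  assumes "inj_on f (ball l e)" "0 < e" "v \<longlonglongrightarrow> l" "w \<longlonglongrightarrow> l" "\<And>n::nat. f (v n) = f (w n)"
  shows "\<exists>n. v n = w n"
proof -
  have "eventually (\<lambda>n. v n \<in> ball l e \<and> w n \<in> ball l e) sequentially"
    using tendstoD[OF assms(3,2)] tendstoD[OF assms(4,2)] by eventually_elim (simp add: dist_commute)
  then obtain n where "v n \<in> ball l e" "w n \<in> ball l e" by (auto simp: eventually_sequentially)
  then have "v n = w n" using inj_onD[OF assms(1) assms(5)] by blast
  then show ?thesis ..
qed

context alternating_map_branch
begin

text \<open>Compactness for pairs of points with equal values, as used in both halves of the injectivity proof: to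
  show that the set of values taken twice is closed, and that it stays away from the right edge.\<close>

lemma paired_limits:
  assumes "\<And>n. v n \<in> H" "\<And>n. w n \<in> H" "\<And>n. \<phi> (v n) = \<phi> (w n)" "(\<lambda>n. \<phi> (v n)) \<longlonglongrightarrow> \<zeta>"
  obtains a b r where "a \<in> C" "b \<in> C" "(\<lambda>n. v (r n)) \<longlonglongrightarrow> a" "(\<lambda>n. w (r n :: nat)) \<longlonglongrightarrow> b"
    "\<phi> a = \<zeta>" "\<phi> b = \<zeta>"
proof -
  have C: "v n \<in> C" "w n \<in> C" for n using assms(1,2)[of n] by auto
  have "(\<lambda>n. cos (\<phi> (v n))) \<longlonglongrightarrow> cos \<zeta>" using assms(4) by (intro tendsto_intros)
  moreover have "(\<lambda>n. cos (\<phi> (v n))) = (\<lambda>n. g (v n))" using C cos_phi by auto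
  ultimately have lim: "(\<lambda>n. g (v n)) \<longlonglongrightarrow> cos \<zeta>" by simp
  then have bd: "bounded (range (\<lambda>n. g (v n)))" by (rule convergent_imp_bounded)
  obtain a r1 where a: "a \<in> C" "strict_mono r1" "(\<lambda>n. v (r1 n)) \<longlonglongrightarrow> a"
    using convergent_subsequence[OF C(1) bd] by blast
  have gw: "g (w n) = g (v n)" for n using cos_phi C[of n] assms(3)[of n] by (metis mem_Collect_eq)
  have "bounded (range (\<lambda>n. g (w (r1 n))))"
    using bd unfolding gw by (rule bounded_subset) auto
  then obtain b r2 where b: "b \<in> C" "strict_mono r2" "(\<lambda>n. w (r1 (r2 n))) \<longlonglongrightarrow> b"
    using convergent_subsequence[of "\<lambda>n. w (r1 n)"] C(2) by blast
  have va: "(\<lambda>n. v (r1 (r2 n))) \<longlonglongrightarrow> a" using LIMSEQ_subseq_LIMSEQ[OF a(3) b(2)] by (simp add: comp_def)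
  have "strict_mono (\<lambda>n. r1 (r2 n))" using a(2) b(2) by (simp add: strict_mono_def)
  then have z: "(\<lambda>n. \<phi> (v (r1 (r2 n)))) \<longlonglongrightarrow> \<zeta>"
    using LIMSEQ_subseq_LIMSEQ[OF assms(4)] by (simp add: comp_def)
  have "\<phi> a = \<zeta>" using phi_tendsto[OF a(1) C(1) va] z LIMSEQ_unique by blast
  moreover have "(\<lambda>n. \<phi> (w (r1 (r2 n)))) \<longlonglongrightarrow> \<zeta>" using z assms(3) by simp
  then have "\<phi> b = \<zeta>" using phi_tendsto[OF b(1) C(2) b(3)] LIMSEQ_unique by blast
  ultimately show ?thesis using that[of a b "\<lambda>n. r1 (r2 n)"] a(1) b(1,3) va by blast
qed

lemma right_boundary_value_unique:
  assumes "w \<in> C" "x (Suc m) < t" "\<phi> w = \<phi> (of_real t)"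
  shows "w = of_real t"
proof -
  have t0: "0 \<le> t" using assms(2) x_gt_0[of "Suc m"] by simp
  have Re: "Re (\<phi> w) = real (Suc m) * pi" using assms Re_phi_right[of t] by simp
  have Im: "0 < Im (\<phi> w)" using sin_zero_Im_pos(2)[of t] k_right[OF assms(2)] t0 assms(3) by simp
  have "Im w = 0"
  proof (rule ccontr)
    assume "Im w \<noteq> 0"
    then have "\<phi> w \<in> \<Omega>" using assms(1) by force
    then show False using Omega_boundary[of "of_real t"] assms(3) by simp
  qed
  then show ?thesis
  proof (cases rule: boundary_cases)
    case (minus r)
    have "pi < real (Suc m) * pi" using m_pos by simp
    then show ?thesis using phi_minus(4)[OF minus(1)] minus(2) Re by simp
  next
    case (left u)
    have "0 < real (Suc m) * pi" by simp
    then show ?thesis using Re_phi_left[of u] left Re by simp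
  next
    case (middle u)
    then show ?thesis using phi_middle(1)[of u] Im by simp
  next
    case (right u)
    then have "g (of_real u) = g (of_real t)" using cos_phi[of w] cos_phi[of "of_real t"] assms(3) by simp
    then have "k u = k t" using g_real[of u] g_real[of t] t0 right x_gt_0[of "Suc m"] by simp
    then show ?thesis using k_right_inj right assms(2) by (auto dest: inj_onD)
  qed
qed

text \<open>Let \<open>D\<close> be the set of values taken at least twice. It is open by the open mapping theorem. It is
  closed in \<open>\<Omega>\<close>: limits of pairs of distinct points with equal values stay in the upper half-plane by
  \<open>Omega_boundary\<close> and cannot coincide, as \<open>\<phi>' \<noteq> 0\<close>. As \<open>\<Omega>\<close> is connected, it remains to see that \<open>D \<noteq> \<Omega>\<close>.
  Close to the image of a point \<open>t > x (m + 1)\<close> of the right edge all preimages are close to \<open>t\<close>, because that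
  boundary value is taken only once, and near \<open>t\<close> even \<open>g = cos \<phi>\<close> is injective.\<close>

lemma inj_phi: "inj_on \<phi> H"
proof (rule inj_onI, rule ccontr)
  fix v0 w0 assume vw0: "v0 \<in> H" "w0 \<in> H" "\<phi> v0 = \<phi> w0" "v0 \<noteq> w0"
  define D where "D = {\<zeta>. \<exists>v\<in>H. \<exists>w\<in>H. v \<noteq> w \<and> \<phi> v = \<zeta> \<and> \<phi> w = \<zeta>}"
  have sub: "D \<subseteq> \<Omega>" by (auto simp: D_def)
  have "open D"
  proof (subst open_subopen, intro ballI)
    fix \<zeta> assume "\<zeta> \<in> D"
    then obtain v w where vw: "v \<in> H" "w \<in> H" "v \<noteq> w" "\<phi> v = \<zeta>" "\<phi> w = \<zeta>" by (auto simp: D_def)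
    obtain U W where UW: "open U" "open W" "v \<in> U" "w \<in> W" "U \<inter> W = {}"
      using hausdorff[OF vw(3)] by blast
    show "\<exists>T. open T \<and> \<zeta> \<in> T \<and> T \<subseteq> D"
    proof (intro exI conjI)
      show "open (\<phi> ` (U \<inter> H) \<inter> \<phi> ` (W \<inter> H))" using UW open_H by (intro open_Int open_image) auto
      have "\<phi> v \<in> \<phi> ` (U \<inter> H)" "\<phi> w \<in> \<phi> ` (W \<inter> H)"
        using vw(1,2) UW(3,4) by (intro imageI; simp)+
      then show "\<zeta> \<in> \<phi> ` (U \<inter> H) \<inter> \<phi> ` (W \<inter> H)" unfolding vw(4,5) by (rule IntI)
      show "\<phi> ` (U \<inter> H) \<inter> \<phi> ` (W \<inter> H) \<subseteq> D"
      proof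
        fix \<xi> assume "\<xi> \<in> \<phi> ` (U \<inter> H) \<inter> \<phi> ` (W \<inter> H)"
        then have xi: "\<xi> \<in> \<phi> ` (U \<inter> H)" "\<xi> \<in> \<phi> ` (W \<inter> H)" by (rule IntD1, rule IntD2)
        obtain a where a: "\<xi> = \<phi> a" "a \<in> U \<inter> H" using xi(1) by (rule imageE)
        obtain b where b: "\<xi> = \<phi> b" "b \<in> W \<inter> H" using xi(2) by (rule imageE)
        note ab = a b
        then have "a \<noteq> b" using UW(5) by blast
        then show "\<xi> \<in> D" using ab unfolding D_def by auto
      qed
    qed
  qed
  have seq: "\<exists>p :: nat \<Rightarrow> complex \<times> complex. \<forall>n. fst (p n) \<in> H \<and> snd (p n) \<in> H \<and> fst (p n) \<noteq> snd (p n)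
      \<and> \<phi> (fst (p n)) = z n \<and> \<phi> (snd (p n)) = z n" if zin: "\<And>n. z n \<in> D" for z
  proof (rule choice, rule allI)
    fix n
    obtain v w where "v \<in> H" "w \<in> H" "v \<noteq> w" "\<phi> v = z n" "\<phi> w = z n"
      using zin[of n] unfolding D_def by auto
    then show "\<exists>p. fst p \<in> H \<and> snd p \<in> H \<and> fst p \<noteq> snd p \<and> \<phi> (fst p) = z n \<and> \<phi> (snd p) = z n"
      by (intro exI[of _ "(v, w)"]) simp
  qed
  have "\<Omega> \<inter> closure D \<subseteq> D"
  proof
    fix \<zeta> assume z: "\<zeta> \<in> \<Omega> \<inter> closure D"
    then obtain z where zD: "\<And>n. z n \<in> D" "z \<longlonglongrightarrow> \<zeta>" by (auto simp: closure_sequential)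
    obtain p where p: "\<forall>n. fst (p n) \<in> H \<and> snd (p n) \<in> H \<and> fst (p n) \<noteq> snd (p n)
      \<and> \<phi> (fst (p n)) = z n \<and> \<phi> (snd (p n)) = z n" using seq[OF zD(1)] by (rule exE)
    define v where "v n = fst (p n)" for n
    define w where "w n = snd (p n)" for n
    have vw: "v n \<in> H" "w n \<in> H" "v n \<noteq> w n" "\<phi> (v n) = z n" "\<phi> (w n) = z n" for n
      using p by (simp_all add: v_def w_def)
    have pair: "\<phi> (v n) = \<phi> (w n)" for n using vw(4,5) by simp
    have lim: "(\<lambda>n. \<phi> (v n)) \<longlonglongrightarrow> \<zeta>" using vw(4) zD(2) by simp
    obtain a b r where ab: "a \<in> C" "b \<in> C" "(\<lambda>n. v (r n)) \<longlonglongrightarrow> a" "(\<lambda>n. w (r n)) \<longlonglongrightarrow> b"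
      "\<phi> a = \<zeta>" "\<phi> b = \<zeta>"
      by (rule paired_limits[OF vw(1,2) pair lim])
    have "\<phi> a \<in> \<Omega>" "\<phi> b \<in> \<Omega>" unfolding ab(5,6) using z by (rule IntD1)+
    then have "Im a \<noteq> 0" "Im b \<noteq> 0" using Omega_boundary[of a] Omega_boundary[of b] by argo+
    then have H: "a \<in> H" "b \<in> H" using ab(1,2) by auto
    show "\<zeta> \<in> D"
    proof (cases "a = b")
      case True
      obtain e where e: "0 < e" "inj_on \<phi> (ball a e)"
        using has_complex_derivative_locally_injective[OF hol H(1) open_H] deriv_phi[of a] H(1) by auto
      have "(\<lambda>n. w (r n)) \<longlonglongrightarrow> a" using ab(4) True by simp
      then have "\<exists>n. v (r n) = w (r n)"
        by (rule locally_injective_sequences[OF e(2,1) ab(3)]) (rule pair)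
      then show ?thesis using vw(3) by auto
    next
      case False
      then show ?thesis using ab H by (auto simp: D_def)
    qed
  qed
  moreover have "D \<subseteq> \<Omega> \<inter> closure D" using sub closure_subset by (rule Int_greatest)
  ultimately have eq: "D = \<Omega> \<inter> closure D" by (intro equalityI)
  have "openin (top_of_set \<Omega>) D" using sub open_Omega \<open>open D\<close> by (simp add: openin_open_eq)
  moreover have "closedin (top_of_set \<Omega>) (\<Omega> \<inter> closure D)" by (rule closedin_closed_Int[OF closed_closure])
  then have "closedin (top_of_set \<Omega>) D" unfolding eq[symmetric] .
  moreover have "connected \<Omega>"
    using holomorphic_on_imp_continuous_on[OF hol] connected_H by (rule connected_continuous_image)
  moreover have "D \<noteq> {}" using vw0 by (auto simp: D_def)
  ultimately have D: "D = \<Omega>" unfolding connected_clopen by blast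
  \<comment> \<open>Any point beyond \<open>x (Suc m)\<close> would do; its image lies on the right edge, above the corner.\<close>
  define t where "t = x (Suc m) + 1"
  have t: "x (Suc m) < t" "0 < t" using x_gt_0[of "Suc m"] by (auto simp: t_def)
  define z where "z n = \<phi> (of_real t + \<i> * of_real (inverse (Suc n)))" for n :: nat
  have "(\<lambda>n. of_real t + \<i> * of_real (inverse (Suc n))) \<longlonglongrightarrow> of_real t + \<i> * of_real 0"
    by (intro tendsto_intros LIMSEQ_inverse_real_of_nat)
  then have z: "z \<longlonglongrightarrow> \<phi> (of_real t)"
    unfolding z_def by (intro phi_tendsto) auto
  have zD: "z n \<in> D" for n unfolding D z_def by (intro imageI) auto
  obtain p where p: "\<forall>n. fst (p n) \<in> H \<and> snd (p n) \<in> H \<and> fst (p n) \<noteq> snd (p n)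
      \<and> \<phi> (fst (p n)) = z n \<and> \<phi> (snd (p n)) = z n" using seq[OF zD] by (rule exE)
  define v where "v n = fst (p n)" for n
  define w where "w n = snd (p n)" for n
  have vw: "v n \<in> H" "w n \<in> H" "v n \<noteq> w n" "\<phi> (v n) = z n" "\<phi> (w n) = z n" for n
    using p by (simp_all add: v_def w_def)
  have pair: "\<phi> (v n) = \<phi> (w n)" for n using vw(4,5) by simp
  have lim: "(\<lambda>n. \<phi> (v n)) \<longlonglongrightarrow> \<phi> (of_real t)" using vw(4) z by simp
  obtain a b r where ab: "a \<in> C" "b \<in> C" "(\<lambda>n. v (r n)) \<longlonglongrightarrow> a" "(\<lambda>n. w (r n)) \<longlonglongrightarrow> b"
    "\<phi> a = \<phi> (of_real t)" "\<phi> b = \<phi> (of_real t)"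
    by (rule paired_limits[OF vw(1,2) pair lim])
  have lims: "(\<lambda>n. v (r n)) \<longlonglongrightarrow> of_real t" "(\<lambda>n. w (r n)) \<longlonglongrightarrow> of_real t"
    using right_boundary_value_unique[OF _ t(1)] ab by auto
  have "deriv g (of_real t) \<noteq> 0" using deriv_real[OF t(2)] k_right[OF t(1)] by simp
  then obtain e where e: "0 < e" "inj_on g (ball (of_real t) e)"
    using has_complex_derivative_locally_injective[OF hol_g, of "of_real t"] t(2)
    by (auto simp: closed_nonpos_Reals_complex open_Compl)
  have gvw: "g (v n) = g (w n)" for n
    using cos_phi[of "v n"] cos_phi[of "w n"] vw(1,2,4,5)[of n] by (simp add: less_imp_le)
  have "\<exists>n. v (r n) = w (r n)"
    by (rule locally_injective_sequences[OF e(2,1) lims]) (rule gvw)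
  then show False using vw(3) by auto
qed

lemma gamma_strip: "\<gamma> \<subseteq> strip"
proof
  fix \<zeta> assume "\<zeta> \<in> \<gamma>"
  then obtain r where r: "0 < r" "\<zeta> = \<phi> (- of_real r)" by auto
  have "1 * pi \<le> real (m + 1) * pi" by (intro mult_right_mono) auto
  then have "Re \<zeta> < real (m + 1) * pi" using phi_minus(4)[OF r(1)] unfolding r(2) by linarith
  then show "\<zeta> \<in> strip" using phi_minus(2,3)[OF r(1)] r(2) by simp
qed

lemma frontier_Omega_strip: "frontier \<Omega> \<inter> strip = \<gamma>"
proof (intro equalityI subsetI)
  fix \<zeta> assume z: "\<zeta> \<in> frontier \<Omega> \<inter> strip"
  then obtain w where w: "Im w = 0" "\<zeta> = \<phi> w" using frontier_Omega by auto
  from w(1) show "\<zeta> \<in> \<gamma>"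
  proof (cases rule: boundary_cases)
    case (minus r)
    then show ?thesis using w(2) by auto
  next
    case (left t)
    then show ?thesis using Re_phi_left[of t] z w(2) by simp
  next
    case (middle t)
    then show ?thesis using phi_middle(1)[of t] z w(2) by simp
  next
    case (right t)
    then show ?thesis using Re_phi_right[of t] z w(2) by simp
  qed
next
  fix \<zeta> assume "\<zeta> \<in> \<gamma>"
  then show "\<zeta> \<in> frontier \<Omega> \<inter> strip" using gamma_strip frontier_Omega by auto
qed

text \<open>A connected subset of the half-strip without \<open>\<gamma>\<close> that is larger than \<open>\<Omega>\<close> would have to meet the frontier of
  \<open>\<Omega>\<close>, which inside the half-strip is only \<open>\<gamma>\<close>.\<close>

lemma Omega_component: "\<Omega> \<in> components (strip - \<gamma>)"
  unfolding in_components_maximal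
proof (intro conjI allI impI)
  have "\<phi> \<i> \<in> \<Omega>" by (intro imageI) simp
  then show ne: "\<Omega> \<noteq> {}" by blast
  show "\<Omega> \<subseteq> strip - \<gamma>"
  proof
    fix \<zeta> assume z: "\<zeta> \<in> \<Omega>"
    have "\<phi> (- of_real r) \<notin> \<Omega>" for r by (rule Omega_boundary) simp
    then have "\<zeta> \<notin> \<gamma>" using z by blast
    then show "\<zeta> \<in> strip - \<gamma>" using z Omega_strip by blast
  qed
  show "connected \<Omega>"
    using holomorphic_on_imp_continuous_on[OF hol] connected_H by (rule connected_continuous_image)
  fix T assume T: "T \<noteq> {} \<and> \<Omega> \<subseteq> T \<and> T \<subseteq> strip - \<gamma> \<and> connected T"
  show "T = \<Omega>"
  proof (rule ccontr)
    assume "T \<noteq> \<Omega>"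
    then have "T \<inter> \<Omega> \<noteq> {}" "T - \<Omega> \<noteq> {}" using T ne by blast+
    moreover have "connected T" using T by simp
    ultimately have "T \<inter> frontier \<Omega> \<noteq> {}" by (intro connected_Int_frontier)
    moreover have disjoint: "T \<inter> F = {}" if "T \<subseteq> A - B" "F \<inter> A = B" for A B F :: "complex set"
      using that by blast
    have "T \<inter> frontier \<Omega> = {}" by (rule disjoint[OF _ frontier_Omega_strip]) (use T in simp)
    ultimately show False by simp
  qed
qed

lemma right_edge: "{w. Re w = real (m + 1) * pi \<and> 0 < Im w} \<subseteq> frontier \<Omega>"
proof
  fix \<zeta> assume z: "\<zeta> \<in> {w. Re w = real (m + 1) * pi \<and> 0 < Im w}"
  let ?a = "x (Suc m)"
  obtain R where R: "0 < R" "\<And>w. R \<le> cmod w \<Longrightarrow> cosh (Im \<zeta>) < cmod (g w)"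
    using g_infinity_bound by blast
  define T where "T = max R (?a + 1)"
  have a0: "0 < ?a" using x_gt_0 by simp
  have T: "?a < T" "0 \<le> T" "R \<le> T" using a0 by (auto simp: T_def)
  have "cosh (Im \<zeta>) < \<bar>k T\<bar>" using R(2)[of "of_real T"] g_real[OF T(2)] T by simp
  moreover have "\<bar>k T\<bar> = cosh (Im (\<phi> (of_real T)))"
  proof -
    have "k T = cos (real (Suc m) * pi) * cosh (Im (\<phi> (of_real T)))"
      using Re_cos_cosh[of "\<phi> (of_real T)"] cos_phi[of "of_real T"] g_real[OF T(2)] Re_phi_right[of T] T(1)
      by simp
    then show ?thesis unfolding cos_npi by (simp add: abs_mult)
  qed
  ultimately have "Im \<zeta> < Im (\<phi> (of_real T))"
    using z Im_nonneg[of "of_real T"] by (simp add: cosh_real_nonneg_less_iff)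
  moreover have "continuous_on {?a..T} (\<lambda>t. Im (\<phi> (of_real t)))"
    by (intro continuous_intros continuous_on_compose2[OF cont]) auto
  moreover have "Im (\<phi> (of_real ?a)) = 0" using phi_x[of "Suc m"] by simp
  ultimately obtain t where t: "?a \<le> t" "t \<le> T" "Im (\<phi> (of_real t)) = Im \<zeta>"
    using IVT'[of "\<lambda>t. Im (\<phi> (of_real t))" ?a "Im \<zeta>" T] z T(1) by auto
  then have "\<phi> (of_real t) = \<zeta>" using Re_phi_right[of t] z by (simp add: complex_eq_iff)
  then show "\<zeta> \<in> frontier \<Omega>" unfolding frontier_Omega by force
qed

lemma left_edge: "bounded ({w. Re w = 0 \<and> 0 < Im w} \<inter> frontier \<Omega>)"
proof (rule bounded_subset)
  have "continuous_on {0..x 0} (\<lambda>t. \<phi> (of_real t))"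
    by (intro continuous_intros continuous_on_compose2[OF cont]) auto
  then show "bounded ((\<lambda>t. \<phi> (of_real t)) ` {0..x 0})"
    by (intro compact_imp_bounded compact_continuous_image) auto
  show "{w. Re w = 0 \<and> 0 < Im w} \<inter> frontier \<Omega> \<subseteq> (\<lambda>t. \<phi> (of_real t)) ` {0..x 0}"
  proof
    fix \<zeta> assume z: "\<zeta> \<in> {w. Re w = 0 \<and> 0 < Im w} \<inter> frontier \<Omega>"
    then obtain w where w: "Im w = 0" "\<zeta> = \<phi> w" using frontier_Omega by auto
    from w(1) show "\<zeta> \<in> (\<lambda>t. \<phi> (of_real t)) ` {0..x 0}"
    proof (cases rule: boundary_cases)
      case (minus r)
      then show ?thesis using phi_minus(3)[of r] z w(2) by simp
    next
      case (left t)
      then show ?thesis using w(2) by auto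
    next
      case (middle t)
      then show ?thesis using phi_middle(1)[of t] z w(2) by simp
    next
      case (right t)
      have "0 < real (Suc m) * pi" by simp
      then show ?thesis using Re_phi_right[of t] right z w(2) by simp
    qed
  qed
qed

text \<open>The parameter \<open>r\<close> can be recovered continuously from a point of \<open>\<gamma>\<close>, as \<open>- Im (cos \<zeta>) = \<kappa> r\<^sup>s\<close>.\<close>

lemma gamma_homeomorphic: "\<gamma> homeomorphic (UNIV :: real set)"
proof (subst homeomorphic_sym, rule homeomorphicI)
  let ?f = "\<lambda>t. \<phi> (- of_real (exp t))" and ?h = "\<lambda>\<zeta>. ln (- Im (cos \<zeta>) / \<kappa>) / s"
  have Imc: "- Im (cos (\<phi> (- of_real r))) / \<kappa> = r powr s" if "0 < r" for r
    using cos_phi[of "- of_real r"] Im_g_minus[OF that] \<kappa>_pos by simp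
  have inv: "?h (?f t) = t" for t using Imc[of "exp t"] s_pos by (simp add: ln_powr)
  have range: "range ?f = \<gamma>"
  proof (intro equalityI subsetI)
    fix \<zeta> assume "\<zeta> \<in> \<gamma>"
    then obtain r where "0 < r" "\<zeta> = \<phi> (- of_real r)" by auto
    then have "\<zeta> = ?f (ln r)" by simp
    then show "\<zeta> \<in> range ?f" by blast
  qed auto
  show "?f ` UNIV = \<gamma>" by (rule range)
  have "?h (?f t) \<in> ?h ` \<gamma>" for t unfolding range[symmetric] by (intro imageI rangeI)
  then show "?h ` \<gamma> = UNIV" unfolding inv by blast
  show "continuous_on UNIV ?f" by (intro continuous_intros continuous_on_compose2[OF cont]) auto
  have nz: "- Im (cos \<zeta>) / \<kappa> \<noteq> 0" if z: "\<zeta> \<in> \<gamma>" for \<zeta>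
  proof -
    obtain r where r: "0 < r" "\<zeta> = \<phi> (- of_real r)" using z by auto
    show ?thesis using Imc[OF r(1)] r by simp
  qed
  have "continuous_on \<gamma> (\<lambda>\<zeta>. - Im (cos \<zeta>) / \<kappa>)" using \<kappa>_pos by (intro continuous_intros) auto
  then have "continuous_on \<gamma> (\<lambda>\<zeta>. ln (- Im (cos \<zeta>) / \<kappa>))" by (rule continuous_on_ln) (use nz in blast)
  then show "continuous_on \<gamma> ?h" by (rule continuous_on_divide[OF _ continuous_on_const]) (use s_pos in simp)
  show "?h (?f t) = t" for t by (rule inv)
  show "?f (?h \<zeta>) = \<zeta>" if z: "\<zeta> \<in> \<gamma>" for \<zeta>
  proof -
    obtain t where t: "\<zeta> = ?f t" using z unfolding range[symmetric] by (rule imageE)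
    show ?thesis unfolding t inv ..
  qed
qed

lemma phi_infinity: "filterlim \<phi> at_infinity (inf at_infinity (principal C))"
  unfolding filterlim_at_infinity[OF order_refl]
proof (intro allI impI)
  fix B :: real assume "0 < B"
  have "bounded (cos ` cball (0::complex) B)"
    by (intro compact_imp_bounded compact_continuous_image continuous_intros compact_cball)
  then obtain M where "\<forall>z\<in>cos ` cball 0 B. cmod z \<le> M" unfolding bounded_iff by blast
  then have M: "cmod (cos \<zeta>) \<le> M" if "cmod \<zeta> \<le> B" for \<zeta> using that by simp
  obtain R where R: "\<And>w. R \<le> cmod w \<Longrightarrow> M < cmod (g w)" using g_infinity_bound by blast
  have "B \<le> cmod (\<phi> w)" if "R \<le> cmod w" "w \<in> C" for w
    using M[of "\<phi> w"] R[OF that(1)] cos_phi[of w] that(2) by force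
  then show "eventually (\<lambda>w. B \<le> cmod (\<phi> w)) (inf at_infinity (principal C))"
    unfolding eventually_inf_principal eventually_at_infinity by blast
qed

end

section \<open>The best approximation of a power\<close>

text \<open>The degree bounds are those that make \<open>Q\<close> an admissible approximation of degree \<open>m\<close> and give the odd
  part fewer zeros than there are extremal points.\<close>

lemma even_odd_parts:
  fixes P :: "real poly"
  shows "\<exists>Q R. P = pcompose Q [:0, 0, 1:] + pCons 0 (pcompose R [:0, 0, 1:]) \<and>
    2 * degree Q \<le> degree P \<and> (R \<noteq> 0 \<longrightarrow> 2 * degree R + 1 \<le> degree P) \<and> (P = 0 \<longrightarrow> Q = 0)"
proof (induction P)
  case 0
  show ?case by (intro exI[of _ 0]) simp
next
  case (pCons c P)
  then obtain Q R where QR: "P = pcompose Q [:0, 0, 1:] + pCons 0 (pcompose R [:0, 0, 1:])"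
    "2 * degree Q \<le> degree P" "R \<noteq> 0 \<longrightarrow> 2 * degree R + 1 \<le> degree P" "P = 0 \<longrightarrow> Q = 0" by blast
  show ?case
  proof (intro exI conjI)
    have sq: "[:0, 0, 1:] * T = pCons 0 (pCons 0 T)" for T :: "real poly" by simp
    show "pCons c P = pcompose (pCons c R) [:0, 0, 1:] + pCons 0 (pcompose Q [:0, 0, 1:])"
      using QR(1) unfolding pcompose_pCons sq by simp
    show "2 * degree (pCons c R) \<le> degree (pCons c P)" using QR(3) by (cases "R = 0") (auto simp: degree_pCons_eq_if)
    show "Q \<noteq> 0 \<longrightarrow> 2 * degree Q + 1 \<le> degree (pCons c P)" using QR(2,4) by (auto simp: degree_pCons_eq_if)
    show "pCons c P = 0 \<longrightarrow> pCons c R = 0" using pCons.hyps by auto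
  qed
qed

lemma poly_map_poly_square:
  "poly (map_poly complex_of_real (pcompose Q [:0, 0, 1:])) z = poly (map_poly complex_of_real Q) (z\<^sup>2)"
proof (induction Q)
  case (pCons c Q)
  have sq: "[:0, 0, 1:] * T = pCons 0 (pCons 0 T)" for T :: "real poly" by simp
  have "pcompose (pCons c Q) [:0, 0, 1:] = pCons c (pCons 0 (pcompose Q [:0, 0, 1:]))"
    unfolding pcompose_pCons sq by simp
  then show ?case using pCons by (simp add: map_poly_pCons power2_eq_square algebra_simps)
qed simp

lemma sgn_floor_sin: "(- 1) ^ nat \<lfloor>s\<rfloor> * sin (pi * s) = \<bar>sin (pi * s)\<bar>" if "0 \<le> s" for s :: real
proof -
  define n where "n = nat \<lfloor>s\<rfloor>"
  define f where "f = s - real n"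
  have "real n = of_int \<lfloor>s\<rfloor>" using that by (simp add: n_def)
  then have f: "0 \<le> f" "f < 1" unfolding f_def by linarith+
  have "sin (pi * s) = sin (pi * f + real n * pi)" by (simp add: f_def algebra_simps)
  also have "\<dots> = (- 1) ^ n * sin (pi * f)" by (simp add: sin_add cos_npi sin_npi)
  finally have eq: "sin (pi * s) = (- 1) ^ n * sin (pi * f)" .
  have "pi * f \<le> pi * 1" using f by (intro mult_left_mono) auto
  then have "0 \<le> sin (pi * f)" using f by (intro sin_ge_zero) auto
  then show ?thesis unfolding n_def[symmetric] eq by (cases "even n") auto
qed

lemma approx_set_compact: "compact (approx_set a)"
proof -
  have "approx_set a = {x. a \<le> \<bar>x\<bar>} \<inter> {-1..1}" by (auto simp: approx_set_def)
  moreover have "closed {x. a \<le> \<bar>x::real\<bar>}" by (intro closed_Collect_le continuous_intros)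
  ultimately show ?thesis by (simp add: closed_Int_compact)
qed

context
  fixes a p :: real and n :: nat
  assumes a: "0 < a" "a < 1"
begin

lemma approx_set_nonempty: "approx_set a \<noteq> {}" 
  using a by (auto simp: approx_set_def intro: exI[of _ 1])

lemma continuous_on_error: "continuous_on (approx_set a) (\<lambda>x. \<bar>\<bar>x\<bar> powr p - poly P x\<bar>)"
  using a by (intro continuous_intros) (auto simp: approx_set_def)

lemma bdd_above_error: "bdd_above ((\<lambda>x. \<bar>\<bar>x\<bar> powr p - poly P x\<bar>) ` approx_set a)"
  by (intro compact_imp_bounded[THEN bounded_imp_bdd_above] compact_continuous_image
      continuous_on_error approx_set_compact)

lemma error_le_max_error: "x \<in> approx_set a \<Longrightarrow> \<bar>\<bar>x\<bar> powr p - poly P x\<bar> \<le> max_error p a P"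
  unfolding max_error_def by (rule cSUP_upper[OF _ bdd_above_error])

lemma max_error_attained: "\<exists>x\<in>approx_set a. \<bar>\<bar>x\<bar> powr p - poly P x\<bar> = max_error p a P"
proof -
  obtain x where x: "x \<in> approx_set a"
    "\<And>y. y \<in> approx_set a \<Longrightarrow> \<bar>\<bar>y\<bar> powr p - poly P y\<bar> \<le> \<bar>\<bar>x\<bar> powr p - poly P x\<bar>"
    using continuous_attains_sup[OF approx_set_compact approx_set_nonempty continuous_on_error[of P]] by blast
  have "max_error p a P \<le> \<bar>\<bar>x\<bar> powr p - poly P x\<bar>"
    unfolding max_error_def by (rule cSUP_least[OF approx_set_nonempty x(2)])
  then show ?thesis using error_le_max_error[OF x(1), of P] x(1) by (intro bexI[of _ x]) auto
qed

lemma approx_error_le: "degree P \<le> n \<Longrightarrow> approx_error n p a \<le> max_error p a P"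
proof -
  have "bdd_below (max_error p a ` {P. degree P \<le> n})"
  proof (rule bdd_belowI2)
    show "0 \<le> max_error p a P" for P
      using max_error_attained[of P] by (metis abs_ge_zero)
  qed
  then show "degree P \<le> n \<Longrightarrow> approx_error n p a \<le> max_error p a P"
    unfolding approx_error_def by (intro cINF_lower) auto
qed

end

text \<open>Replacing \<open>P\<close> by its even part does not increase the error, so the even part \<open>Q(x\<^sup>2)\<close> is a best approximation
  too. At an extremal point of its error, where \<open>P(\<plusminus>x)\<close> equals \<open>Q(x\<^sup>2) \<plusminus> x R(x\<^sup>2)\<close>, the odd part must vanish, for
  otherwise the error of \<open>P\<close> at \<open>x\<close> or \<open>-x\<close> would exceed \<open>E\<close>. So \<open>R\<close> has \<open>m + 2\<close> zeros and degree less than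
  \<open>m\<close>, and \<open>P\<close> is even.\<close>

lemma best_approx_even:
  fixes a p :: real and m :: nat and P :: "real poly"
  assumes a: "0 < a" "a < 1" and noneven: "\<And>i::nat. p / 2 \<noteq> real i"
    and best: "best_approx (2 * m) p a P"
  obtains Q :: "real poly" and x :: "nat \<Rightarrow> real" where "P = pcompose Q [:0, 0, 1:]" "degree Q \<le> m"
    "0 < approx_error (2 * m) p a" "x 0 = a\<^sup>2" "x (Suc m) = 1" "\<And>j. j \<le> m \<Longrightarrow> x j < x (Suc j)"
    "{t. 0 < t \<and> quasi_poly Q (p / 2) 1 t = 0} = x ` {1..m}"
    "{t. a\<^sup>2 \<le> t \<and> t \<le> 1 \<and> \<bar>quasi_poly Q (p / 2) 0 t\<bar> = approx_error (2 * m) p a} = x ` {..Suc m}"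
    "\<And>t. a\<^sup>2 \<le> t \<Longrightarrow> t \<le> 1 \<Longrightarrow> \<bar>quasi_poly Q (p / 2) 0 t\<bar> \<le> approx_error (2 * m) p a"
proof -
  define E where "E = approx_error (2 * m) p a"
  have P: "degree P \<le> 2 * m" "max_error p a P = E" using best by (auto simp: best_approx_def E_def)
  obtain Q R where QR: "P = pcompose Q [:0, 0, 1:] + pCons 0 (pcompose R [:0, 0, 1:])"
    "2 * degree Q \<le> degree P" "R \<noteq> 0 \<longrightarrow> 2 * degree R + 1 \<le> degree P"
    using even_odd_parts[of P] by blast
  have Px: "poly P y = poly Q (y\<^sup>2) + y * poly R (y\<^sup>2)" for y
    by (simp add: QR(1) poly_pcompose power2_eq_square)
  have degQ: "degree Q \<le> m" using QR(2) P(1) by simp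
  have sqrt_powr: "sqrt t powr p = t powr (p / 2)" if "0 < t" for t
    using that by (simp add: powr_half_sqrt[symmetric] powr_powr)
  have both: "\<bar>quasi_poly Q (p / 2) 0 t + sqrt t * poly R t\<bar> \<le> E"
    "\<bar>quasi_poly Q (p / 2) 0 t - sqrt t * poly R t\<bar> \<le> E" if t: "a\<^sup>2 \<le> t" "t \<le> 1" for t
  proof -
    have t0: "0 < t" using t(1) a by (meson less_le_trans zero_less_power)
    have "a \<le> sqrt t" "sqrt t \<le> 1" using t a by (auto intro: real_le_rsqrt)
    then have "sqrt t \<in> approx_set a" "- sqrt t \<in> approx_set a" using t0 by (auto simp: approx_set_def)
    from this[THEN error_le_max_error[OF a, where p = p and P = P]]
    show "\<bar>quasi_poly Q (p / 2) 0 t + sqrt t * poly R t\<bar> \<le> E"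
      "\<bar>quasi_poly Q (p / 2) 0 t - sqrt t * poly R t\<bar> \<le> E"
      unfolding P(2) Px quasi_poly_0 using t0 by (auto simp: sqrt_powr)
  qed
  obtain x where x: "0 < E" "x 0 = a\<^sup>2" "x (Suc m) = 1" "\<And>j. j \<le> m \<Longrightarrow> x j < x (Suc j)"
    "{t. 0 < t \<and> quasi_poly Q (p / 2) 1 t = 0} = x ` {1..m}"
    "{t. a\<^sup>2 \<le> t \<and> t \<le> 1 \<and> \<bar>quasi_poly Q (p / 2) 0 t\<bar> = E} = x ` {..Suc m}"
  proof (rule extremal_points_exist[of "a\<^sup>2" Q m "p / 2" E])
    show "0 < a\<^sup>2" using a by simp
    show "a\<^sup>2 < 1" using a by (simp add: power_less_one_iff)
    show "degree Q \<le> m" by (rule degQ)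
    show "p / 2 \<noteq> real i" for i by (rule noneven)
    show "\<bar>quasi_poly Q (p / 2) 0 t\<bar> \<le> E" if "a\<^sup>2 \<le> t" "t \<le> 1" for t
      using both[OF that] by linarith
    show "\<exists>t\<in>{a\<^sup>2..1}. E \<le> \<bar>poly S t - t powr (p / 2)\<bar>" if S: "degree S \<le> m" for S
    proof -
      let ?S = "pcompose S [:0, 0, 1:]"
      have "degree ?S \<le> 2 * m" using S by (simp add: degree_pcompose)
      then have "E \<le> max_error p a ?S" unfolding E_def by (rule approx_error_le[OF a])
      then obtain y where y: "y \<in> approx_set a" "E \<le> \<bar>\<bar>y\<bar> powr p - poly ?S y\<bar>"
        using max_error_attained[OF a, where p = p and P = ?S] by metis
      have y0: "0 < \<bar>y\<bar>" "a \<le> \<bar>y\<bar>" "\<bar>y\<bar> \<le> 1" using y(1) a by (auto simp: approx_set_def)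
      have "poly ?S y = poly S (\<bar>y\<bar>\<^sup>2)" by (simp add: poly_pcompose power2_eq_square)
      moreover have "\<bar>y\<bar> powr p = \<bar>y\<bar>\<^sup>2 powr (p / 2)"
        using sqrt_powr[of "\<bar>y\<bar>\<^sup>2"] y0(1) by simp
      moreover have "a\<^sup>2 \<le> \<bar>y\<bar>\<^sup>2" using y0(2) a by (intro power_mono) auto
      moreover have "\<bar>y\<bar>\<^sup>2 \<le> 1" using y0(3) by (intro power_le_one) auto
      ultimately show ?thesis using y(2) by (intro bexI[of _ "\<bar>y\<bar>\<^sup>2"]) (auto simp: abs_minus_commute)
    qed
  qed blast
  have "R = 0"
  proof (rule ccontr)
    assume R: "R \<noteq> 0"
    have inj: "inj_on x {..Suc m}" by (rule inj_on_of_steps) (rule x(4))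
    have "poly R t = 0" if t: "t \<in> x ` {..Suc m}" for t
    proof -
      have t': "a\<^sup>2 \<le> t" "t \<le> 1" "\<bar>quasi_poly Q (p / 2) 0 t\<bar> = E" using t unfolding x(6)[symmetric] by auto
      have "0 < t" using t'(1) a by (meson less_le_trans zero_less_power)
      moreover have "sqrt t * poly R t = 0" using both[OF t'(1,2)] t'(3) by linarith
      ultimately show ?thesis by simp
    qed
    then have "card (x ` {..Suc m}) \<le> card {t. poly R t = 0}"
      using poly_roots_finite[OF R] by (intro card_mono) auto
    also have "\<dots> \<le> degree R" by (rule card_poly_roots_bound[OF R])
    finally have "Suc (Suc m) \<le> degree R" using card_image[OF inj] by simp
    then show False using QR(3) R P(1) by simp
  qed
  then have "P = pcompose Q [:0, 0, 1:]" using QR(1) by simp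
  moreover have "\<bar>quasi_poly Q (p / 2) 0 t\<bar> \<le> E" if "a\<^sup>2 \<le> t" "t \<le> 1" for t
    using both[OF that] by linarith
  ultimately show ?thesis using that[of Q x] degQ x unfolding E_def by blast
qed

lemma map_poly_of_real_pderiv:
  "pderiv (map_poly complex_of_real Q) = map_poly complex_of_real (pderiv Q)"
  by (intro poly_eqI) (simp add: coeff_pderiv coeff_map_poly)

lemma quasi_poly_complex_has_derivative:
  assumes "w \<notin> \<real>\<^sub>\<le>\<^sub>0"
  shows "(quasi_poly_complex Q k s has_field_derivative
    (poly (map_poly of_real (pderiv Q)) w + of_real k * (of_real s * w powr (of_real s - 1)))) (at w)"
  unfolding quasi_poly_complex_def map_poly_of_real_pderiv[symmetric]
  by (intro DERIV_add poly_DERIV DERIV_cmult has_field_derivative_powr assms)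

lemma real_zero_crossing:
  fixes f :: "real \<Rightarrow> real"
  assumes "continuous_on {a..b} f" "a < b" "f a * f b < 0"
  shows "\<exists>t. a < t \<and> t < b \<and> f t = 0"
proof -
  consider "f a < 0" "0 < f b" | "0 < f a" "f b < 0" using assms(3) by (auto simp: mult_less_0_iff)
  then show ?thesis
  proof cases
    case 1
    then obtain t where "a \<le> t" "t \<le> b" "f t = 0" using IVT'[of f a 0 b] assms by auto
    then show ?thesis using 1 by (intro exI[of _ t]) (auto simp: order_le_less)
  next
    case 2
    then obtain t where "a \<le> t" "t \<le> b" "f t = 0" using IVT2'[of f b 0 a] assms by auto
    then show ?thesis using 2 by (intro exI[of _ t]) (auto simp: order_le_less)
  qed
qed

text \<open>The facts about the upper half-plane come from \<open>quasi_poly_complex_nonzero\<close>. It applies to \<open>w g'(w)\<close>, which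
  vanishes at the \<open>m\<close> critical points, and to \<open>g - y\<close> with \<open>\<bar>y\<bar> < 1\<close>, which vanishes once in each of the
  intervals between consecutive extremal points. The values \<open>\<plusminus>1\<close> are omitted as well because the image of
  the upper half-plane is open.\<close>

lemma alternating_error_map:
  fixes Q :: "real poly" and s E :: real and x :: "nat \<Rightarrow> real"
  assumes m: "0 < m" and s: "0 < s" "s < real m" "\<And>i::nat. s \<noteq> real i" 
    and deg: "degree Q \<le> m" and E: "0 < E"
    and x0: "0 < x 0" and inc: "\<And>j. j \<le> m \<Longrightarrow> x j < x (Suc j)"
    and crit: "{t. 0 < t \<and> quasi_poly Q s 1 t = 0} = x ` {1..m}"
    and le: "\<And>t. x 0 \<le> t \<Longrightarrow> t \<le> x (Suc m) \<Longrightarrow> \<bar>quasi_poly Q s 0 t\<bar> \<le> E"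
    and ext: "{t. x 0 \<le> t \<and> t \<le> x (Suc m) \<and> \<bar>quasi_poly Q s 0 t\<bar> = E} = x ` {..Suc m}"
  defines "c \<equiv> (- 1) ^ nat \<lfloor>s\<rfloor> / E"
  shows "alternating_map (\<lambda>w. of_real c * quasi_poly_complex Q (- 1) s w)
    (\<lambda>t. c * quasi_poly Q s 0 t) (\<lambda>t. c * quasi_poly Q s 1 t) x m (\<bar>sin (pi * s)\<bar> / E) s"
proof -
  define \<sigma> where "\<sigma> = ((- 1) ^ nat \<lfloor>s\<rfloor> :: real)"
  define q where "q = quasi_poly_complex Q (- 1) s"
  define g where "g w = of_real c * q w" for w
  define k where "k t = c * quasi_poly Q s 0 t" for t
  define k' where "k' t = c * quasi_poly Q s 1 t" for t
  have sg: "\<sigma> = 1 \<or> \<sigma> = - 1" unfolding \<sigma>_def by (cases "even (nat \<lfloor>s\<rfloor>)") auto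
  have c: "c = \<sigma> / E" "c \<noteq> 0" using E by (auto simp: c_def \<sigma>_def)
  have mono: "x i < x j" if "i < j" "j \<le> Suc m" for i j
    by (rule less_of_steps[where m = m]) (use inc that in auto)
  have xpos: "0 < x j" if "j \<le> Suc m" for j
    using that mono[of 0 j] x0 by (cases j) auto
  have ext': "\<bar>quasi_poly Q s 0 (x j)\<bar> = E" if "j \<le> Suc m" for j
  proof -
    have "x j \<in> x ` {..Suc m}" using that by (intro imageI) simp
    then show ?thesis unfolding ext[symmetric] by simp
  qed
  note signs_raw = extremal_error_signs[OF m s deg E x0 inc crit ext', folded \<sigma>_def]
  have signs: "degree Q = m"
    "\<And>j. j \<le> Suc m \<Longrightarrow> \<sigma> * quasi_poly Q s 0 (x j) = (- 1) ^ j * E"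
    "\<And>t. 0 < t \<Longrightarrow> t < x 1 \<Longrightarrow> \<sigma> * quasi_poly Q s 1 t < 0"
    "\<And>j t. j \<le> m \<Longrightarrow> x j < t \<Longrightarrow> t < x (Suc j) \<Longrightarrow> (- 1) ^ j * \<sigma> * quasi_poly Q s 1 t < 0"
    "\<And>t. x m < t \<Longrightarrow> (- 1) ^ m * \<sigma> * quasi_poly Q s 1 t < 0"
    by (rule signs_raw(1), assumption+) (rule signs_raw(2), assumption+, rule signs_raw(3), assumption+,
        rule signs_raw(4), assumption+, rule signs_raw(5), assumption+)
  have derk: "(k has_real_derivative k' t) (at t)" if "0 < t" for t
    unfolding k_def k'_def using quasi_poly_has_derivative[OF that, of Q s 0] by (intro DERIV_cmult) simp
  have contk: "continuous_on {0..} k"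
  proof -
    have "continuous_on {0..} (\<lambda>t. t powr s)"
      using s(1) by (intro continuous_on_powr' continuous_intros) auto
    then have "continuous_on {0..} (\<lambda>t. poly Q t - t powr s)"
      by (rule continuous_on_diff[rotated]) (intro continuous_intros)
    then show ?thesis unfolding k_def quasi_poly_0 by (rule continuous_on_mult_left)
  qed
  have scale': "(- 1) ^ j * k' t < 0 \<longleftrightarrow> (- 1) ^ j * \<sigma> * quasi_poly Q s 1 t < 0" for j t
    unfolding k'_def c(1) using E by (simp add: divide_less_0_iff mult.assoc)
  have kx: "k (x j) = (- 1) ^ j" if "j \<le> Suc m" for j
    using signs(2)[OF that] E unfolding k_def c(1) by simp
  have kleft: "k' t < 0" if "0 < t" "t < x 1" for t
    using signs(3)[OF that] scale'[of 0 t] by simp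
  have kmid: "(- 1) ^ j * k' t < 0" if "j \<le> m" "x j < t" "t < x (Suc j)" for j t
    using signs(4)[OF that] scale' by simp
  have kright: "(- 1) ^ m * k' t < 0" if "x m < t" for t
    using signs(5)[OF that] scale' by simp
  have decr: "k v < k u" if "0 \<le> u" "u < v" "v \<le> x 1" for u v
  proof (rule DERIV_neg_imp_decreasing_open[OF that(2)])
    show "\<exists>y. DERIV k t :> y \<and> y < 0" if "u < t" "t < v" for t
      using derk[of t] kleft[of t] that \<open>0 \<le> u\<close> \<open>v \<le> x 1\<close> by (intro exI[of _ "k' t"]) auto
    show "continuous_on {u..v} k" by (rule continuous_on_subset[OF contk]) (use that in auto)
  qed
  have decr_right: "(- 1) ^ m * k v < (- 1) ^ m * k u" if "x m < u" "u < v" for u v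
  proof (rule DERIV_neg_imp_decreasing_open[OF that(2), where f = "\<lambda>t. (- 1) ^ m * k t"])
    have u0: "0 < u" using xpos[of m] that by simp
    show "\<exists>y. DERIV (\<lambda>t. (- 1) ^ m * k t) t :> y \<and> y < 0" if "u < t" "t < v" for t
      using derk[of t] kright[of t] that u0 \<open>x m < u\<close>
      by (intro exI[of _ "(- 1) ^ m * k' t"] conjI DERIV_cmult) auto
    show "continuous_on {u..v} (\<lambda>t. (- 1) ^ m * k t)"
      by (intro continuous_intros continuous_on_subset[OF contk]) (use u0 in auto)
  qed
  have abs_m: "\<bar>y\<bar> = \<bar>(- 1) ^ m * y\<bar>" for y :: real by (simp add: abs_mult)
  have "inj_on x {..Suc m}" by (rule inj_on_of_steps) (rule inc)
  then have inj: "inj_on x {1..m}" by (rule inj_on_subset) auto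
  have derq: "(q has_field_derivative
      (poly (map_poly of_real (pderiv Q)) w - of_real s * w powr (of_real s - 1))) (at w)"
    if "w \<notin> \<real>\<^sub>\<le>\<^sub>0" for w
    using quasi_poly_complex_has_derivative[OF that, of Q "- 1" s] by (simp add: q_def)
  then have derg: "deriv g w = of_real c * (poly (map_poly of_real (pderiv Q)) w - of_real s * w powr (of_real s - 1))"
    if "w \<notin> \<real>\<^sub>\<le>\<^sub>0" for w
    unfolding g_def using that by (intro DERIV_imp_deriv DERIV_cmult)
  have holg: "g holomorphic_on - \<real>\<^sub>\<le>\<^sub>0"
    unfolding g_def q_def by (intro holomorphic_intros quasi_poly_complex_holomorphic)
  have upper: "w \<notin> \<real>\<^sub>\<le>\<^sub>0" if "0 < Im w" for w using that by (auto simp: complex_nonpos_Reals_iff)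
  have deriv_nz: "deriv g w \<noteq> 0" if w: "0 < Im w" for w
  proof -
    have R: "degree (pCons 0 (pderiv Q)) \<le> m"
      using deg m by (auto simp: degree_pCons_eq_if degree_pderiv)
    have "quasi_poly_complex (pCons 0 (pderiv Q)) (- s) s w \<noteq> 0"
    proof (rule quasi_poly_complex_nonzero[OF s _ R, where Z = "x ` {1..m}"])
      show "card (x ` {1..m}) = m" using inj by (simp add: card_image)
      show "0 < z \<and> poly (pCons 0 (pderiv Q)) z + - s * z powr s = 0" if "z \<in> x ` {1..m}" for z
      proof -
        have z: "0 < z" "quasi_poly Q s 1 z = 0" using that unfolding crit[symmetric] by auto
        then have "z * (poly (pderiv Q) z - s * z powr (s - 1)) = 0" by (simp add: quasi_poly_def)
        then show ?thesis using z(1) by (simp add: powr_diff right_diff_distrib)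
      qed
    qed (use s w in auto)
    moreover have "quasi_poly_complex (pCons 0 (pderiv Q)) (- s) s w
        = w * (poly (map_poly of_real (pderiv Q)) w - of_real s * w powr (of_real s - 1))"
    proof -
      have "w \<noteq> 0" using w by auto
      then have "w * w powr (of_real s - 1) = w powr of_real s" by (simp add: powr_diff)
      then show ?thesis
        by (simp add: quasi_poly_complex_def map_poly_pCons algebra_simps)
    qed
    ultimately show ?thesis using derg[OF upper[OF w]] c(2) by auto
  qed
  have nonconst: "\<not> g constant_on {w. 0 < Im w}"
  proof
    assume "g constant_on {w. 0 < Im w}"
    then obtain d where d: "\<And>w. 0 < Im w \<Longrightarrow> g w = d" by (auto simp: constant_on_def)
    have "(g has_field_derivative 0) (at \<i>)"
      by (rule has_field_derivative_transform_within_open[OF DERIV_const open_halfspace_Im_gt[of 0]]) (use d in auto)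
    then show False using deriv_nz[of \<i>] DERIV_imp_deriv by force
  qed
  have omits_open: "g w \<noteq> of_real y" if w: "0 < Im w" and y: "\<bar>y\<bar> < 1" for w y
  proof -
    have "\<exists>t. x j < t \<and> t < x (Suc j) \<and> k t - y = 0" if j: "j \<le> m" for j
    proof (rule real_zero_crossing)
      show "continuous_on {x j..x (Suc j)} (\<lambda>t. k t - y)"
        by (intro continuous_intros continuous_on_subset[OF contk]) (use xpos[of j] j in auto)
      show "x j < x (Suc j)" using inc j .
      show "(k (x j) - y) * (k (x (Suc j)) - y) < 0"
        using kx[of j] kx[of "Suc j"] j y by (cases "even j") (auto simp: mult_less_0_iff abs_less_iff)
    qed
    then obtain z where z: "\<And>j. j \<le> m \<Longrightarrow> x j < z j \<and> z j < x (Suc j) \<and> k (z j) = y"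
      by (metis right_minus_eq)
    have zmono: "z i < z j" if "i < j" "j \<le> m" for i j
    proof -
      have "z i < x (Suc i)" "x j < z j" using z[of i] z[of j] that by auto
      moreover have "x (Suc i) \<le> x j" using mono[of "Suc i" j] that by (cases "Suc i = j") auto
      ultimately show ?thesis by simp
    qed
    have injz: "inj_on z {..<m}"
    proof (intro inj_onI)
      fix i j assume ij: "i \<in> {..<m}" "j \<in> {..<m}" "z i = z j"
      show "i = j" using zmono[of i j] zmono[of j i] ij by (cases i j rule: linorder_cases) auto
    qed
    define S where "S = Q - [:y / c:]"
    have "quasi_poly_complex S (- 1) s w \<noteq> 0"
    proof (rule quasi_poly_complex_nonzero[OF s, where Z = "z ` {..<m}"])
      show "degree S \<le> m" unfolding S_def using deg by (intro degree_diff_le) auto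
      show "card (z ` {..<m}) = m" using injz by (simp add: card_image)
      show "0 < t \<and> poly S t + - 1 * t powr s = 0" if "t \<in> z ` {..<m}" for t
      proof -
        obtain j where "j < m" "t = z j" using \<open>t \<in> z ` {..<m}\<close> by auto
        then have j: "j \<le> m" "t = z j" by auto
        have "k t = y" "x j < t" using z[OF j(1)] j(2) by auto
        moreover from this have "0 < t" using xpos[of j] j(1) by simp
        ultimately show ?thesis using c(2) by (simp add: S_def k_def quasi_poly_0 field_simps)
      qed
    qed (use w in auto)
    moreover have "map_poly complex_of_real S = map_poly of_real Q - [:of_real (y / c):]"
      unfolding S_def by (intro poly_eqI) (simp add: coeff_map_poly coeff_pCons split: nat.split)
    then have Sw: "poly (map_poly complex_of_real S) w = poly (map_poly of_real Q) w - of_real (y / c)" by simp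
    have "of_real c * quasi_poly_complex S (- 1) s w = g w - of_real y"
      using c(2) unfolding g_def q_def quasi_poly_complex_def Sw by (simp add: algebra_simps)
    ultimately show ?thesis using c(2) by auto
  qed
  show ?thesis
    unfolding q_def[symmetric] g_def[symmetric] k_def[symmetric] k'_def[symmetric]
  proof (unfold_locales)
    show "continuous_on {w. 0 \<le> Im w} g"
      unfolding g_def q_def by (intro continuous_intros quasi_poly_complex_continuous s)
    show "g holomorphic_on - \<real>\<^sub>\<le>\<^sub>0" by (rule holg)
    show "filterlim g at_infinity at_infinity"
    proof -
      have "((\<lambda>w. of_real c * (q w / w ^ m)) \<longlongrightarrow> of_real c * of_real (coeff Q m)) at_infinity"
        unfolding q_def by (intro tendsto_intros quasi_poly_complex_over_power deg s)
      moreover have "coeff Q m \<noteq> 0" using signs(1) m by auto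
      then have "of_real c * of_real (coeff Q m) \<noteq> (0 :: complex)" using c(2) by simp
      moreover have "filterlim (\<lambda>w::complex. w ^ m) at_infinity at_infinity"
        using m by (intro Polynomial.filterlim_power_at_infinity) simp
      ultimately have "filterlim (\<lambda>w. of_real c * (q w / w ^ m) * w ^ m) at_infinity at_infinity"
        by (rule tendsto_mult_filterlim_at_infinity)
      moreover have "eventually (\<lambda>w. of_real c * (q w / w ^ m) * w ^ m = g w) at_infinity"
        unfolding eventually_at_infinity by (intro exI[of _ 1]) (auto simp: g_def)
      ultimately show ?thesis using filterlim_cong by force
    qed
    show "deriv g w \<noteq> 0" if "0 < Im w" for w using deriv_nz that .
    show "g w \<noteq> of_real y" if w: "0 < Im w" and y: "\<bar>y\<bar> \<le> 1" for w y
    proof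
      assume eq: "g w = of_real y"
      have "open (g ` {w. 0 < Im w})"
        by (rule open_mapping_thm[OF holomorphic_on_subset[OF holg] _ _ _ _ nonconst])
           (use upper in \<open>auto intro: open_halfspace_Im_gt convex_connected convex_halfspace_Im_gt\<close>)
      then obtain e where e: "0 < e" "ball (of_real y) e \<subseteq> g ` {w. 0 < Im w}"
        using w eq by (metis (mono_tags, lifting) imageI mem_Collect_eq open_contains_ball)
      \<comment> \<open>Move from \<open>y\<close> towards \<open>0\<close>, far enough to enter \<open>(-1, 1)\<close> but within the ball.\<close>
      define d where "d = min (e / 2) (1 / 2)"
      define y' where "y' = y - d * (if 0 \<le> y then 1 else - 1)"
      have d: "0 < d" "d < e" "d \<le> 1 / 2" using e(1) by (auto simp: d_def)
      have "\<bar>y'\<bar> < 1" using y d by (auto simp: y'_def)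
      moreover have "dist (of_real y :: complex) (of_real y') < e"
        using d unfolding dist_of_real by (auto simp: y'_def dist_real_def)
      then have "of_real y' \<in> g ` {w. 0 < Im w}" by (intro subsetD[OF e(2)]) simp
      then obtain v where "0 < Im v" "g v = of_real y'" by auto
      ultimately show False using omits_open by blast
    qed
    show "g (of_real t) = of_real (k t)" if "0 \<le> t" for t
      using quasi_poly_complex_of_real[OF that, of Q "- 1" s]
      by (simp add: g_def q_def k_def quasi_poly_0)
    show "deriv g (of_real t) = of_real (k' t)" if t: "0 < t" for t
    proof -
      have "(of_real t :: complex) powr (of_real s - 1) = of_real (t powr (s - 1))"
        using t powr_of_real[of t "s - 1"] by simp
      then show ?thesis using derg[of "of_real t"] t by (simp add: k'_def quasi_poly_def)
    qed
    show "0 < m" "0 < x 0" "\<And>j. j \<le> m \<Longrightarrow> x j < x (Suc j)" by (fact m x0 inc)+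
    show "k (x j) = (- 1) ^ j" if "j \<le> Suc m" for j using kx that .
    show "\<bar>k t\<bar> < 1 \<and> (- 1) ^ j * k' t < 0" if t: "j \<le> m" "x j < t" "t < x (Suc j)" for j t
    proof
      show "(- 1) ^ j * k' t < 0" using kmid t .
      have b: "x 0 \<le> t" "t \<le> x (Suc m)"
        using mono[of 0 j] mono[of "Suc j" "Suc m"] t by (cases "j = 0"; cases "j = m"; force)+
      have "t \<notin> x ` {..Suc m}"
      proof
        assume "t \<in> x ` {..Suc m}"
        then obtain i where i: "i \<le> Suc m" "t = x i" by (auto simp del: atMost_Suc)
        have "x i \<le> x j \<or> x (Suc j) \<le> x i"
          by (rule no_point_inside_step[where m = m]) (use inc i(1) t(1) in auto)
        then show False using t(2,3) i(2) by auto
      qed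
      then have "\<bar>quasi_poly Q s 0 t\<bar> \<noteq> E" using b unfolding ext[symmetric] by simp
      then have "\<bar>quasi_poly Q s 0 t\<bar> < E" using le[OF b] by simp
      moreover have "\<bar>k t\<bar> = \<bar>quasi_poly Q s 0 t\<bar> / E"
        using sg E by (auto simp: k_def c(1) abs_mult)
      ultimately show "\<bar>k t\<bar> < 1" using E by simp
    qed
    show "1 < k t \<and> k t \<le> k 0" if t: "0 \<le> t" "t < x 0" for t
    proof
      have "x 0 < x 1" using inc[of 0] by simp
      then show "1 < k t" using decr[OF t] kx[of 0] by simp
      show "k t \<le> k 0" using decr[of 0 t] t \<open>x 0 < x 1\<close> by (cases "t = 0") auto
    qed
    show "1 < \<bar>k t\<bar> \<and> k' t \<noteq> 0" if t: "x (Suc m) < t" for t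
    proof
      have "(- 1) ^ m * k t < (- 1) ^ m * k (x (Suc m))" using decr_right[OF inc[OF order_refl] t] .
      also have "\<dots> = - 1" using kx[of "Suc m"] by (simp add: power_mult_distrib[symmetric])
      finally show "1 < \<bar>k t\<bar>" unfolding abs_m[of "k t"] by simp
      show "k' t \<noteq> 0" using kright[of t] inc[OF order_refl] t by force
    qed
    show "inj_on k {x (Suc m)<..}"
    proof (intro inj_onI)
      fix u v assume uv: "u \<in> {x (Suc m)<..}" "v \<in> {x (Suc m)<..}" "k u = k v"
      then have "x m < u" "x m < v" using inc[of m] by auto
      then show "u = v" using decr_right[of u v] decr_right[of v u] uv(3)
        by (cases u v rule: linorder_cases) auto
    qed
    show "0 < \<bar>sin (pi * s)\<bar> / E" using sin_pi_noninteger[OF s(1,3)] E by simp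
    show "0 < s" by (rule s)
    show "Im (g (- of_real r)) = - (\<bar>sin (pi * s)\<bar> / E) * r powr s" if "0 < r" for r
    proof -
      have "Im (g (- of_real r)) = c * (- 1 * r powr s * sin (pi * s))"
        using Im_quasi_poly_complex_minus[OF that, of Q "- 1" s] by (simp add: g_def q_def)
      also have "\<dots> = - ((\<sigma> * sin (pi * s)) / E) * r powr s" by (simp add: c(1))
      also have "\<sigma> * sin (pi * s) = \<bar>sin (pi * s)\<bar>"
        unfolding \<sigma>_def using sgn_floor_sin[of s] s(1) by simp
      finally show ?thesis .
    qed
  qed
qed

section \<open>From the upper half-plane to the quadrant\<close>

lemma square_first_quadrant: "bij_betw (\<lambda>z. z\<^sup>2) first_quadrant {w. 0 < Im w}"
  unfolding bij_betw_def
proof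
  show "inj_on (\<lambda>z. z\<^sup>2) first_quadrant"
  proof (intro inj_onI)
    fix z w assume *: "z \<in> first_quadrant" "w \<in> first_quadrant" "z\<^sup>2 = w\<^sup>2"
    then have "z = w \<or> z = - w" by (simp add: power2_eq_iff)
    then show "z = w" using *(1,2) by (auto simp: first_quadrant_def)
  qed
  show "(\<lambda>z. z\<^sup>2) ` first_quadrant = {w. 0 < Im w}"
  proof (intro equalityI subsetI)
    fix w assume "w \<in> (\<lambda>z. z\<^sup>2) ` first_quadrant"
    then show "w \<in> {w. 0 < Im w}" by (auto simp: first_quadrant_def Im_power2)
  next
    fix w :: complex assume "w \<in> {w. 0 < Im w}"
    then have "0 < Im ((csqrt w)\<^sup>2)" by simp
    then have "0 < Re (csqrt w) * Im (csqrt w)" by (simp only: Im_power2)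
    moreover have "0 \<le> Re (csqrt w)" by (rule Re_csqrt)
    ultimately have "csqrt w \<in> first_quadrant" by (auto simp: first_quadrant_def zero_less_mult_iff)
    then show "w \<in> (\<lambda>z. z\<^sup>2) ` first_quadrant" by (intro image_eqI[of _ _ "csqrt w"]) simp_all
  qed
qed

lemma closure_first_quadrant: "closure first_quadrant \<subseteq> {z. 0 \<le> Re z \<and> 0 \<le> Im z}"
proof (rule closure_minimal)
  have "{z. 0 \<le> Re z \<and> 0 \<le> Im z} = {z. 0 \<le> Re z} \<inter> {z. 0 \<le> Im z}" by auto
  then show "closed {z. 0 \<le> Re z \<and> 0 \<le> Im z}"
    by (simp add: closed_Int closed_halfspace_Re_ge closed_halfspace_Im_ge)
qed (auto simp: first_quadrant_def)

lemma square_closure_first_quadrant: "z \<in> closure first_quadrant \<Longrightarrow> 0 \<le> Im (z\<^sup>2)"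
  using closure_first_quadrant by (force simp: Im_power2)

text \<open>In the first quadrant the argument stays below \<open>\<pi> / 2\<close>, so squaring does not leave the principal branch.\<close>

lemma powr_square_first_quadrant:
  assumes "z \<in> first_quadrant"
  shows "(z\<^sup>2) powr of_real (p / 2) = z powr of_real p"
proof -
  have z: "0 < Re z" "z \<noteq> 0" using assms by (auto simp: first_quadrant_def)
  have "\<bar>Im (Ln z)\<bar> < pi / 2" using Re_Ln_pos_lt_imp[OF z(1)] .
  then have "Ln (exp (2 * Ln z)) = 2 * Ln z" by (intro Ln_exp) auto
  moreover have "exp (2 * Ln z) = z\<^sup>2" using z(2) exp_double[of "Ln z"] by simp
  ultimately have "Ln (z\<^sup>2) = 2 * Ln z" by simp
  then show ?thesis using z(2) by (simp add: powr_def)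
qed

lemma filterlim_square_quadrant:
  "filterlim (\<lambda>z. z\<^sup>2) (inf at_infinity (principal {w. 0 \<le> Im w}))
    (inf at_infinity (principal (closure first_quadrant)))"
  unfolding filterlim_inf filterlim_principal
proof
  have "filterlim (\<lambda>z::complex. z\<^sup>2) at_infinity at_infinity"
    by (rule Polynomial.filterlim_power_at_infinity) simp
  then show "filterlim (\<lambda>z::complex. z\<^sup>2) at_infinity (inf at_infinity (principal (closure first_quadrant)))"
    by (rule filterlim_mono) auto
  show "eventually (\<lambda>z. z\<^sup>2 \<in> {w. 0 \<le> Im w}) (inf at_infinity (principal (closure first_quadrant)))"
    unfolding eventually_inf_principal by (auto simp: square_closure_first_quadrant)
qed

theorem theorem5p1:
  fixes a p :: real and m :: nat and P :: "real poly"
  assumes "0 < a" and "a < 1" and "0 < m"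
    and "0 < p" and "p < 2 * real m" and "\<And>k :: int. p \<noteq> 2 * real_of_int k"
    and "best_approx (2 * m) p a P"
  shows "\<exists>\<gamma> \<Omega> \<phi>.
    \<gamma> homeomorphic (UNIV :: real set) \<and>
    \<gamma> \<subseteq> half_strip m \<and>
    bounded_on_left_by m \<gamma> \<Omega> \<and>
    normalized_conformal_map m a \<Omega> \<phi> \<and>
    (\<forall>z\<in>first_quadrant.
       poly (map_poly complex_of_real P) z =
         z powr of_real p
         + (- 1) ^ nat \<lfloor>p / 2\<rfloor> * of_real (approx_error (2 * m) p a) * cos (\<phi> z)) \<and>
    \<gamma> = {\<phi> (\<i> * of_real y) |y. y > 0} \<and>
    (\<forall>y > 0. approx_error (2 * m) p a
               * sin (Re (\<phi> (\<i> * of_real y))) * sinh (Im (\<phi> (\<i> * of_real y)))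
             = \<bar>sin (pi * p / 2)\<bar> * y powr p)"
proof -
  define s where "s = p / 2"
  define E where "E = approx_error (2 * m) p a"
  have s: "0 < s" "s < real m" using assms by (auto simp: s_def)
  have s_nat: "s \<noteq> real i" for i
    using assms(6)[of "int i"] by (simp add: s_def)
  obtain Q x where Q: "P = pcompose Q [:0, 0, 1:]" "degree Q \<le> m" "0 < E"
    "x 0 = a\<^sup>2" "x (Suc m) = 1" "\<And>j. j \<le> m \<Longrightarrow> x j < x (Suc j)"
    "{t. 0 < t \<and> quasi_poly Q s 1 t = 0} = x ` {1..m}"
    "{t. a\<^sup>2 \<le> t \<and> t \<le> 1 \<and> \<bar>quasi_poly Q s 0 t\<bar> = E} = x ` {..Suc m}"
    "\<And>t. a\<^sup>2 \<le> t \<Longrightarrow> t \<le> 1 \<Longrightarrow> \<bar>quasi_poly Q s 0 t\<bar> \<le> E"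
    using best_approx_even[OF assms(1,2) s_nat[unfolded s_def] assms(7)] unfolding s_def E_def by blast
  define c where "c = (- 1) ^ nat \<lfloor>s\<rfloor> / E"
  define g where "g w = of_real c * quasi_poly_complex Q (- 1) s w" for w
  define \<kappa> where "\<kappa> = \<bar>sin (pi * s)\<bar> / E"
  have cE: "of_real (((- 1) ^ nat \<lfloor>s\<rfloor>) * E * c) = (1 :: complex)"
    using Q(3) by (simp add: c_def power_mult_distrib[symmetric])
  interpret alternating_map g "\<lambda>t. c * quasi_poly Q s 0 t" "\<lambda>t. c * quasi_poly Q s 1 t" x m \<kappa> s
    unfolding g_def c_def \<kappa>_def
    by (rule alternating_error_map[OF assms(3) s s_nat Q(2,3) _ Q(6,7)]) (use Q assms(1) in auto)
  obtain \<phi> where phi: "continuous_on {w. 0 \<le> Im w} \<phi>" "\<phi> holomorphic_on {w. 0 < Im w}"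
    "\<And>w. 0 \<le> Im w \<Longrightarrow> cos (\<phi> w) = g w" "\<And>w. 0 < Im w \<Longrightarrow> 0 < Im (\<phi> w)" "\<phi> (of_real (x 0)) = 0"
    using arccos_branch_exists by auto
  interpret alternating_map_branch g "\<lambda>t. c * quasi_poly Q s 0 t" "\<lambda>t. c * quasi_poly Q s 1 t" x m \<kappa> s \<phi>
    by unfold_locales (fact phi)+
  define \<psi> where "\<psi> z = \<phi> (z\<^sup>2)" for z
  have psi_i: "\<psi> (\<i> * of_real y) = \<phi> (- of_real (y\<^sup>2))" for y
    by (simp add: \<psi>_def power_mult_distrib)
  have gam: "\<gamma> = {\<psi> (\<i> * of_real y) |y. y > 0}"
  proof (intro equalityI subsetI)
    fix \<zeta> assume "\<zeta> \<in> \<gamma>"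
    then obtain r where r: "0 < r" "\<zeta> = \<phi> (- of_real r)" by auto
    then have "\<zeta> = \<psi> (\<i> * of_real (sqrt r))" "0 < sqrt r" unfolding psi_i by auto
    then show "\<zeta> \<in> {\<psi> (\<i> * of_real y) |y. y > 0}" by blast
  next
    fix \<zeta> assume "\<zeta> \<in> {\<psi> (\<i> * of_real y) |y. y > 0}"
    then obtain y where y: "0 < y" "\<zeta> = \<psi> (\<i> * of_real y)" by auto
    then have "\<zeta> = \<phi> (- of_real (y\<^sup>2))" "0 < y\<^sup>2" unfolding psi_i by auto
    then show "\<zeta> \<in> \<gamma>" by blast
  qed
  have strip: "half_strip m = strip" by (simp add: half_strip_def)
  have image: "\<Omega> = \<psi> ` first_quadrant"
    using square_first_quadrant unfolding \<psi>_def bij_betw_def by (metis image_image)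
  show ?thesis
  proof (intro exI conjI ballI allI impI)
    show "\<gamma> homeomorphic (UNIV :: real set)" by (rule gamma_homeomorphic)
    show "\<gamma> \<subseteq> half_strip m" unfolding strip by (rule gamma_strip)
    show "bounded_on_left_by m \<gamma> \<Omega>"
      unfolding bounded_on_left_by_def strip
      by (intro conjI Omega_component frontier_Omega_strip right_edge left_edge)
    show "normalized_conformal_map m a \<Omega> \<psi>"
      unfolding normalized_conformal_map_def
    proof (intro conjI)
      have sub: "(\<lambda>z. z\<^sup>2) ` first_quadrant \<subseteq> {w. 0 < Im w}"
        using square_first_quadrant by (simp add: bij_betw_def)
      show "\<psi> holomorphic_on first_quadrant"
        unfolding \<psi>_def using holomorphic_on_compose_gen[OF _ hol sub] 
        by (simp add: comp_def holomorphic_on_power)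
      show "bij_betw \<psi> first_quadrant \<Omega>"
        unfolding \<psi>_def using bij_betw_trans[OF square_first_quadrant inj_on_imp_bij_betw[OF inj_phi]]
        by (simp add: comp_def)
      show "continuous_on (closure first_quadrant) \<psi>"
        unfolding \<psi>_def
        by (intro continuous_on_compose2[OF cont] continuous_intros) (auto simp: square_closure_first_quadrant)
      show "\<psi> (of_real a) = 0" using phi(5) Q(4) by (simp add: \<psi>_def)
      show "\<psi> 1 = of_real (real (m + 1) * pi)" using phi_x[of "Suc m"] Q(5) by (simp add: \<psi>_def)
      show "filterlim \<psi> at_infinity (inf at_infinity (principal (closure first_quadrant)))"
        unfolding \<psi>_def by (rule filterlim_compose[OF phi_infinity filterlim_square_quadrant])
    qed
    show "poly (map_poly complex_of_real P) z = z powr of_real p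
         + (- 1) ^ nat \<lfloor>p / 2\<rfloor> * of_real (approx_error (2 * m) p a) * cos (\<psi> z)"
      if z: "z \<in> first_quadrant" for z
    proof -
      have "0 \<le> Im (z\<^sup>2)" using z by (simp add: first_quadrant_def Im_power2)
      then have "cos (\<psi> z) = of_real c * quasi_poly_complex Q (- 1) s (z\<^sup>2)"
        unfolding \<psi>_def by (simp add: cos_phi g_def)
      then have "(- 1) ^ nat \<lfloor>s\<rfloor> * of_real E * cos (\<psi> z)
          = of_real (((- 1) ^ nat \<lfloor>s\<rfloor>) * E * c) * quasi_poly_complex Q (- 1) s (z\<^sup>2)"
        by simp
      also have "\<dots> = poly (map_poly of_real Q) (z\<^sup>2) - (z\<^sup>2) powr of_real s"
        unfolding cE by (simp add: quasi_poly_complex_def)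
      also have "(z\<^sup>2) powr of_real s = z powr of_real p"
        unfolding s_def by (rule powr_square_first_quadrant[OF z])
      also have "poly (map_poly of_real Q) (z\<^sup>2) = poly (map_poly complex_of_real P) z"
        unfolding Q(1) by (rule poly_map_poly_square[symmetric])
      finally show ?thesis unfolding s_def[symmetric] E_def[symmetric] by simp
    qed
    show "\<gamma> = {\<psi> (\<i> * of_real y) |y. y > 0}" by (rule gam)
    show "approx_error (2 * m) p a * sin (Re (\<psi> (\<i> * of_real y))) * sinh (Im (\<psi> (\<i> * of_real y)))
             = \<bar>sin (pi * p / 2)\<bar> * y powr p" if y: "0 < y" for y
    proof -
      have "y\<^sup>2 powr s = y powr p"
        using y powr_powr[of y 2 s] by (simp add: s_def powr_numeral)
      then have "sin (Re (\<psi> (\<i> * of_real y))) * sinh (Im (\<psi> (\<i> * of_real y))) = \<kappa> * y powr p"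
        using phi_minus(1)[of "y\<^sup>2"] y unfolding psi_i by simp
      then have "E * (sin (Re (\<psi> (\<i> * of_real y))) * sinh (Im (\<psi> (\<i> * of_real y)))) = \<bar>sin (pi * s)\<bar> * y powr p"
        using Q(3) by (simp add: \<kappa>_def)
      then show ?thesis by (simp add: E_def s_def mult.assoc)
    qed
  qed
qed

end
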